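(* For every integer $n\geq 12602987$, $$ \overline{\Upsilon}(n)<\log n\,\log\log n+\frac{380537}{17966}\log n+1. $$
   Context: Here $\log$ is the natural logarithm. For a positive integer $n$ and a prime $p$, $v_p(n!)$ denotes the exponent of $p$ in the prime factorization of $n!$. Put $$\Upsilon(n)=\sum_{p\leq n}v_p(n!),\qquad \overline{\Upsilon}(n)=\frac{\Upsilon(n)}{\pi(n)},$$ the sum being over primes $p\le n$, where $\pi(n)$ is the number of primes not exceeding $n$ (so $\overline{\Upsilon}(n)$ is the mean of $v_p(n!)$ over primes $p\le n$). *)

theory Defs
  imports Complex_Main "HOL-Computational_Algebra.Primes"
begin

definition prime_pi :: "nat \<Rightarrow> nat" where
  "prime_pi n = card {p. prime p \<and> p \<le> n}"

definition Upsilon :: "nat \<Rightarrow> nat" where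
  "Upsilon n = (\<Sum>p\<in>{p. prime p \<and> p \<le> n}. multiplicity p (fact n :: nat))"

definition Upsilon_mean :: "nat \<Rightarrow> real" where
  "Upsilon_mean n = real (Upsilon n) / real (prime_pi n)"

end

theory Submission
  imports Defs "HOL-Number_Theory.Prime_Powers" "HOL-Complex_Analysis.Complex_Analysis"
begin

text \<open>
  Write \<open>L = ln (ln n)\<close>. The numerator of the mean is elementary: \<open>v_p(n!) \<le> n / (p - 1)\<close>, and an explicit
  form of Mertens' theorem for \<open>\<Sum> 1 / p\<close> gives \<open>Upsilon n \<le> n (L + 7)\<close> (lemma \<open>Upsilon_le\<close>). With
  Chebyshev's function \<open>\<psi>\<close>, the sum of the von Mangoldt function \<open>\<Lambda>\<close>, one has \<open>\<psi>(n) \<le> \<pi>(n) ln n\<close>. So the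
  claim holds as soon as \<open>\<psi>(n) \<ge> c n\<close> for some \<open>c\<close> with \<open>c (L + 21.18) \<ge> L + 7\<close>.

  For \<open>L \<le> 125\<close> the value \<open>c = 0.905\<close> from Chebyshev's elementary method is good enough. For large \<open>L\<close>
  no fixed \<open>c < 1\<close> is: the main terms on both sides agree, and the statement contains a form of the
  prime number theorem with a relative error of order \<open>1 / ln (ln n)\<close> and an explicit constant. On the
  other hand \<open>ln n \<ge> exp 125\<close> for \<open>L \<ge> 125\<close>, so saving a small power of \<open>ln n\<close> is plenty, even with
  enormous constants. What is proved is \<open>\<psi>(n) \<ge> (1 - 12 / \<tau>) n\<close> with \<open>\<tau> = (ln n) powr (1 / 24)\<close>
  (lemma \<open>chebyshev_psi_asymptotic_lower\<close>), in two steps.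

  First, bounds to the right of the line \<open>Re s = 1\<close>. The function \<open>(s - 1) \<zeta>(s)\<close> is continued to
  \<open>Re s > 1/2\<close> as a series, which shows that \<open>\<zeta>\<close> without its pole grows at most like a square root of the
  height. The inequality
  \<open>3 + 4 cos x + cos 2x \<ge> 0\<close> bounds \<open>\<zeta>\<close> from below. Together they show that
  \<open>G(s) = \<Sum> (\<Lambda>(n) - 1) n^(-s) = - \<zeta>'(s)/\<zeta>(s) - \<zeta>(s)\<close> and \<open>G'\<close> are at most a constant times \<open>T ^ 5\<close> for
  \<open>1 < Re s \<le> 2\<close> and \<open>\<bar>Im s\<bar> \<le> T\<close>, uniformly up to the line (lemmas \<open>norm_mangoldt_defect_le\<close> and
  \<open>norm_mangoldt_defect'_le\<close>).

  Second, a Tauberian argument with a kernel whose Fourier transform has support in \<open>[-T, T]\<close>. Weighting the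
  coefficients \<open>\<Lambda>(n) - 1\<close> with it gives an integral of \<open>G(s) / s\<close> over a segment of height \<open>T\<close> against
  \<open>exp (i T v t)\<close>, where \<open>v\<close> is close to \<open>ln n\<close>; one integration by parts makes it \<open>O(T ^ 5 / v)\<close>
  (lemma \<open>smoothed_sum_limit\<close>). The weight is decreasing, and minus its derivative is, up to a power of
  the argument, a Fejer kernel concentrated in a window of logarithmic length \<open>1 / T\<close> about \<open>exp v\<close>. Partial summation and the
  monotonicity of \<open>\<psi>\<close> then yield the lower bound for \<open>\<psi>\<close>
  (lemma \<open>chebyshev_psi_lower_smoothed\<close>), and \<open>T = \<tau>\<^sup>2\<close> balances the errors.
\<close>

section \<open>Chebyshev's function, Mertens' theorem and the size of Upsilon\<close>

definition chebyshev_psi :: "nat \<Rightarrow> real" where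
  "chebyshev_psi n = (\<Sum>d=1..n. mangoldt d)"

lemma Suc_div_eq: "Suc n div d = n div d + (if d dvd Suc n then 1 else 0)" if "d > 0"
  using that by (auto simp: div_Suc dvd_eq_mod_eq_0)

text \<open>Passing from \<open>n\<close> to \<open>n + 1\<close>, the quotient \<open>n div d\<close> grows exactly at the divisors \<open>d\<close> of \<open>n + 1\<close>, and
  the values of the von Mangoldt function at these sum to \<open>ln (n + 1)\<close>. The free upper limit \<open>N\<close> allows
  comparing factorials of different numbers in one sum.\<close>

lemma ln_fact_eq_sum_mangoldt:
  assumes "n \<le> N"
  shows "ln (fact n) = (\<Sum>d=1..N. mangoldt d * real (n div d))"
  using assms
proof (induction n)
  case 0
  then show ?case by simp
next
  case (Suc n)
  have "ln (fact (Suc n) :: real) = ln (real (Suc n)) + ln (fact n)"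
    by (simp add: ln_mult del: of_nat_Suc)
  also have "ln (real (Suc n)) = (\<Sum>d | d dvd Suc n. mangoldt d)"
    using mangoldt_sum[of "Suc n", where ?'a = real] by simp
  also have "{d. d dvd Suc n} = {d\<in>{1..N}. d dvd Suc n}"
    using Suc.prems by (auto dest: dvd_imp_le intro: Nat.gr0I intro!: Suc_leI)
  also have "(\<Sum>d | d \<in> {1..N} \<and> d dvd Suc n. mangoldt d) = (\<Sum>d=1..N. if d dvd Suc n then mangoldt d else (0::real))"
    by (subst sum.inter_filter) auto
  also have "ln (fact n :: real) = (\<Sum>d=1..N. mangoldt d * real (n div d))"
    using Suc by simp
  also have "(\<Sum>d=1..N. if d dvd Suc n then mangoldt d else (0::real)) + (\<Sum>d=1..N. mangoldt d * real (n div d))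
     = (\<Sum>d=1..N. mangoldt d * real (Suc n div d))"
    unfolding sum.distrib[symmetric]
    by (intro sum.cong refl) (auto simp: Suc_div_eq algebra_simps)
  finally show ?case .
qed

text \<open>Since \<open>1/2 + 1/3 + 1/5 - 1/30 = 1\<close>, the difference of both sides depends on \<open>m mod 30\<close> only, which
  leaves thirty cases.\<close>

lemma chebyshev_weight_le_one:
  "m + m div 30 \<le> 1 + m div 2 + m div 3 + m div (5::nat)"
proof -
  define q r where "q = m div 30" and "r = m mod 30"
  have m: "m = 30 * q + r" "r < 30" by (auto simp: q_def r_def)
  have d: "m div 2 = 15 * q + r div 2" "m div 3 = 10 * q + r div 3" "m div 5 = 6 * q + r div 5" "m div 30 = q"
    using m by auto
  have "\<forall>r\<in>set [0..<30]. r \<le> 1 + r div 2 + r div 3 + r div (5::nat)"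
    by code_simp
  then have "r \<le> 1 + r div 2 + r div 3 + r div 5" using m by auto
  then show ?thesis using d m by simp
qed

text \<open>Chebyshev's classical combination: the von Mangoldt function is counted with the weights
  of \<open>chebyshev_weight_le_one\<close> at \<open>n div d\<close>, which never exceed one.\<close>

lemma chebyshev_psi_ge_ln_fact:
  "chebyshev_psi n \<ge> ln (fact n) - ln (fact (n div 2)) - ln (fact (n div 3)) - ln (fact (n div 5)) + ln (fact (n div 30))"
proof -
  have T: "ln (fact (n div k)) = (\<Sum>d=1..n. mangoldt d * real ((n div d) div k))" for k
    by (subst ln_fact_eq_sum_mangoldt[where N = n])
       (auto simp: div_mult2_eq[symmetric] mult.commute)
  have "mangoldt d \<ge> mangoldt d * real (n div d) - mangoldt d * real (n div d div 2) - mangoldt d * real (n div d div 3)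
        - mangoldt d * real (n div d div 5) + mangoldt d * real (n div d div 30)" for d
  proof -
    have "real (n div d + n div d div 30) \<le> real (1 + n div d div 2 + n div d div 3 + n div d div 5)"
      using chebyshev_weight_le_one[of "n div d"] by (simp only: of_nat_le_iff)
    then have "mangoldt d * (real (n div d) - real (n div d div 2) - real (n div d div 3)
        - real (n div d div 5) + real (n div d div 30)) \<le> mangoldt d * 1"
      by (intro mult_left_mono mangoldt_nonneg) auto
    then show ?thesis by (simp add: algebra_simps)
  qed
  then have "(\<Sum>d=1..n. mangoldt d) \<ge> (\<Sum>d=1..n. mangoldt d * real (n div d) - mangoldt d * real (n div d div 2) - mangoldt d * real (n div d div 3)
        - mangoldt d * real (n div d div 5) + mangoldt d * real (n div d div 30))"
    by (intro sum_mono) auto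
  then show ?thesis
    unfolding chebyshev_psi_def T ln_fact_eq_sum_mangoldt[of n n, OF order_refl] 
    by (simp add: sum.distrib sum_subtractf)
qed

definition stirling_main :: "real \<Rightarrow> real" where
  "stirling_main x = x * ln x - x"

text \<open>The derivative of \<open>x ln x - x\<close> is \<open>ln x\<close>.\<close>

lemma stirling_main_mono:
  assumes "1 \<le> x" "x \<le> y"
  shows "stirling_main x \<le> stirling_main y"
proof -
  have "1 - x / y \<le> ln (y / x)"
    using ln_le_minus_one[of "x / y"] assms by (simp add: ln_div)
  then have "y * (1 - x / y) \<le> y * ln (y / x)"
    using assms by (intro mult_left_mono) auto
  then have "y - x \<le> y * ln y - y * ln x"
    using assms by (simp add: ln_div algebra_simps)
  moreover have "x * ln x \<le> y * ln x" using assms by (intro mult_right_mono) auto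
  ultimately show ?thesis by (simp add: stirling_main_def)
qed

lemma ln_fact_ge_stirling_main:
  assumes "m \<ge> 1"
  shows "stirling_main (real m) \<le> ln (fact m)"
  using assms
proof (induction m rule: nat_induct_at_least)
  case base
  then show ?case by (simp add: stirling_main_def)
next
  case (Suc m)
  have "ln (1 + 1 / real m) \<le> 1 / real m" by (rule ln_add_one_self_le_self) auto
  moreover have "1 + 1 / real m = real (Suc m) / real m" using Suc by (simp add: field_simps)
  ultimately have "real m * ln (real (Suc m) / real m) \<le> 1"
    using Suc by (simp add: field_simps)
  then have "real m * ln (real (Suc m)) - real m * ln (real m) \<le> 1"
    using Suc by (simp add: ln_div algebra_simps)
  moreover have "ln (fact (Suc m) :: real) = ln (real (Suc m)) + ln (fact m)"
    by (simp add: ln_mult del: of_nat_Suc)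
  ultimately show ?case using Suc by (simp add: stirling_main_def algebra_simps)
qed

lemma ln_fact_le_stirling_main:
  assumes "m \<ge> 1"
  shows "ln (fact m) \<le> stirling_main (real m) + ln (real m) + 1"
  using assms
proof (induction m rule: nat_induct_at_least)
  case base
  then show ?case by (simp add: stirling_main_def)
next
  case (Suc m)
  have "ln (real m / real (Suc m)) \<le> real m / real (Suc m) - 1"
    using Suc by (intro ln_le_minus_one) auto
  then have "real (Suc m) * ln (real m / real (Suc m)) \<le> - 1"
    using Suc by (simp add: field_simps)
  then have "real (Suc m) * ln (real m) - real (Suc m) * ln (real (Suc m)) \<le> - 1"
    using Suc by (subst (asm) ln_div) (auto simp: right_diff_distrib)
  moreover have "ln (fact (Suc m) :: real) = ln (real (Suc m)) + ln (fact m)"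
    by (simp add: ln_mult del: of_nat_Suc)
  ultimately show ?case using Suc by (simp add: stirling_main_def algebra_simps)
qed

text \<open>Replacing the integer \<open>n div k\<close> by the real number \<open>n / k\<close> changes Stirling's main term by no more than a
  logarithm.\<close>

lemma
  assumes "k \<ge> 1" "n \<ge> k"
  shows ln_fact_div_le: "ln (fact (n div k)) \<le> stirling_main (real n / real k) + ln (real n / real k) + 1"
    and ln_fact_div_ge: "stirling_main (real n / real k) - ln (real n / real k) - 1 \<le> ln (fact (n div k))"
proof -
  define m where "m = n div k"
  have m: "m \<ge> 1" using assms by (simp add: m_def div_greater_zero_iff Suc_le_eq)
  have m_le: "real m \<le> real n / real k" unfolding m_def by (rule of_nat_div_le_of_nat)
  have "n < Suc m * k" using assms by (metis m_def dividend_less_div_times less_one linorder_not_less mult_Suc zero_less_iff_neq_zero)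
  then have "real n < real (Suc m) * real k" by (metis of_nat_less_iff of_nat_mult)
  then have less: "real n / real k < real (Suc m)" using assms by (simp add: field_simps)
  have "ln (fact m) \<le> stirling_main (real m) + ln (real m) + 1" by (rule ln_fact_le_stirling_main[OF m])
  also have "stirling_main (real m) \<le> stirling_main (real n / real k)"
    using m m_le by (intro stirling_main_mono) auto
  also have "ln (real m) \<le> ln (real n / real k)" using m m_le by simp
  finally show "ln (fact (n div k)) \<le> stirling_main (real n / real k) + ln (real n / real k) + 1"
    by (simp add: m_def)
  have "stirling_main (real n / real k) \<le> stirling_main (real (Suc m))"
    using m m_le less by (intro stirling_main_mono) linarith+
  also have "\<dots> \<le> ln (fact (Suc m))" by (rule ln_fact_ge_stirling_main) auto
  also have "\<dots> = ln (real (Suc m)) + ln (fact m)" by (simp add: ln_mult del: of_nat_Suc)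
  also have "ln (real (Suc m)) \<le> ln (exp 1 * (real n / real k))"
  proof -
    have "real (Suc m) \<le> 2 * real m" using m by simp
    also have "2 * real m \<le> exp 1 * real m" using exp_ge_add_one_self[of "1::real"] by (intro mult_right_mono) auto
    also have "\<dots> \<le> exp 1 * (real n / real k)" using m_le by (intro mult_left_mono) auto
    finally show ?thesis by (subst ln_le_cancel_iff) (use m m_le in \<open>auto\<close>)
  qed
  also have "\<dots> = 1 + ln (real n / real k)" using assms by (subst ln_mult) auto
  finally show "stirling_main (real n / real k) - ln (real n / real k) - 1 \<le> ln (fact (n div k))"
    by (simp add: m_def)
qed

text \<open>In the combination of Stirling's main terms the contributions of \<open>n ln n\<close> and of \<open>- n\<close> cancel, because
  \<open>1 - 1/2 - 1/3 - 1/5 + 1/30 = 0\<close>. What is left is linear in \<open>n\<close>.\<close>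

lemma chebyshev_psi_ge_linear:
  assumes "n \<ge> 30"
  shows "chebyshev_psi n \<ge> (ln 2 / 2 + ln 3 / 3 + ln 5 / 5 - ln 30 / 30) * real n - 4 * ln (real n) - 4"
proof -
  have "ln (fact n) - ln (fact (n div 2)) - ln (fact (n div 3)) - ln (fact (n div 5)) + ln (fact (n div 30))
     \<ge> stirling_main n - (stirling_main (real n / real 2) + ln (real n / real 2) + 1) 
     - (stirling_main (real n / real 3) + ln (real n / real 3) + 1)
     - (stirling_main (real n / real 5) + ln (real n / real 5) + 1) + (stirling_main (real n / real 30) - ln (real n / real 30) - 1)"
    using assms
    by (intro add_mono diff_mono ln_fact_ge_stirling_main ln_fact_div_le ln_fact_div_ge) auto
  moreover have "stirling_main n - stirling_main (real n / real 2) - stirling_main (real n / real 3) - stirling_main (real n / real 5)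
     + stirling_main (real n / real 30) = (ln 2 / 2 + ln 3 / 3 + ln 5 / 5 - ln 30 / 30) * real n"
    using assms by (simp add: stirling_main_def ln_div field_simps)
  moreover have "ln (real n / real k) \<le> ln (real n)" if "k \<in> {2,3,5,30}" for k
    using that assms by (subst ln_le_cancel_iff) (auto simp: field_simps)
  from this[of 2] this[of 3] this[of 5] this[of 30]
  have "ln (real n / real 2) \<le> ln (real n)" "ln (real n / real 3) \<le> ln (real n)" 
    "ln (real n / real 5) \<le> ln (real n)" "ln (real n / real 30) \<le> ln (real n)" by simp_all
  ultimately show ?thesis using chebyshev_psi_ge_ln_fact[of n] by linarith
qed

text \<open>The true value is 0.9212...; the logarithms of 3 and 5 are reduced to \<open>ln 2\<close> by comparing powers.\<close>

lemma chebyshev_constant_ge: "ln 2 / 2 + ln 3 / 3 + ln 5 / 5 - ln 30 / (30::real) \<ge> 91 / 100"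
proof -
  have l2: "ln (2::real) \<ge> 6925 / 10000"
    using ln_approx_bounds[of 2 3] by (simp add: eval_nat_numeral)
  have l3: "19 * ln (2::real) \<le> 12 * ln 3"
  proof -
    have "ln ((2::real)^19) \<le> ln (3^12)" by (subst ln_le_cancel_iff) auto
    moreover have "ln ((2::real)^19) = 19 * ln 2" "ln ((3::real)^12) = 12 * ln 3"
      by (simp_all only: ln_realpow zero_less_numeral of_nat_numeral)
    ultimately show ?thesis by linarith
  qed
  have l5: "16 * ln (2::real) \<le> 7 * ln 5"
  proof -
    have "ln ((2::real)^16) \<le> ln (5^7)" by (subst ln_le_cancel_iff) auto
    moreover have "ln ((2::real)^16) = 16 * ln 2" "ln ((5::real)^7) = 7 * ln 5"
      by (simp_all only: ln_realpow zero_less_numeral of_nat_numeral)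
    ultimately show ?thesis by linarith
  qed
  have "ln (30::real) = ln (2 * 3 * 5)" by simp
  also have "\<dots> = ln 2 + ln 3 + ln 5" by (simp only: ln_mult) simp
  finally show ?thesis using l2 l3 l5 by linarith
qed

lemma chebyshev_psi_lower:
  assumes "n \<ge> 12602987"
  shows "chebyshev_psi n \<ge> 905 / 1000 * real n"
proof -
  have s: "sqrt (real n) \<ge> 3500" using assms by (intro real_le_rsqrt) auto
  have "ln (real n) = 2 * ln (sqrt (real n))" using assms by (simp add: ln_sqrt)
  also have "ln (sqrt (real n)) \<le> sqrt (real n)"
    using s by (intro less_imp_le ln_less_self) linarith
  finally have "ln (real n) \<le> 2 * sqrt (real n)" by simp
  moreover have "3500 * sqrt (real n) \<le> sqrt (real n) * sqrt (real n)" using s by (intro mult_right_mono) auto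
  then have "3500 * sqrt (real n) \<le> real n" by simp
  ultimately have "4 * ln (real n) + 4 \<le> 5 / 1000 * real n" using s by linarith
  moreover have "91 / 100 * real n \<le> (ln 2 / 2 + ln 3 / 3 + ln 5 / 5 - ln 30 / 30) * real n"
    using chebyshev_constant_ge by (intro mult_right_mono) auto
  ultimately show ?thesis using chebyshev_psi_ge_linear[of n] assms by linarith
qed

lemma chebyshev_psi_mono: "m \<le> n \<Longrightarrow> chebyshev_psi m \<le> chebyshev_psi n"
  unfolding chebyshev_psi_def by (intro sum_mono2 mangoldt_nonneg) auto

lemma chebyshev_psi_nonneg: "chebyshev_psi n \<ge> 0"
  unfolding chebyshev_psi_def by (intro sum_nonneg mangoldt_nonneg)

text \<open>The prime powers in \<open>(n/2, n]\<close> are visible in \<open>n! / ((n/2)!)\<^sup>2\<close>, which is essentially a binomial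
  coefficient and hence at most \<open>2 ^ n\<close> up to a factor \<open>n + 1\<close>.\<close>

lemma chebyshev_psi_halving:
  "chebyshev_psi n \<le> chebyshev_psi (n div 2) + real n * ln 2 + ln (real n + 1)"
proof -
  define m where "m = n div 2"
  have T: "ln (fact m) = (\<Sum>d=1..n. mangoldt d * real ((n div d) div 2))"
    unfolding m_def by (subst ln_fact_eq_sum_mangoldt[where N = n])
       (auto simp: div_mult2_eq[symmetric] mult.commute)
  have "(\<Sum>d\<in>{m<..n}. mangoldt d) \<le> (\<Sum>d=1..n. mangoldt d * (real (n div d) - 2 * real (n div d div 2)))"
  proof -
    have "(\<Sum>d\<in>{m<..n}. mangoldt d) = (\<Sum>d\<in>{m<..n}. mangoldt d * (real (n div d) - 2 * real (n div d div 2)))"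
    proof (intro sum.cong refl)
      fix d assume d: "d \<in> {m<..n}"
      then have "n div d = 1" unfolding m_def
        by (intro div_nat_eqI) auto
      then show "mangoldt d = mangoldt d * (real (n div d) - 2 * real (n div d div 2))" by simp
    qed
    also have "\<dots> \<le> (\<Sum>d=1..n. mangoldt d * (real (n div d) - 2 * real (n div d div 2)))"
    proof (intro sum_mono2)
      fix d
      have "2 * (n div d div 2) \<le> n div d" by simp
      then have "real (2 * (n div d div 2)) \<le> real (n div d)" by (simp only: of_nat_le_iff)
      then show "0 \<le> mangoldt d * (real (n div d) - 2 * real (n div d div 2))"
        by (intro mult_nonneg_nonneg mangoldt_nonneg) simp
    qed auto
    finally show ?thesis .
  qed
  also have "\<dots> = ln (fact n) - 2 * ln (fact m)"
    unfolding T ln_fact_eq_sum_mangoldt[of n n, OF order_refl] 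
    by (simp only: sum_subtractf right_diff_distrib sum_distrib_left mult.left_commute)
  also have "\<dots> \<le> real n * ln 2 + ln (real n + 1)"
  proof -
    have "fact m * fact (n - m) * (n choose m) = fact n" 
      by (rule binomial_fact_lemma) (simp add: m_def)
    then have "real (fact n) = real (fact m * fact (n - m) * (n choose m))" by (simp only:)
    then have "(fact n :: real) = fact m * (fact (n - m) * real (n choose m))"
      by (simp only: of_nat_mult of_nat_fact mult.assoc)
    moreover have "real (n choose m) > 0" by (simp add: m_def)
    ultimately have "ln (fact n :: real) = ln (fact m) + (ln (fact (n - m)) + ln (real (n choose m)))"
      by (simp only: ln_mult_pos fact_gt_zero mult_pos_pos)
    moreover have "ln (real (n choose m)) \<le> real n * ln 2"
    proof -
      have "(n choose m) \<le> 2 ^ n"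
        by (rule binomial_le_pow2)
      then have "real (n choose m) \<le> 2 ^ n" by (metis of_nat_le_iff of_nat_numeral of_nat_power)
      then have "ln (real (n choose m)) \<le> ln (2 ^ n)" by (subst ln_le_cancel_iff) (auto simp: m_def)
      then show ?thesis by (simp add: ln_realpow)
    qed
    moreover have "ln (fact (n - m) :: real) \<le> ln (fact m) + ln (real n + 1)"
    proof -
      have "n - m = m \<or> n - m = Suc m" unfolding m_def by linarith
      then show ?thesis
      proof
        assume "n - m = Suc m"
        then have "ln (fact (n - m) :: real) = ln (real (Suc m)) + ln (fact m)"
          by (simp add: ln_mult del: of_nat_Suc)
        moreover have "ln (real (Suc m)) \<le> ln (real n + 1)"
          by (subst ln_le_cancel_iff) (auto simp: m_def)
        ultimately show ?thesis by linarith
      qed auto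
    qed
    ultimately show ?thesis by linarith
  qed
  finally have "(\<Sum>d\<in>{m<..n}. mangoldt d) \<le> real n * ln 2 + ln (real n + 1)" .
  moreover have "chebyshev_psi n = chebyshev_psi m + (\<Sum>d\<in>{m<..n}. mangoldt d)"
  proof -
    have "{1..n} = {1..m} \<union> {m<..n}" unfolding m_def by auto
    then show ?thesis unfolding chebyshev_psi_def 
      by (simp add: sum.union_disjoint ivl_disj_int)
  qed
  ultimately show ?thesis by (simp add: m_def)
qed

lemma chebyshev_psi_upper: "chebyshev_psi n \<le> 3 * real n"
proof (induction n rule: less_induct)
  case (less n)
  show ?case
  proof (cases "n = 0")
    case True
    then show ?thesis by (simp add: chebyshev_psi_def)
  next
    case False
    then have n: "n \<ge> 1" by simp
    define h x where "h = real (n div 2)" and "x = real n"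
    \<comment> \<open>Induction needs 3/2 + ln 2 + 1/2 plus a small constant to stay below 3.\<close>
    have l2: "ln (2::real) \<le> 6935 / 10000" using ln_approx_bounds[of 2 3] by (simp add: eval_nat_numeral)
    have x: "x \<ge> 1" using n by (simp add: x_def)
    have "ln ((x + 1) / 2) \<le> (x + 1) / 2 - 1" using x by (intro ln_le_minus_one) auto
    then have "ln (x + 1) \<le> ln 2 + x / 2 - 1 / 2" using x by (simp add: ln_div field_simps)
    then have "ln (x + 1) \<le> x / 2 + 1935 / 10000" using l2 by linarith
    moreover have "chebyshev_psi (n div 2) \<le> 3 * h" using less n by (simp add: h_def)
    then have "chebyshev_psi (n div 2) \<le> 3 / 2 * x"
      using of_nat_div_le_of_nat[of n 2, where ?'a = real] by (simp add: h_def x_def)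
    moreover have "x * ln 2 \<le> x * (6935 / 10000)" using l2 x by (intro mult_left_mono) auto
    moreover have "chebyshev_psi n \<le> chebyshev_psi (n div 2) + x * ln 2 + ln (x + 1)"
      using chebyshev_psi_halving[of n] by (simp add: x_def)
    ultimately have "chebyshev_psi n \<le> 3 / 2 * x + x * (6935 / 10000) + (x / 2 + 1935 / 10000)" by linarith
    also have "\<dots> \<le> 3 * x" using x by simp
    finally show ?thesis by (simp add: x_def)
  qed
qed

text \<open>Divide the identity for \<open>ln (n!)\<close> by \<open>n\<close>: dropping the integer parts costs \<open>\<psi>(n) / n \<le> 3\<close>.\<close>

lemma sum_mangoldt_over_self_le:
  assumes "n \<ge> 1"
  shows "(\<Sum>d=1..n. mangoldt d / real d) \<le> ln (real n) + 3"
proof -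
  have "real n * (\<Sum>d=1..n. mangoldt d / real d) \<le> (\<Sum>d=1..n. mangoldt d * real (n div d) + mangoldt d)"
    unfolding sum_distrib_left
  proof (intro sum_mono)
    fix d assume "d \<in> {1..n}"
    then have d: "d > 0" by simp
    have "real n / real d \<le> real (n div d) + 1"
    proof -
      have "\<lfloor>real n / real d\<rfloor> = int (n div d)" by (rule floor_divide_of_nat_eq)
      then show ?thesis by linarith
    qed
    then have "mangoldt d * (real n / real d) \<le> mangoldt d * (real (n div d) + 1)"
      by (intro mult_left_mono mangoldt_nonneg) 
    then show "real n * (mangoldt d / real d) \<le> mangoldt d * real (n div d) + mangoldt d"
      by (simp add: algebra_simps)
  qed
  also have "\<dots> = ln (fact n) + chebyshev_psi n"
    by (simp add: sum.distrib chebyshev_psi_def ln_fact_eq_sum_mangoldt[of n n])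
  also have "ln (fact n :: real) \<le> ln (real n ^ n)"
  proof (subst ln_le_cancel_iff)
    show "fact n \<le> real n ^ n" using fact_le_power[of n, where ?'a = real] by simp
  qed (use assms in auto)
  also have "\<dots> = real n * ln (real n)" using assms by (simp add: ln_realpow)
  also have "real n * ln (real n) + chebyshev_psi n \<le> real n * (ln (real n) + 3)"
    using chebyshev_psi_upper[of n] by (simp add: algebra_simps)
  finally show ?thesis using assms by simp
qed

text \<open>Partial summation of the previous bound, done as an induction. The quantity \<open>D n\<close> is the unused part of
  that bound; keeping \<open>D n / ln n\<close> on the left makes the induction step close, because \<open>1 - x / y \<le> ln y - ln x\<close>
  for consecutive values \<open>x < y\<close> of the logarithm.\<close>

lemma sum_inverse_primes_le:
  assumes "n \<ge> 2"
  shows "(\<Sum>p | prime p \<and> p \<le> n. 1 / real p) \<le> ln (ln (real n)) + 6"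
proof -
  define a where "a m = (mangoldt m / real m :: real)" for m
  define D where "D n = ln (real n) + 3 - (\<Sum>d=1..n. a d)" for n
  have D: "D n \<ge> 0" if "n \<ge> 2" for n
    using sum_mangoldt_over_self_le[of n] that by (auto simp: D_def a_def)
  have "(\<Sum>m=2..n. a m / ln (real m)) + D n / ln (real n) \<le> ln (ln (real n)) + 6"
    using assms
  proof (induction n rule: nat_induct_at_least)
    case base
    have l: "ln (2::real) > 0" "ln (2::real) \<ge> 2 / 3" using ln2_ge_two_thirds by auto
    have "{1..2::nat} = {1,2}" by auto
    then have "D 2 = ln 2 + 3 - a 2" by (simp add: D_def a_def)
    then have "(\<Sum>m=2..2. a m / ln (real m)) + D 2 / ln (real 2) = 1 + 3 / ln 2"
      using l by (simp add: field_simps)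
    moreover have "3 / ln 2 \<le> 9 / (2::real)" using l by (simp add: field_simps)
    moreover have "ln (1 / ln 2) \<le> 1 / ln 2 - (1::real)" using l by (intro ln_le_minus_one) auto
    then have "1 - 1 / ln 2 \<le> ln (ln (2::real))" using l by (simp add: ln_div)
    moreover have "1 / ln 2 \<le> 3 / (2::real)" using l by (simp add: field_simps)
    ultimately show ?case unfolding of_nat_numeral by linarith
  next
    case (Suc n)
    define x y where "x = ln (real n)" and "y = ln (real (Suc n))"
    have xy: "0 < x" "x < y" using Suc by (auto simp: x_def y_def)
    have DS: "D (Suc n) = D n + (y - x) - a (Suc n)"
      by (simp add: D_def x_def y_def)
    have "{2..Suc n} = insert (Suc n) {2..n}" using Suc by auto
    then have "(\<Sum>m=2..Suc n. a m / ln (real m)) + D (Suc n) / ln (real (Suc n))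
       = (\<Sum>m=2..n. a m / ln (real m)) + (D n + (y - x)) / y"
      unfolding DS y_def[symmetric] by (simp add: y_def[symmetric] diff_divide_distrib del: of_nat_Suc)
    also have "\<dots> = (\<Sum>m=2..n. a m / ln (real m)) + D n / y + (1 - x / y)"
      using xy by (simp add: field_simps)
    also have "D n / y \<le> D n / x" using xy D[of n] Suc by (intro divide_left_mono) auto
    also have "1 - x / y \<le> ln y - ln x"
      using ln_le_minus_one[of "x / y"] xy by (simp add: ln_div)
    finally show ?case using Suc unfolding x_def y_def by linarith
  qed
  moreover have "D n / ln (real n) \<ge> 0" using D[of n] assms by (intro divide_nonneg_nonneg) auto
  moreover have "(\<Sum>p | prime p \<and> p \<le> n. 1 / real p) \<le> (\<Sum>m=2..n. a m / ln (real m))"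
  proof -
    have "(\<Sum>p | prime p \<and> p \<le> n. 1 / real p) = (\<Sum>p | prime p \<and> p \<le> n. a p / ln (real p))"
      by (intro sum.cong refl) (auto simp: a_def dest: prime_gt_1_nat)
    also have "\<dots> \<le> (\<Sum>m=2..n. a m / ln (real m))"
      by (intro sum_mono2) (auto simp: a_def mangoldt_nonneg dest: prime_ge_2_nat)
    finally show ?thesis .
  qed
  ultimately show ?thesis by linarith
qed

text \<open>Legendre's formula. In the step from \<open>n\<close> to \<open>n + 1\<close> the terms that grow belong to the powers of \<open>p\<close> dividing
  \<open>n + 1\<close>.\<close>

lemma multiplicity_fact_eq_sum_div:
  assumes p: "prime (p::nat)" and "n \<le> N"
  shows "multiplicity p (fact n :: nat) = (\<Sum>k=1..N. n div p ^ k)"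
  using assms(2)
proof (induction n)
  case 0
  then show ?case by simp
next
  case (Suc n)
  define e where "e = multiplicity p (Suc n)"
  have "p ^ e dvd Suc n" by (simp add: e_def multiplicity_dvd)
  then have "p ^ e \<le> Suc n" by (intro dvd_imp_le) auto
  moreover have "e < p ^ e" using p prime_gt_1_nat by (intro power_gt_expt) auto
  ultimately have e: "e \<le> N" using Suc by linarith
  have "multiplicity p (fact (Suc n) :: nat) = multiplicity p (Suc n * fact n)" by simp
  also have "\<dots> = e + multiplicity p (fact n :: nat)"
    unfolding e_def using p by (intro prime_elem_multiplicity_mult_distrib) auto
  also have "multiplicity p (fact n :: nat) = (\<Sum>k=1..N. n div p ^ k)" using Suc by simp
  also have "e = (\<Sum>k=1..N. if p ^ k dvd Suc n then 1 else 0)"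
  proof -
    have "p ^ k dvd Suc n \<longleftrightarrow> k \<le> e" for k
      using p unfolding e_def by (intro power_dvd_iff_le_multiplicity) auto
    then have "(\<Sum>k=1..N. if p ^ k dvd Suc n then 1 else 0) = card {k\<in>{1..N}. k \<le> e}"
      by (subst card_eq_sum, subst sum.inter_filter) auto
    also have "{k\<in>{1..N}. k \<le> e} = {1..e}" using e by auto
    finally show ?thesis by simp
  qed
  also have "\<dots> + (\<Sum>k=1..N. n div p ^ k) = (\<Sum>k=1..N. Suc n div p ^ k)"
    unfolding sum.distrib[symmetric] using p
    by (intro sum.cong refl) (auto simp: Suc_div_eq prime_gt_0_nat)
  finally show ?case .
qed

lemma multiplicity_fact_le:
  assumes p: "prime (p::nat)"
  shows "real (multiplicity p (fact n :: nat)) \<le> real n / (real p - 1)"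
proof -
  have p1: "real p > 1" using p prime_gt_1_nat by simp
  have "real (multiplicity p (fact n :: nat)) = (\<Sum>k=1..n. real (n div p ^ k))"
    by (subst multiplicity_fact_eq_sum_div[OF p order_refl]) simp
  also have "\<dots> \<le> (\<Sum>k=1..n. real n * (1 / real p) ^ k)"
    by (intro sum_mono) (metis of_nat_div_le_of_nat of_nat_power power_one_over divide_inverse inverse_eq_divide)
  also have "\<dots> = real n * (\<Sum>k=1..n. (1 / real p) ^ k)" by (simp add: sum_distrib_left)
  also have "(\<Sum>k=1..n. (1 / real p) ^ k) \<le> 1 / (real p - 1)"
  proof (cases "n = 0")
    case False
    have "(\<Sum>k=1..n. (1 / real p) ^ k) = (1 / real p - (1 / real p) ^ Suc n) / (1 - 1 / real p)"
      using p1 False by (subst sum_gp) auto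
    also have "\<dots> \<le> (1 / real p) / (1 - 1 / real p)" using p1 by (intro divide_right_mono) auto
    also have "\<dots> = 1 / (real p - 1)" using p1 by (simp add: field_simps)
    finally show ?thesis .
  qed (use p1 in auto)
  finally show ?thesis using p1 by (simp add: mult_left_mono)
qed

text \<open>Replacing \<open>1 / (p - 1)\<close> by \<open>1 / p\<close> costs at most the telescoping sum of \<open>1 / (m - 1) - 1 / m\<close>, which is
  less than one.\<close>

lemma Upsilon_le:
  assumes "n \<ge> 2"
  shows "real (Upsilon n) \<le> real n * (ln (ln (real n)) + 7)"
proof -
  define P where "P = {p. prime p \<and> p \<le> n}"
  have fin: "finite P" unfolding P_def by simp
  have "real (Upsilon n) \<le> (\<Sum>p\<in>P. real n / (real p - 1))"
    unfolding Upsilon_def P_def of_nat_sum by (intro sum_mono multiplicity_fact_le) auto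
  also have "\<dots> = (\<Sum>p\<in>P. real n * (1 / real p) + real n * (1 / (real p - 1) - 1 / real p))"
    by (intro sum.cong refl) (simp add: algebra_simps)
  also have "\<dots> = real n * ((\<Sum>p\<in>P. 1 / real p) + (\<Sum>p\<in>P. 1 / (real p - 1) - 1 / real p))"
    by (simp add: sum.distrib sum_distrib_left distrib_left)
  also have "(\<Sum>p\<in>P. 1 / (real p - 1) - 1 / real p) \<le> (\<Sum>m=2..n. 1 / (real m - 1) - 1 / real m)"
  proof (intro sum_mono2)
    show "P \<subseteq> {2..n}" unfolding P_def by (auto dest: prime_ge_2_nat)
  qed (auto simp: field_simps)
  also have "(\<Sum>m=2..n. 1 / (real m - 1) - 1 / real m) = 1 - 1 / real n"
    using assms by (induction n rule: nat_induct_at_least) (auto simp: numeral_2_eq_2)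
  also have "\<dots> \<le> 1" by simp
  also have "(\<Sum>p\<in>P. 1 / real p) \<le> ln (ln (real n)) + 6"
    unfolding P_def by (rule sum_inverse_primes_le[OF assms])
  finally have "real (Upsilon n) \<le> real n * (ln (ln (real n)) + 6 + 1)" 
    by (simp add: mult_left_mono add_right_mono)
  then show ?thesis by (simp add: algebra_simps)
qed

text \<open>A prime \<open>p\<close> contributes \<open>ln p\<close> once for each of its powers up to \<open>n\<close>, that is, at most
  \<open>log p n * ln p = ln n\<close> in total.\<close>

lemma chebyshev_psi_le_prime_pi:
  "chebyshev_psi n \<le> real (prime_pi n) * ln (real n)"
proof -
  define P where "P = {p. prime p \<and> p \<le> n}"
  have fin: "finite P" unfolding P_def by simp
  define Q where "Q = {q\<in>{1..n}. primepow q}"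
  have Q: "aprimedivisor q \<in> P" "q > 1" if "q \<in> Q" for q
  proof -
    show "q > 1" using that primepow_gt_Suc_0[of q] by (auto simp: Q_def)
    then show "aprimedivisor q \<in> P" 
      using that aprimedivisor_nat[of q] aprimedivisor_le_nat[of q] by (auto simp: P_def Q_def)
  qed
  have "chebyshev_psi n = (\<Sum>q\<in>Q. ln (real (aprimedivisor q)))"
    unfolding chebyshev_psi_def Q_def
    by (intro sum.mono_neutral_cong_right) (auto simp: mangoldt_def)
  also have "\<dots> = (\<Sum>p\<in>P. \<Sum>q | q \<in> Q \<and> aprimedivisor q = p. ln (real (aprimedivisor q)))"
    using Q by (intro sum.group[symmetric] fin) (auto simp: Q_def)
  also have "\<dots> = (\<Sum>p\<in>P. real (card {q\<in>Q. aprimedivisor q = p}) * ln (real p))"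
    by (intro sum.cong refl) simp
  also have "\<dots> \<le> (\<Sum>p\<in>P. ln (real n))"
  proof (intro sum_mono)
    fix p assume pP: "p \<in> P"
    then have p: "prime p" "p \<le> n" "p > 1" by (auto simp: P_def prime_gt_Suc_0_nat)
    define K where "K = nat \<lfloor>log (real p) (real n)\<rfloor>"
    have log0: "log (real p) (real n) \<ge> 0" using p by simp
    have "{q\<in>Q. aprimedivisor q = p} \<subseteq> (\<lambda>k. p ^ k) ` {1..K}"
    proof
      fix q assume "q \<in> {q\<in>Q. aprimedivisor q = p}"
      then have q: "q \<le> n" "primepow q" "aprimedivisor q = p" by (simp_all add: Q_def)
      then obtain p' k where k: "prime p'" "k > 0" "q = p' ^ k" by (auto simp: primepow_def)
      have "p' = p" using k(1,2) q(3) unfolding k(3) by (simp add: aprimedivisor_prime_power)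
      then have qk: "q = p ^ k" using k(3) by simp
      have "p ^ k \<le> n" using q(1) unfolding qk .
      then have "real p ^ k \<le> real n" by (metis of_nat_le_iff of_nat_power)
      then have "real k \<le> log (real p) (real n)"
        using p by (simp add: le_log_iff powr_realpow)
      then have "k \<le> K" unfolding K_def by linarith
      then have "k \<in> {1..K}" using k(2) by simp
      then show "q \<in> (\<lambda>k. p ^ k) ` {1..K}" unfolding qk by (rule imageI)
    qed
    then have "card {q\<in>Q. aprimedivisor q = p} \<le> card ((\<lambda>k. p ^ k) ` {1..K})" by (intro card_mono) auto
    also have "\<dots> \<le> K" using card_image_le[of "{1..K}" "\<lambda>k. p ^ k"] by simp
    finally have "real (card {q\<in>Q. aprimedivisor q = p}) \<le> log (real p) (real n)"
      using log0 unfolding K_def by linarith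
    then have "real (card {q\<in>Q. aprimedivisor q = p}) * ln (real p) \<le> log (real p) (real n) * ln (real p)"
      using p by (intro mult_right_mono) auto
    also have "\<dots> = ln (real n)" using p by (simp add: log_def)
    finally show "real (card {q\<in>Q. aprimedivisor q = p}) * ln (real p) \<le> ln (real n)" .
  qed
  also have "\<dots> = real (prime_pi n) * ln (real n)" by (simp add: prime_pi_def P_def)
  finally show ?thesis .
qed

section \<open>The zeta function in the half-plane Re s > 1/2\<close>

text \<open>The power \<open>x ^ (-s)\<close> of a positive real \<open>x\<close>. Writing it with the real logarithm makes it an entire
  function of \<open>s\<close> by inspection and a smooth curve in \<open>x\<close>.\<close>

definition rpow :: "complex \<Rightarrow> real \<Rightarrow> complex" where
  "rpow s x = exp (- s * of_real (ln x))"

lemma norm_rpow: "x > 0 \<Longrightarrow> norm (rpow s x) = x powr (- Re s)"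
  by (simp add: rpow_def powr_def mult.commute)

lemma rpow_1 [simp]: "rpow s 1 = 1"
  by (simp add: rpow_def)

lemma rpow_mult: "x > 0 \<Longrightarrow> y > 0 \<Longrightarrow> rpow s (x * y) = rpow s x * rpow s y"
  by (simp add: rpow_def ln_mult distrib_left exp_add[symmetric])

lemma rpow_add: "rpow (s + w) x = rpow s x * rpow w x"
  by (simp add: rpow_def algebra_simps exp_add[symmetric])

lemma rpow_one_exponent: "x > 0 \<Longrightarrow> rpow 1 x = 1 / of_real x"
proof -
  assume x: "x > 0"
  have "rpow 1 x = inverse (exp (of_real (ln x)))" by (simp add: rpow_def exp_minus)
  also have "exp (of_real (ln x) :: complex) = of_real (exp (ln x))" by (rule exp_of_real)
  finally show ?thesis using x by (simp add: divide_inverse)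
qed

lemma has_field_derivative_rpow [derivative_intros]:
  assumes "(f has_field_derivative f') (at s within S)"
  shows "((\<lambda>s. rpow (f s) x) has_field_derivative - of_real (ln x) * rpow (f s) x * f') (at s within S)"
  unfolding rpow_def by (rule derivative_eq_intros assms refl)+ simp

lemma holomorphic_on_rpow [holomorphic_intros]:
  assumes "f holomorphic_on S" shows "(\<lambda>s. rpow (f s) x) holomorphic_on S"
  unfolding rpow_def using assms by (intro holomorphic_intros)

lemma has_vector_derivative_rpow:
  assumes "x > 0"
  shows "(rpow s has_vector_derivative - s * rpow (s + 1) x) (at x within S)"
proof -
  have "((\<lambda>x. of_real (ln x) :: complex) has_vector_derivative of_real (1 / x)) (at x within S)"
    using assms by (intro has_vector_derivative_of_real) (auto intro!: derivative_eq_intros)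
  then have "((\<lambda>x. - s * of_real (ln x)) has_vector_derivative - s * of_real (1 / x)) (at x within S)"
    by (rule has_vector_derivative_mult_right)
  moreover have "(exp has_field_derivative exp (- s * of_real (ln x))) (at (- s * of_real (ln x)) within (\<lambda>x. - s * of_real (ln x)) ` S)"
    by (rule has_field_derivative_at_within[OF DERIV_exp])
  ultimately have "(exp \<circ> (\<lambda>x. - s * of_real (ln x)) has_vector_derivative (- s * of_real (1 / x)) * exp (- s * of_real (ln x))) (at x within S)"
    by (rule field_vector_diff_chain_within)
  moreover have "(- s * of_real (1 / x)) * exp (- s * of_real (ln x)) = - s * rpow (s + 1) x"
    using assms by (simp add: rpow_add rpow_one_exponent) (simp add: rpow_def)
  ultimately show ?thesis by (simp add: rpow_def[abs_def] o_def)
qed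

text \<open>The mean value inequality for curves. Applied twice, it bounds the terms of the zeta series.\<close>

lemma norm_diff_le_vector_derivative:
  fixes f :: "real \<Rightarrow> 'a :: real_normed_vector"
  assumes "a \<le> b"
    and "\<And>x. x \<in> {a..b} \<Longrightarrow> (f has_vector_derivative f' x) (at x within {a..b})"
    and "\<And>x. x \<in> {a..b} \<Longrightarrow> norm (f' x) \<le> B"
  shows "norm (f b - f a) \<le> B * (b - a)"
proof -
  have "norm (f b - f a) \<le> B * norm (b - a)"
  proof (rule differentiable_bound[where S = "{a..b}" and f' = "\<lambda>x h. h *\<^sub>R f' x"])
    show "(f has_derivative (\<lambda>h. h *\<^sub>R f' x)) (at x within {a..b})" if "x \<in> {a..b}" for x
      using assms(2)[OF that] by (simp add: has_vector_derivative_def)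
    show "onorm (\<lambda>h. h *\<^sub>R f' x) \<le> B" if "x \<in> {a..b}" for x
    proof (rule onorm_le)
      fix h :: real
      have "norm (h *\<^sub>R f' x) = norm (f' x) * norm h" by simp
      also have "\<dots> \<le> B * norm h" using assms(3)[OF that] by (intro mult_right_mono) auto
      finally show "norm (h *\<^sub>R f' x) \<le> B * norm h" .
    qed
  qed (use assms in auto)
  then show ?thesis using assms by simp
qed

text \<open>Comparison with the integral of \<open>x powr (-1 - r)\<close>, as a telescoping sum.\<close>

lemma sum_powr_le:
  fixes r :: real
  assumes r: "r > 0"
  shows "(\<Sum>k<N. real (Suc k) powr (-1 - r)) \<le> 1 + 1 / r"
proof -
  have step: "real (Suc (Suc k)) powr (-1 - r) \<le> (real (Suc k) powr (-r) - real (Suc (Suc k)) powr (-r)) / r" for k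
  proof -
    define a b where "a = real (Suc k)" and "b = real (Suc (Suc k))"
    have ab: "0 < a" "a < b" "b = a + 1" by (auto simp: a_def b_def)
    obtain z where z: "a < z" "z < b" "(b powr (-r)) - (a powr (-r)) = (b - a) * ((-r) * z powr (-r - 1))"
    proof -
      have "\<exists>z>a. z < b \<and> (\<lambda>x. x powr (-r)) b - (\<lambda>x. x powr (-r)) a = (b - a) * ((-r) * z powr (-r - 1))"
      proof (rule MVT2[OF ab(2)])
        fix x assume "a \<le> x" "x \<le> b"
        then show "((\<lambda>x. x powr (-r)) has_real_derivative ((-r) * x powr (-r - 1))) (at x)"
          using ab by (intro has_real_derivative_powr) auto
      qed
      then show ?thesis using that by blast
    qed
    have "b powr (-1 - r) \<le> z powr (-1 - r)" using z ab r by (intro powr_mono2') auto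
    then have "r * b powr (-1 - r) \<le> r * z powr (-1 - r)" using r by simp
    moreover have "-r - 1 = -1 - r" by simp
    from z(3)[unfolded this] have "b powr (-r) - a powr (-r) = - (r * z powr (-1 - r))" using ab(3) by simp
    ultimately have "r * b powr (-1 - r) \<le> a powr (-r) - b powr (-r)" by linarith
    then show ?thesis using r by (simp add: a_def b_def field_simps)
  qed
  have "(\<Sum>k<Suc N. real (Suc k) powr (-1 - r)) \<le> 1 + (1 - real (Suc N) powr (-r)) / r"
  proof (induction N)
    case (Suc N)
    have "(\<Sum>k<Suc (Suc N). real (Suc k) powr (-1 - r)) = (\<Sum>k<Suc N. real (Suc k) powr (-1 - r)) + real (Suc (Suc N)) powr (-1 - r)"
      by simp
    also have "\<dots> \<le> (1 + (1 - real (Suc N) powr (-r)) / r) + (real (Suc N) powr (-r) - real (Suc (Suc N)) powr (-r)) / r"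
      by (intro add_mono Suc step)
    also have "\<dots> = 1 + (1 - real (Suc (Suc N)) powr (-r)) / r" by (simp add: diff_divide_distrib)
    finally show ?case .
  qed simp
  also have "\<dots> \<le> 1 + 1 / r" using r by (simp add: field_simps)
  finally have "(\<Sum>k<Suc N. real (Suc k) powr (-1 - r)) \<le> 1 + 1 / r" .
  moreover have "(\<Sum>k<N. real (Suc k) powr (-1 - r)) \<le> (\<Sum>k<Suc N. real (Suc k) powr (-1 - r))"
    by (intro sum_mono2) auto
  ultimately show ?thesis by linarith
qed

lemma summable_Suc_powr: "p > 1 \<Longrightarrow> summable (\<lambda>k. real (Suc k) powr (- p))"
  using summable_Suc_iff[of "\<lambda>n. real n powr (-p)"] summable_real_powr_iff[of "-p"] by simp

lemma suminf_Suc_powr_le: "r > 0 \<Longrightarrow> (\<Sum>k. real (Suc k) powr (-1 - r)) \<le> 1 + 1 / r"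
  using summable_Suc_powr[of "1 + r"] by (intro suminf_le_const sum_powr_le) auto

text \<open>This is \<open>s - 1\<close> times the difference of \<open>n ^ (-s)\<close> and the integral of \<open>x ^ (-s)\<close> over \<open>[n, n + 1]\<close>,
  with \<open>n = k + 1\<close>. The factor \<open>s - 1\<close> makes it an entire function without a case distinction at \<open>s = 1\<close>.\<close>

definition zeta_step :: "complex \<Rightarrow> nat \<Rightarrow> complex" where
  "zeta_step s k = (s - 1) * rpow s (real (Suc k)) - rpow (s - 1) (real (Suc k)) + rpow (s - 1) (real (Suc k) + 1)"

text \<open>The geometric mean of two estimates: the trivial one by \<open>2 n ^ (- Re s)\<close> and the one by
  \<open>\<bar>s\<bar> n ^ (- Re s - 1)\<close> from the derivative. Only the square root of \<open>\<bar>s\<bar>\<close> enters, and the sum over \<open>n\<close>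
  still converges for \<open>Re s > 1/2\<close>.\<close>

lemma norm_rpow_diff_le:
  assumes "Re s > 0" "n > 0" "x \<in> {n..n+1}"
  shows "norm (rpow s n - rpow s x) \<le> sqrt (2 * norm s) * n powr (- Re s - 1 / 2)"
proof -
  have "norm (rpow s x - rpow s n) \<le> (norm s * n powr (- Re s - 1)) * (x - n)"
  proof (rule norm_diff_le_vector_derivative)
    fix y assume y: "y \<in> {n..x}"
    show "(rpow s has_vector_derivative - s * rpow (s + 1) y) (at y within {n..x})"
      using y assms by (intro has_vector_derivative_rpow) auto
    have "y powr (- Re s - 1) \<le> n powr (- Re s - 1)" using y assms by (intro powr_mono2') auto
    then show "norm (- s * rpow (s + 1) y) \<le> norm s * n powr (- Re s - 1)"
      using y assms by (simp add: norm_mult norm_rpow mult_left_mono)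
  qed (use assms in auto)
  also have "\<dots> \<le> (norm s * n powr (- Re s - 1)) * 1" using assms by (intro mult_left_mono) auto
  finally have 1: "norm (rpow s n - rpow s x) \<le> norm s * n powr (- Re s - 1)"
    by (simp add: norm_minus_commute)
  have "norm (rpow s n - rpow s x) \<le> n powr (- Re s) + x powr (- Re s)"
    using norm_triangle_ineq4[of "rpow s n" "rpow s x"] assms by (simp add: norm_rpow)
  also have "x powr (- Re s) \<le> n powr (- Re s)" using assms by (intro powr_mono2') auto
  finally have 2: "norm (rpow s n - rpow s x) \<le> 2 * n powr (- Re s)" by simp
  have "norm (rpow s n - rpow s x) ^ 2 \<le> (norm s * n powr (- Re s - 1)) * (2 * n powr (- Re s))"
    unfolding power2_eq_square using 1 2 by (intro mult_mono) auto
  also have "\<dots> = (2 * norm s) * (n powr (- Re s - 1 / 2)) ^ 2"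
    by (simp add: power2_eq_square powr_add[symmetric])
  finally have "norm (rpow s n - rpow s x) \<le> sqrt ((2 * norm s) * (n powr (- Re s - 1 / 2)) ^ 2)"
    by (rule real_le_rsqrt)
  also have "\<dots> = sqrt (2 * norm s) * n powr (- Re s - 1 / 2)" by (simp add: real_sqrt_mult)
  finally show ?thesis .
qed

lemma norm_zeta_step_le:
  assumes "Re s > 0"
  shows "norm (zeta_step s k) \<le> norm (s - 1) * sqrt (2 * norm s) * real (Suc k) powr (- Re s - 1 / 2)"
proof -
  define n where "n = real (Suc k)"
  have n: "n > 0" by (simp add: n_def)
  define f where "f = (\<lambda>x. (s - 1) * rpow s n * of_real x + rpow (s - 1) x)"
  have "norm (f (n + 1) - f n) \<le> (norm (s - 1) * (sqrt (2 * norm s) * n powr (- Re s - 1 / 2))) * ((n + 1) - n)"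
  proof (rule norm_diff_le_vector_derivative)
    fix x assume x: "x \<in> {n..n+1}"
    have "((\<lambda>x. (s - 1) * rpow s n * of_real x) has_vector_derivative (s - 1) * rpow s n * of_real 1) (at x within {n..n+1})"
      by (intro has_vector_derivative_mult_right has_vector_derivative_of_real DERIV_ident)
    from has_vector_derivative_add[OF this has_vector_derivative_rpow[of x "s - 1" "{n..n+1}"]]
    show "(f has_vector_derivative (s - 1) * (rpow s n - rpow s x)) (at x within {n..n+1})"
      using x n by (simp add: f_def algebra_simps)
    show "norm ((s - 1) * (rpow s n - rpow s x)) \<le> norm (s - 1) * (sqrt (2 * norm s) * n powr (- Re s - 1 / 2))"
      unfolding norm_mult using x n assms by (intro mult_left_mono norm_rpow_diff_le) auto
  qed auto
  also have "f (n + 1) - f n = zeta_step s k" by (simp add: f_def zeta_step_def n_def algebra_simps)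
  finally show ?thesis by (simp add: n_def mult.assoc)
qed

text \<open>For \<open>Re s > 1\<close> this is \<open>(s - 1) \<zeta>(s)\<close>: the integrals in the steps add up to \<open>1 / (s - 1)\<close>.\<close>

definition zeta_reg :: "complex \<Rightarrow> complex" where
  "zeta_reg s = 1 + (\<Sum>k. zeta_step s k)"

lemma summable_zeta_step:
  assumes "Re s > 1 / 2"
  shows "summable (zeta_step s)"
proof (rule summable_comparison_test')
  show "summable (\<lambda>k. norm (s - 1) * sqrt (2 * norm s) * real (Suc k) powr (- (Re s + 1 / 2)))"
    using assms by (intro summable_mult summable_Suc_powr) auto
  show "norm (zeta_step s k) \<le> norm (s - 1) * sqrt (2 * norm s) * real (Suc k) powr (- (Re s + 1 / 2))" for k
    using norm_zeta_step_le[of s k] assms by simp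
qed

lemma zeta_reg_1 [simp]: "zeta_reg 1 = 1"
  using norm_zeta_step_le[of 1] by (simp add: zeta_reg_def)

lemma holomorphic_zeta_reg: "zeta_reg holomorphic_on {s. Re s > 1 / 2}"
proof -
  have "(\<lambda>s. \<Sum>k. zeta_step s k) holomorphic_on {s. Re s > 1 / 2}"
  proof (rule holomorphic_uniform_sequence)
    show "open {s. Re s > 1 / 2}" by (rule open_halfspace_Re_gt)
    show "(\<lambda>s. \<Sum>k<n. zeta_step s k) holomorphic_on {s. Re s > 1 / 2}" for n
      unfolding zeta_step_def by (intro holomorphic_intros)
    fix s assume "s \<in> {s. Re s > 1 / 2}"
    then have s: "Re s > 1 / 2" by simp
    define d where "d = (Re s - 1 / 2) / 2"
    have d: "d > 0" using s by (simp add: d_def)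
    have Re_ge: "Re w \<ge> 1 / 2 + d" if "w \<in> cball s d" for w
    proof -
      have "\<bar>Re (s - w)\<bar> \<le> norm (s - w)" by (rule abs_Re_le_cmod)
      also have "\<dots> \<le> d" using that by (simp add: dist_norm)
      finally have "\<bar>Re s - Re w\<bar> \<le> d" by simp
      moreover have "Re s = 1 / 2 + 2 * d" by (simp add: d_def field_simps)
      ultimately show ?thesis by linarith
    qed
    define C where "C = (norm s + d + 1) * sqrt (2 * (norm s + d))"
    have "uniform_limit (cball s d) (\<lambda>n w. \<Sum>k<n. zeta_step w k) (\<lambda>w. \<Sum>k. zeta_step w k) sequentially"
    proof (rule Weierstrass_m_test)
      show "summable (\<lambda>k. C * real (Suc k) powr (- (1 + d)))"
        using d by (intro summable_mult summable_Suc_powr) auto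
      fix k w assume w: "w \<in> cball s d"
      have nw: "norm w \<le> norm s + d"
        using w norm_triangle_ineq2[of w s] by (simp add: dist_norm norm_minus_commute)
      have "norm (zeta_step w k) \<le> (norm (w - 1) * sqrt (2 * norm w)) * real (Suc k) powr (- Re w - 1 / 2)"
        using Re_ge[OF w] d by (intro norm_zeta_step_le) auto
      also have "\<dots> \<le> C * real (Suc k) powr (- (1 + d))"
      proof (rule mult_mono)
        have "norm (w - 1) \<le> norm w + 1" using norm_triangle_ineq4[of w 1] by simp
        then show "norm (w - 1) * sqrt (2 * norm w) \<le> C"
          unfolding C_def using nw d by (intro mult_mono) (auto intro!: add_nonneg_nonneg)
        show "real (Suc k) powr (- Re w - 1 / 2) \<le> real (Suc k) powr (- (1 + d))"
          using Re_ge[OF w] by (intro powr_mono) auto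
      qed (use nw d in \<open>auto simp: C_def\<close>)
      finally show "norm (zeta_step w k) \<le> C * real (Suc k) powr (- (1 + d))" .
    qed
    moreover have "cball s d \<subseteq> {s. Re s > 1 / 2}" using Re_ge d by force
    ultimately show "\<exists>d>0. cball s d \<subseteq> {s. Re s > 1 / 2} \<and>
        uniform_limit (cball s d) (\<lambda>n s. \<Sum>k<n. zeta_step s k) (\<lambda>s. \<Sum>k. zeta_step s k) sequentially"
      using d by blast
  qed
  then show ?thesis unfolding zeta_reg_def[abs_def] by (intro holomorphic_intros)
qed

text \<open>For \<open>Re s > 1\<close> this is \<open>\<zeta>(s) - 1 / (s - 1)\<close>, the zeta function without its pole.\<close>

definition zeta_hol :: "complex \<Rightarrow> complex" where
  "zeta_hol s = (if s = 1 then deriv zeta_reg 1 else (zeta_reg s - 1) / (s - 1))"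

lemma zeta_reg_eq: "zeta_reg s = 1 + (s - 1) * zeta_hol s"
  by (simp add: zeta_hol_def)

lemma holomorphic_zeta_hol: "zeta_hol holomorphic_on {s. Re s > 1 / 2}"
proof -
  have "(\<lambda>s. if s = 1 then deriv zeta_reg 1 else zeta_reg s / (s - 1) - zeta_reg 1 / (s - 1)) holomorphic_on {s. Re s > 1 / 2}"
    by (rule pole_theorem_open[OF holomorphic_zeta_reg open_halfspace_Re_gt]) auto
  then show ?thesis
    by (simp add: zeta_hol_def[abs_def] diff_divide_distrib cong: if_cong)
qed

text \<open>Summing the bounds for the single steps and dividing by \<open>s - 1\<close> proves this for \<open>s \<noteq> 1\<close>; the point
  \<open>s = 1\<close> follows by continuity.\<close>

lemma norm_zeta_hol_le:
  assumes s: "Re s \<ge> 3 / 4"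
  shows "norm (zeta_hol s) \<le> 5 * sqrt (2 * norm s)"
proof -
  have *: "norm (zeta_hol s) \<le> 5 * sqrt (2 * norm s)" if s: "Re s \<ge> 3 / 4" "s \<noteq> 1" for s
  proof -
    have sm: "summable (\<lambda>k. norm (s - 1) * sqrt (2 * norm s) * real (Suc k) powr (-1 - 1 / 4))"
      using summable_Suc_powr[of "1 + 1 / 4"] by (intro summable_mult) auto
    have "norm (\<Sum>k. zeta_step s k) \<le> (\<Sum>k. norm (s - 1) * sqrt (2 * norm s) * real (Suc k) powr (-1 - 1 / 4))"
    proof (rule norm_suminf_le[OF _ sm])
      fix k
      have "norm (zeta_step s k) \<le> norm (s - 1) * sqrt (2 * norm s) * real (Suc k) powr (- Re s - 1 / 2)"
        using s by (intro norm_zeta_step_le) auto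
      also have "\<dots> \<le> norm (s - 1) * sqrt (2 * norm s) * real (Suc k) powr (-1 - 1 / 4)"
        using s by (intro mult_left_mono powr_mono) auto
      finally show "norm (zeta_step s k) \<le> norm (s - 1) * sqrt (2 * norm s) * real (Suc k) powr (-1 - 1 / 4)" .
    qed
    also have "\<dots> = norm (s - 1) * sqrt (2 * norm s) * (\<Sum>k. real (Suc k) powr (-1 - 1 / 4))"
      using summable_Suc_powr[of "1 + 1 / 4"] by (intro suminf_mult) auto
    also have "\<dots> \<le> norm (s - 1) * sqrt (2 * norm s) * 5"
      using suminf_Suc_powr_le[of "1 / 4"] by (intro mult_left_mono) auto
    finally have "norm (zeta_reg s - 1) \<le> norm (s - 1) * (5 * sqrt (2 * norm s))"
      by (simp add: zeta_reg_def mult_ac)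
    then show ?thesis using s by (simp add: zeta_hol_def norm_divide divide_le_eq mult_ac)
  qed
  show ?thesis
  proof (cases "s = 1")
    case True
    have "isCont zeta_hol 1"
      using holomorphic_on_imp_continuous_on[OF holomorphic_zeta_hol]
      unfolding continuous_on_eq_continuous_at[OF open_halfspace_Re_gt] by simp
    then have lim: "((\<lambda>s. norm (zeta_hol s)) \<longlongrightarrow> norm (zeta_hol 1)) (at 1)"
      by (intro tendsto_norm) (simp add: isCont_def)
    have lim2: "((\<lambda>s::complex. 5 * sqrt (2 * norm s)) \<longlongrightarrow> 5 * sqrt (2 * norm (1::complex))) (at 1)"
      by (intro tendsto_intros)
    have "eventually (\<lambda>s. s \<in> {s. Re s > 3 / 4}) (at (1::complex))"
      by (intro eventually_at_in_open' open_halfspace_Re_gt) auto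
    then have "eventually (\<lambda>s. norm (zeta_hol s) \<le> 5 * sqrt (2 * norm s)) (at 1)"
      using eventually_neq_at_within[of 1 1 UNIV]
    proof eventually_elim
      case (elim s)
      then show ?case by (intro *) auto
    qed
    from tendsto_le[OF _ lim2 lim this] show ?thesis using True by simp
  qed (use * s in auto)
qed

lemma zeta_sums:
  assumes "Re s > 1"
  shows "(\<lambda>k. rpow s (real (Suc k))) sums (zeta_hol s + 1 / (s - 1))"
proof -
  have s1: "s \<noteq> 1" using assms by auto
  \<comment> \<open>The differences of the powers with exponent 1 - s telescope.\<close>
  have tele: "(\<Sum>k<N. zeta_step s k) = (s - 1) * (\<Sum>k<N. rpow s (real (Suc k))) - 1 + rpow (s - 1) (real (Suc N))" for N
    by (induction N) (auto simp: zeta_step_def algebra_simps)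
  have "(\<lambda>N. \<Sum>k<N. zeta_step s k) \<longlonglongrightarrow> (\<Sum>k. zeta_step s k)"
    using summable_zeta_step[of s] assms by (simp add: summable_LIMSEQ)
  moreover have "(\<lambda>N. rpow (s - 1) (real (Suc N))) \<longlonglongrightarrow> 0"
  proof (rule tendsto_norm_zero_cancel)
    have "(\<lambda>N. real (Suc N) powr (- (Re s - 1))) \<longlonglongrightarrow> 0"
      using assms by (intro tendsto_neg_powr filterlim_compose[OF filterlim_real_sequentially filterlim_Suc]) auto
    then show "(\<lambda>N. norm (rpow (s - 1) (real (Suc N)))) \<longlonglongrightarrow> 0"
      by (simp add: norm_rpow del: of_nat_Suc)
  qed
  ultimately have "(\<lambda>N. ((\<Sum>k<N. zeta_step s k) + 1 - rpow (s - 1) (real (Suc N))) / (s - 1)) \<longlonglongrightarrow> ((\<Sum>k. zeta_step s k) + 1 - 0) / (s - 1)"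
    using s1 by (intro tendsto_intros) auto
  moreover have "((\<Sum>k<N. zeta_step s k) + 1 - rpow (s - 1) (real (Suc N))) / (s - 1) = (\<Sum>k<N. rpow s (real (Suc k)))" for N
    unfolding tele using s1 by simp
  moreover have "((\<Sum>k. zeta_step s k) + 1 - 0) / (s - 1) = zeta_hol s + 1 / (s - 1)"
    using s1 by (simp add: zeta_hol_def zeta_reg_def add_divide_distrib)
  ultimately show ?thesis by (simp add: sums_def)
qed

section \<open>Dirichlet series and the von Mangoldt function\<close>

definition dseries :: "(nat \<Rightarrow> real) \<Rightarrow> complex \<Rightarrow> complex" where
  "dseries a s = (\<Sum>k. of_real (a (Suc k)) * rpow s (real (Suc k)))"

text \<open>A growth condition that the coefficient sequences 1, \<open>ln n\<close>, \<open>\<Lambda>(n)\<close> and \<open>\<Lambda>(n) - 1\<close> share and that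
  makes their Dirichlet series converge absolutely for \<open>Re s > 1\<close>.\<close>

definition log_bounded :: "(nat \<Rightarrow> real) \<Rightarrow> bool" where
  "log_bounded a \<longleftrightarrow> (\<forall>n\<ge>1. \<bar>a n\<bar> \<le> 1 + ln (real n))"

lemma norm_dseries_term_le:
  assumes "log_bounded a" "e > 0"
  shows "norm (of_real (a (Suc k)) * rpow s (real (Suc k))) \<le> (1 + 1 / e) * real (Suc k) powr (e - Re s)"
proof -
  define n where "n = real (Suc k)"
  have n: "n \<ge> 1" by (simp add: n_def)
  have "\<bar>a (Suc k)\<bar> \<le> 1 + ln n" using assms using n unfolding log_bounded_def n_def by (metis One_nat_def Suc_le_mono le0)
  also have "ln n \<le> n powr e / e" using n assms by (intro ln_powr_bound) auto
  also have "1 \<le> n powr e" using n assms by (simp add: ge_one_powr_ge_zero)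
  finally have "\<bar>a (Suc k)\<bar> \<le> (1 + 1 / e) * n powr e" by (simp add: algebra_simps)
  then have "\<bar>a (Suc k)\<bar> * n powr (- Re s) \<le> (1 + 1 / e) * n powr e * n powr (- Re s)"
    by (intro mult_right_mono) auto
  also have "\<dots> = (1 + 1 / e) * n powr (e - Re s)"
    by (simp add: powr_add[symmetric] mult.assoc)
  finally show ?thesis using n by (simp add: norm_mult norm_rpow n_def del: of_nat_Suc)
qed

lemma summable_norm_dseries:
  assumes "log_bounded a" "Re s > 1"
  shows "summable (\<lambda>k. norm (of_real (a (Suc k)) * rpow s (real (Suc k))))"
proof (rule summable_comparison_test')
  define e where "e = (Re s - 1) / 2"
  have e: "e > 0" "Re s - e > 1" using assms by (auto simp: e_def field_simps)
  have "summable (\<lambda>k. (1 + 1 / e) * real (Suc k) powr (- (Re s - e)))"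
    using e by (intro summable_mult summable_Suc_powr) auto
  then show "summable (\<lambda>k. (1 + 1 / e) * real (Suc k) powr (e - Re s))" by simp
  show "norm (norm (of_real (a (Suc k)) * rpow s (real (Suc k)))) \<le> (1 + 1 / e) * real (Suc k) powr (e - Re s)" for k
    using norm_dseries_term_le[OF assms(1) e(1)] by simp
qed

lemma dseries_sums:
  assumes "log_bounded a" "Re s > 1"
  shows "(\<lambda>k. of_real (a (Suc k)) * rpow s (real (Suc k))) sums dseries a s"
  unfolding dseries_def using summable_norm_cancel[OF summable_norm_dseries[OF assms]] by (rule summable_sums)

lemma dseries_derivative:
  assumes a: "log_bounded a" and s: "Re s > 1"
  obtains D where "(\<lambda>k. of_real (- ln (real (Suc k)) * a (Suc k)) * rpow s (real (Suc k))) sums D"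
    and "(dseries a has_field_derivative D) (at s)"
proof -
  define e where "e = (Re s - 1) / 3"
  have e: "e > 0" "Re s > 1 + 2 * e" using s by (auto simp: e_def field_simps)
  define S where "S = {s. Re s > 1 + 2 * e}"
  have S: "open S" "s \<in> S" using e by (auto simp: S_def open_halfspace_Re_gt)
  obtain g g' where gg: "\<forall>x\<in>S. ((\<lambda>k. of_real (a (Suc k)) * rpow x (real (Suc k))) sums g x) \<and>
      ((\<lambda>k. of_real (a (Suc k)) * (- of_real (ln (real (Suc k))) * rpow x (real (Suc k)))) sums g' x) \<and>
      (g has_field_derivative g' x) (at x)"
  proof (rule series_and_derivative_comparison[OF S(1)])
    show "summable (\<lambda>k. (1 + 1 / e) * real (Suc k) powr (- (1 + e)))"
      using e by (intro summable_mult summable_Suc_powr) auto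
    show "((\<lambda>x. of_real (a (Suc k)) * rpow x (real (Suc k))) has_field_derivative
           of_real (a (Suc k)) * (- of_real (ln (real (Suc k))) * rpow x (real (Suc k)))) (at x)" for k x
      by (rule derivative_eq_intros refl)+ simp
    have "norm (of_real (a (Suc k)) * rpow x (real (Suc k))) \<le> (1 + 1 / e) * real (Suc k) powr (- (1 + e))" 
      if "x \<in> S" for k x
    proof -
      have "norm (of_real (a (Suc k)) * rpow x (real (Suc k))) \<le> (1 + 1 / e) * real (Suc k) powr (e - Re x)"
        by (rule norm_dseries_term_le[OF a e(1)])
      also have "\<dots> \<le> (1 + 1 / e) * real (Suc k) powr (- (1 + e))"
        using that e by (intro mult_left_mono powr_mono) (auto simp: S_def)
      finally show ?thesis .
    qed
    then show "\<forall>\<^sub>F k in sequentially. \<forall>x\<in>S. norm (of_real (a (Suc k)) * rpow x (real (Suc k))) \<le> (1 + 1 / e) * real (Suc k) powr (- (1 + e))"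
      by auto
  qed auto
  have "(g has_field_derivative g' s) (at s)" using gg S by blast
  then have "(dseries a has_field_derivative g' s) (at s)"
  proof (rule has_field_derivative_transform_within_open[OF _ S])
    fix x assume "x \<in> S"
    then show "g x = dseries a x" using gg unfolding dseries_def by (auto simp: sums_iff)
  qed
  moreover have "(\<lambda>k. of_real (- ln (real (Suc k)) * a (Suc k)) * rpow s (real (Suc k))) sums g' s"
    using bspec[OF gg S(2)] by (simp add: mult_ac del: of_nat_Suc)
  ultimately show thesis by (rule that[rotated])
qed

lemma log_bounded_one: "log_bounded (\<lambda>_. 1)"
  by (simp add: log_bounded_def)

lemma log_bounded_ln: "log_bounded (\<lambda>n. ln (real n))"
  by (simp add: log_bounded_def)

lemma log_bounded_mangoldt: "log_bounded mangoldt"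
  unfolding log_bounded_def
proof (intro allI impI)
  fix n :: nat assume "n \<ge> 1"
  then have "mangoldt n \<le> ln (real n)" by (intro mangoldt_le) auto
  then show "\<bar>mangoldt n\<bar> \<le> 1 + ln (real n)" by simp
qed

lemma log_bounded_mangoldt_minus_one: "log_bounded (\<lambda>n. mangoldt n - 1)"
  unfolding log_bounded_def
proof (intro allI impI)
  fix n :: nat assume "n \<ge> 1"
  then have "mangoldt n \<le> ln (real n)" "ln (real n) \<ge> 0" by (auto intro!: mangoldt_le)
  moreover have "(mangoldt n :: real) \<ge> 0" by (rule mangoldt_nonneg)
  ultimately show "\<bar>mangoldt n - 1\<bar> \<le> 1 + ln (real n)" by simp
qed

abbreviation zeta_series :: "complex \<Rightarrow> complex" where
  "zeta_series \<equiv> dseries (\<lambda>_. 1)"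

lemma zeta_series_eq: "Re s > 1 \<Longrightarrow> zeta_series s = zeta_hol s + 1 / (s - 1)"
  using zeta_sums[of s] unfolding dseries_def by (simp add: sums_iff)

lemma infsum_nat_eq_suminf:
  fixes f :: "nat \<Rightarrow> complex"
  assumes "summable (\<lambda>k. norm (f (Suc k)))"
  shows "(\<lambda>n. norm (f n)) summable_on {0<..}" "infsum f {0<..} = (\<Sum>k. f (Suc k))"
proof -
  have bij: "bij_betw Suc UNIV {0<..}"
    by (auto simp: bij_betw_def image_iff gr0_conv_Suc)
  have "(\<lambda>k. norm (f (Suc k))) summable_on UNIV"
    using assms by (simp add: summable_on_UNIV_nonneg_real_iff)
  then show "(\<lambda>n. norm (f n)) summable_on {0<..}"
    using summable_on_reindex_bij_betw[OF bij, of "\<lambda>n. norm (f n)"] by simp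
  have "((\<lambda>k. f (Suc k)) has_sum (\<Sum>k. f (Suc k))) UNIV"
    using norm_summable_imp_has_sum[OF assms] summable_sums[OF summable_norm_cancel[OF assms]] by blast
  then have "infsum (\<lambda>k. f (Suc k)) UNIV = (\<Sum>k. f (Suc k))" by (rule infsumI)
  then show "infsum f {0<..} = (\<Sum>k. f (Suc k))"
    using infsum_reindex_bij_betw[OF bij, of f] by simp
qed

text \<open>The product of two absolutely convergent Dirichlet series, rearranged according to
  the product \<open>n\<close> of the two indices; the coefficient at \<open>n\<close> is the sum of \<open>\<Lambda>\<close> over the divisors of \<open>n\<close>.\<close>

lemma dseries_mangoldt_times_zeta:
  assumes s: "Re s > 1"
  shows "dseries mangoldt s * zeta_series s = dseries (\<lambda>n. ln (real n)) s"
proof -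
  define f where "f n = of_real (mangoldt n) * rpow s (real n)" for n :: nat
  define g where "g n = rpow s (real n)" for n :: nat
  define N :: "nat set" where "N = {0<..}"
  have f: "(\<lambda>n. norm (f n)) summable_on N" "infsum f N = dseries mangoldt s"
    using infsum_nat_eq_suminf[of f] summable_norm_dseries[OF log_bounded_mangoldt s] 
    unfolding N_def f_def dseries_def by auto
  have g: "(\<lambda>n. norm (g n)) summable_on N" "infsum g N = zeta_series s"
    using infsum_nat_eq_suminf[of g] summable_norm_dseries[OF log_bounded_one s] 
    unfolding N_def g_def dseries_def by auto
  have fg: "(\<lambda>x. norm (case x of (d, m) \<Rightarrow> f d * g m)) summable_on N \<times> N"
  proof (subst Infinite_Sum.abs_summable_on_Sigma_iff, intro conjI ballI)
    fix d show "(\<lambda>m. norm (case (d, m) of (d, m) \<Rightarrow> f d * g m)) summable_on N"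
      using g(1) by (auto simp: norm_mult intro: summable_on_cmult_right)
  next
    have "(\<lambda>d. norm (f d) * infsum (\<lambda>m. norm (g m)) N) summable_on N"
      using f(1) by (intro summable_on_cmult_left)
    moreover have "infsum (\<lambda>m. norm (g m)) N \<ge> 0" by (intro infsum_nonneg) auto
    ultimately show "(\<lambda>d. norm (\<Sum>\<^sub>\<infinity>m\<in>N. norm (case (d, m) of (d, m) \<Rightarrow> f d * g m))) summable_on N"
      by (simp add: norm_mult infsum_cmult_right' abs_mult)
  qed
  have "dseries mangoldt s * zeta_series s = infsum (\<lambda>d. infsum (\<lambda>m. f d * g m) N) N"
    by (simp add: infsum_cmult_right' infsum_cmult_left' f(2) g(2))
  also have "\<dots> = infsum (\<lambda>(d, m). f d * g m) (N \<times> N)" (is "_ = ?S")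
    using abs_summable_summable[OF fg] by (rule infsum_Sigma'_banach)
  also have "?S = infsum (\<lambda>n. infsum (\<lambda>d. of_real (mangoldt d) * g n) {d. d dvd n}) N"
  proof -
    have "((\<lambda>(d, m). f d * g m) has_sum ?S) (N \<times> N)"
      using abs_summable_summable[OF fg] by (rule has_sum_infsum)
    also have "?this \<longleftrightarrow> ((\<lambda>(n, d). of_real (mangoldt d) * g n) has_sum ?S) (Sigma N (\<lambda>n. {d. d dvd n}))"
    proof (rule has_sum_reindex_bij_witness[where i = "\<lambda>(n, d). (d, n div d)" and j = "\<lambda>(d, m). (d * m, d)"])
      fix x assume x: "x \<in> N \<times> N"
      obtain d m where [simp]: "x = (d, m)" by (cases x)
      have dm: "d > 0" "m > 0" using x by (auto simp: N_def)
      show "(\<lambda>(n, d). (d, n div d)) ((\<lambda>(d, m). (d * m, d)) x) = x" using dm by simp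
      show "(\<lambda>(d, m). (d * m, d)) x \<in> Sigma N (\<lambda>n. {d. d dvd n})" using dm by (simp add: N_def)
      show "(\<lambda>(n, d). of_real (mangoldt d) * g n) ((\<lambda>(d, m). (d * m, d)) x) = (\<lambda>(d, m). f d * g m) x"
        using dm by (simp add: f_def g_def rpow_mult)
    next
      fix x assume x: "x \<in> Sigma N (\<lambda>n. {d. d dvd n})"
      obtain n d where [simp]: "x = (n, d)" by (cases x)
      have nd: "n > 0" "d dvd n" "d > 0" using x by (auto simp: N_def intro: Nat.gr0I)
      show "(\<lambda>(d, m). (d * m, d)) ((\<lambda>(n, d). (d, n div d)) x) = x" using nd by simp
      show "(\<lambda>(n, d). (d, n div d)) x \<in> N \<times> N" using nd by (auto simp: N_def div_greater_zero_iff dvd_imp_le)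
    qed simp
    finally have hs: "((\<lambda>(n, d). of_real (mangoldt d) * g n) has_sum ?S) (Sigma N (\<lambda>n. {d. d dvd n}))" .
    then have "infsum (\<lambda>n. infsum (\<lambda>d. of_real (mangoldt d) * g n) {d. d dvd n}) N
       = infsum (\<lambda>(n, d). of_real (mangoldt d) * g n) (Sigma N (\<lambda>n. {d. d dvd n}))"
      by (intro infsum_Sigma'_banach) (auto simp: summable_on_def)
    also have "\<dots> = ?S" using hs by (rule infsumI)
    finally show ?thesis ..
  qed
  also have "\<dots> = infsum (\<lambda>n. of_real (ln (real n)) * g n) N"
  proof (rule infsum_cong)
    fix n assume "n \<in> N"
    then have n: "n > 0" by (simp add: N_def)
    have "infsum (\<lambda>d. of_real (mangoldt d) * g n) {d. d dvd n} = (\<Sum>d | d dvd n. of_real (mangoldt d) * g n)"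
      using n by (intro infsum_finite) auto
    also have "\<dots> = (\<Sum>d | d dvd n. mangoldt d) * g n" by (simp add: sum_distrib_right)
    also have "(\<Sum>d | d dvd n. mangoldt d :: complex) = of_real (ln (real n))"
      using n mangoldt_sum[of n, where ?'a = complex] by simp
    finally show "infsum (\<lambda>d. of_real (mangoldt d) * g n) {d. d dvd n} = of_real (ln (real n)) * g n" .
  qed
  also have "\<dots> = dseries (\<lambda>n. ln (real n)) s"
    using infsum_nat_eq_suminf[of "\<lambda>n. of_real (ln (real n)) * g n"] summable_norm_dseries[OF log_bounded_ln s] 
    unfolding N_def g_def dseries_def by auto
  finally show ?thesis .
qed

text \<open>The relation \<open>\<zeta>' = - (\<Sum> \<Lambda>(n) n ^ (-s)) \<zeta>\<close>, in a form that does not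
  divide by \<open>\<zeta>\<close>. Nonvanishing of \<open>\<zeta>\<close> will be deduced from it.\<close>

lemma has_field_derivative_zeta_series:
  assumes s: "Re s > 1"
  shows "(zeta_series has_field_derivative - (dseries mangoldt s * zeta_series s)) (at s)"
proof -
  obtain D where D: "(\<lambda>k. of_real (- ln (real (Suc k)) * 1) * rpow s (real (Suc k))) sums D"
    "(zeta_series has_field_derivative D) (at s)"
    using dseries_derivative[OF log_bounded_one s] by blast
  have "(\<lambda>k. - (of_real (ln (real (Suc k))) * rpow s (real (Suc k)))) sums - dseries (\<lambda>n. ln (real n)) s"
    by (intro sums_minus dseries_sums log_bounded_ln s)
  then have "D = - dseries (\<lambda>n. ln (real n)) s"
    using D(1) by (simp add: sums_iff)
  then show ?thesis using D(2) dseries_mangoldt_times_zeta[OF s] by simp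
qed

section \<open>The 3-4-1 inequality and the logarithmic derivative of zeta\<close>

lemma Re_rpow: "x > 0 \<Longrightarrow> Re (rpow (Complex \<sigma> t) x) = x powr (- \<sigma>) * cos (t * ln x)"
  by (simp add: rpow_def Re_exp powr_def)

text \<open>Termwise from \<open>3 + 4 cos x + cos 2x = 2 (1 + cos x)\<^sup>2\<close> and \<open>\<Lambda> \<ge> 0\<close>.\<close>

lemma mertens_341:
  assumes "\<sigma> > 1"
  shows "3 * Re (dseries mangoldt (Complex \<sigma> 0)) + 4 * Re (dseries mangoldt (Complex \<sigma> t))
         + Re (dseries mangoldt (Complex \<sigma> (2 * t))) \<ge> 0"
proof -
  have s: "(\<lambda>k. mangoldt (Suc k) * (real (Suc k) powr (- \<sigma>) * cos (u * ln (real (Suc k))))) sums Re (dseries mangoldt (Complex \<sigma> u))" for u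
    using sums_Re[OF dseries_sums[OF log_bounded_mangoldt, of "Complex \<sigma> u"]] assms
    by (simp add: Re_rpow del: of_nat_Suc of_real_mangoldt)
  have "(\<lambda>k. 3 * (mangoldt (Suc k) * (real (Suc k) powr (- \<sigma>) * cos (0 * ln (real (Suc k)))))
          + 4 * (mangoldt (Suc k) * (real (Suc k) powr (- \<sigma>) * cos (t * ln (real (Suc k)))))
          + mangoldt (Suc k) * (real (Suc k) powr (- \<sigma>) * cos (2 * t * ln (real (Suc k)))))
      sums (3 * Re (dseries mangoldt (Complex \<sigma> 0)) + 4 * Re (dseries mangoldt (Complex \<sigma> t))
         + Re (dseries mangoldt (Complex \<sigma> (2 * t))))"
    by (intro sums_add sums_mult s)
  moreover have "0 \<le> 3 * (mangoldt (Suc k) * (real (Suc k) powr (- \<sigma>) * cos (0 * ln (real (Suc k)))))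
          + 4 * (mangoldt (Suc k) * (real (Suc k) powr (- \<sigma>) * cos (t * ln (real (Suc k)))))
          + mangoldt (Suc k) * (real (Suc k) powr (- \<sigma>) * cos (2 * t * ln (real (Suc k))))" for k
  proof -
    define c where "c = cos (t * ln (real (Suc k)))"
    define m where "m = mangoldt (Suc k) * real (Suc k) powr (- \<sigma>)"
    have m: "m \<ge> 0" unfolding m_def by (intro mult_nonneg_nonneg mangoldt_nonneg) auto
    have e: "cos (2 * t * ln (real (Suc k))) = 2 * c ^ 2 - 1"
      using cos_double_cos[of "t * ln (real (Suc k))"] by (simp add: c_def mult.assoc)
    have "3 * (mangoldt (Suc k) * (real (Suc k) powr (- \<sigma>) * cos (0 * ln (real (Suc k)))))
          + 4 * (mangoldt (Suc k) * (real (Suc k) powr (- \<sigma>) * cos (t * ln (real (Suc k)))))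
          + mangoldt (Suc k) * (real (Suc k) powr (- \<sigma>) * cos (2 * t * ln (real (Suc k))))
        = m * (3 * 1 + 4 * c + (2 * c ^ 2 - 1))"
      unfolding m_def c_def[symmetric] e by (simp add: algebra_simps del: of_nat_Suc)
    also have "3 * 1 + 4 * c + (2 * c ^ 2 - 1) = 2 * (1 + c) ^ 2" by (simp add: power2_eq_square algebra_simps)
    finally show ?thesis using m by simp
  qed
  ultimately show ?thesis by (rule sums_le[OF _ sums_zero, rotated])
qed

lemma has_vector_derivative_horizontal:
  assumes "(f has_field_derivative D) (at (Complex x t))"
  shows "((\<lambda>x. f (Complex x t)) has_vector_derivative D) (at x within S)"
proof -
  have "((\<lambda>x. of_real x + \<i> * of_real t) has_vector_derivative 1) (at x within S)"
    by (auto intro!: derivative_eq_intros simp: has_vector_derivative_def scaleR_conv_of_real)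
  then have "((\<lambda>x. Complex x t) has_vector_derivative 1) (at x within S)"
    by (simp add: Complex_eq)
  from field_vector_diff_chain_within[OF this has_field_derivative_at_within[OF assms]] 
  show ?thesis by (simp add: o_def)
qed

lemma has_real_derivative_norm_zeta_squared:
  assumes "\<sigma> > 1"
  shows "((\<lambda>\<sigma>. (norm (zeta_series (Complex \<sigma> t)))\<^sup>2) has_real_derivative
          - 2 * Re (dseries mangoldt (Complex \<sigma> t)) * (norm (zeta_series (Complex \<sigma> t)))\<^sup>2) (at \<sigma>)"
proof -
  define f where "f = (\<lambda>\<sigma>. zeta_series (Complex \<sigma> t))"
  define L where "L = dseries mangoldt (Complex \<sigma> t)"
  have f: "(f has_vector_derivative - (L * f \<sigma>)) (at \<sigma>)"
    unfolding f_def L_def using assms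
    by (intro has_vector_derivative_horizontal has_field_derivative_zeta_series) simp
  have Re: "((\<lambda>\<sigma>. Re (f \<sigma>)) has_real_derivative Re (- (L * f \<sigma>))) (at \<sigma>)"
    and Im: "((\<lambda>\<sigma>. Im (f \<sigma>)) has_real_derivative Im (- (L * f \<sigma>))) (at \<sigma>)"
    using bounded_linear.has_vector_derivative[OF bounded_linear_Re f]
      bounded_linear.has_vector_derivative[OF bounded_linear_Im f]
    by (simp_all add: has_real_derivative_iff_has_vector_derivative)
  have "((\<lambda>\<sigma>. (Re (f \<sigma>))\<^sup>2 + (Im (f \<sigma>))\<^sup>2) has_real_derivative 
      2 * Re (f \<sigma>) * Re (- (L * f \<sigma>)) + 2 * Im (f \<sigma>) * Im (- (L * f \<sigma>))) (at \<sigma>)"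
    by (rule derivative_eq_intros Re Im refl)+ simp
  also have "2 * Re (f \<sigma>) * Re (- (L * f \<sigma>)) + 2 * Im (f \<sigma>) * Im (- (L * f \<sigma>))
     = - 2 * Re L * ((Re (f \<sigma>))\<^sup>2 + (Im (f \<sigma>))\<^sup>2)"
    by (simp add: power2_eq_square algebra_simps)
  finally show ?thesis unfolding cmod_power2 f_def L_def .
qed

text \<open>The square of the product \<open>\<bar>\<zeta>(\<sigma>)\<bar>^3 \<bar>\<zeta>(\<sigma> + i t)\<bar>^4 \<bar>\<zeta>(\<sigma> + 2 i t)\<bar>\<close>. With squared norms it is
  differentiable in \<open>\<sigma>\<close> before \<open>\<zeta>\<close> is known to have no zeros.\<close>

definition zeta_341 :: "real \<Rightarrow> real \<Rightarrow> real" where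
  "zeta_341 t \<sigma> = ((norm (zeta_series (Complex \<sigma> 0)))\<^sup>2) ^ 3 * ((norm (zeta_series (Complex \<sigma> t)))\<^sup>2) ^ 4
     * (norm (zeta_series (Complex \<sigma> (2 * t))))\<^sup>2"

text \<open>The derivative is the product itself times a nonpositive number, by \<open>mertens_341\<close>.\<close>

lemma zeta_341_antimono:
  assumes "1 < \<sigma>" "\<sigma> \<le> \<sigma>'"
  shows "zeta_341 t \<sigma>' \<le> zeta_341 t \<sigma>"
proof (rule DERIV_nonpos_imp_nonincreasing[OF assms(2)])
  fix x assume x: "\<sigma> \<le> x"  "x \<le> \<sigma>'"
  then have x1: "x > 1" using assms by simp
  define L where "L u = Re (dseries mangoldt (Complex x u))" for u
  define N where "N u = (norm (zeta_series (Complex x u)))\<^sup>2" for u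
  have d: "((\<lambda>\<sigma>. (norm (zeta_series (Complex \<sigma> u)))\<^sup>2) has_real_derivative (- 2 * L u * N u)) (at x)" for u
    unfolding L_def N_def by (rule has_real_derivative_norm_zeta_squared[OF x1])
  have D: "(zeta_341 t has_real_derivative - (2 * (N 0 ^ 3 * N t ^ 4 * N (2 * t)) * (3 * L 0 + 4 * L t + L (2 * t)))) (at x)"
    unfolding zeta_341_def[abs_def]
    by (rule DERIV_cong[OF DERIV_mult[OF DERIV_mult[OF DERIV_power[OF d[of 0], of 3] DERIV_power[OF d[of t], of 4]] d[of "2 * t"]]])
       (unfold N_def[symmetric], simp add: algebra_simps numeral_eq_Suc)
  moreover have "2 * (N 0 ^ 3 * N t ^ 4 * N (2 * t)) * (3 * L 0 + 4 * L t + L (2 * t)) \<ge> 0"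
    using mertens_341[OF x1, of t] by (intro mult_nonneg_nonneg) (auto simp: N_def L_def)
  ultimately show "\<exists>y. (zeta_341 t has_real_derivative y) (at x) \<and> y \<le> 0" by fastforce
qed

lemma norm_zeta_series_5_ge:
  "norm (zeta_series (Complex 5 t)) \<ge> 3 / 4"
proof -
  define s where "s = Complex 5 t"
  have sm: "summable (\<lambda>k. real (Suc k) powr (-1 - 4))" using summable_Suc_powr[of 5] by simp
  have sums: "(\<lambda>k. rpow s (real (Suc k))) sums zeta_series s"
    using dseries_sums[OF log_bounded_one, of s] by (simp add: s_def)
  then have "(\<lambda>k. rpow s (real (Suc (Suc k)))) sums (zeta_series s - 1)"
    by (subst sums_Suc_iff[of "\<lambda>k. rpow s (real (Suc k))"]) simp
  then have eq: "zeta_series s - 1 = (\<Sum>k. rpow s (real (Suc (Suc k))))" by (simp add: sums_iff)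
  have "norm (\<Sum>k. rpow s (real (Suc (Suc k)))) \<le> (\<Sum>k. real (Suc (Suc k)) powr (-1 - 4))"
  proof (rule norm_suminf_le)
    show "summable (\<lambda>k. real (Suc (Suc k)) powr (-1 - 4))"
      using sm by (subst summable_Suc_iff[of "\<lambda>k. real (Suc k) powr (-1 - 4)"])
    show "norm (rpow s (real (Suc (Suc k)))) \<le> real (Suc (Suc k)) powr (-1 - 4)" for k
      by (subst norm_rpow) (auto simp: s_def)
  qed
  also have "\<dots> = (\<Sum>k. real (Suc k) powr (-1 - 4)) - 1"
    using suminf_split_head[OF sm] by simp
  also have "\<dots> \<le> 1 / 4" using suminf_Suc_powr_le[of 4] by simp
  finally have "norm (zeta_series s - 1) \<le> 1 / 4" unfolding eq .
  moreover have "norm (1::complex) \<le> norm (zeta_series s) + norm (zeta_series s - 1)"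
    using norm_triangle_ineq4[of "zeta_series s" "zeta_series s - 1"] by simp
  ultimately show ?thesis by (simp add: s_def)
qed

text \<open>By monotonicity it is enough to look at \<open>\<sigma> = 5\<close>, where the first term of the series dominates.\<close>

lemma zeta_341_ge:
  assumes "1 < \<sigma>" "\<sigma> \<le> 5"
  shows "zeta_341 t \<sigma> \<ge> 1 / 100"
proof -
  have *: "(norm (zeta_series (Complex 5 u)))\<^sup>2 \<ge> 9 / 16" for u
    using power_mono[OF norm_zeta_series_5_ge[of u], of 2] by (simp add: power2_eq_square)
  have "(9 / 16) ^ 3 * (9 / 16) ^ 4 * (9 / 16) \<le> zeta_341 t 5"
    unfolding zeta_341_def by (intro mult_mono power_mono *) auto
  moreover have "(1 / 100 :: real) \<le> (9 / 16) ^ 3 * (9 / 16) ^ 4 * (9 / 16)" by (simp add: power_divide)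
  ultimately show ?thesis using zeta_341_antimono[OF assms, of t] by linarith
qed

lemma zeta_series_nonzero:
  assumes "1 < Re s" "Re s \<le> 5"
  shows "zeta_series s \<noteq> 0"
  using zeta_341_ge[OF assms, of "Im s"] by (auto simp: zeta_341_def)

lemma norm_zeta_series_real_le:
  assumes "1 < \<sigma>" "\<sigma> \<le> 2"
  shows "norm (zeta_series (Complex \<sigma> 0)) \<le> 2 / (\<sigma> - 1)"
proof -
  define r where "r = \<sigma> - 1"
  have r: "r > 0" using assms by (simp add: r_def)
  have "norm (zeta_series (Complex \<sigma> 0)) \<le> (\<Sum>k. real (Suc k) powr (-1 - r))"
    unfolding dseries_def
  proof (rule norm_suminf_le)
    show "summable (\<lambda>k. real (Suc k) powr (-1 - r))" using summable_Suc_powr[of "1 + r"] r by simp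
  qed (auto simp: norm_rpow r_def simp del: of_nat_Suc)
  also have "\<dots> \<le> 1 + 1 / r" using r by (rule suminf_Suc_powr_le)
  also have "1 \<le> 1 / r" using r assms by (simp add: r_def)
  then have "1 + 1 / r \<le> 2 / r" by simp
  finally show ?thesis by (simp add: r_def)
qed

text \<open>The first derivative of \<open>\<zeta>\<close>, split into the part that Cauchy's inequality controls and the
  contribution of the pole.\<close>

definition zeta' :: "complex \<Rightarrow> complex" where
  "zeta' s = deriv zeta_hol s - 1 / (s - 1)\<^sup>2"

definition zeta'' :: "complex \<Rightarrow> complex" where
  "zeta'' s = deriv (deriv zeta_hol) s + 2 / (s - 1) ^ 3"

lemma has_field_derivative_zeta_hol: "Re s > 1 / 2 \<Longrightarrow> (zeta_hol has_field_derivative deriv zeta_hol s) (at s)"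
  using holomorphic_derivI[OF holomorphic_zeta_hol open_halfspace_Re_gt] by simp

lemma has_field_derivative_deriv_zeta_hol: "Re s > 1 / 2 \<Longrightarrow> (deriv zeta_hol has_field_derivative deriv (deriv zeta_hol) s) (at s)"
  using holomorphic_derivI[OF holomorphic_deriv[OF holomorphic_zeta_hol open_halfspace_Re_gt] open_halfspace_Re_gt] by simp

lemma zeta_series_has_derivative:
  assumes "Re s > 1"
  shows "(zeta_series has_field_derivative zeta' s) (at s)"
proof (rule has_field_derivative_transform_within_open[where S = "{s. Re s > 1}"])
  have s1: "s \<noteq> 1" using assms by auto
  show "((\<lambda>s. zeta_hol s + 1 / (s - 1)) has_field_derivative zeta' s) (at s)"
    using assms s1 unfolding zeta'_def
    by (auto intro!: derivative_eq_intros has_field_derivative_zeta_hol simp: power2_eq_square)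
qed (use assms in \<open>auto simp: open_halfspace_Re_gt zeta_series_eq\<close>)

lemma zeta'_has_derivative:
  assumes "Re s > 1"
  shows "(zeta' has_field_derivative zeta'' s) (at s)"
proof -
  have s1: "s \<noteq> 1" using assms by auto
  have "((\<lambda>s. 1 / (s - 1)\<^sup>2) has_field_derivative - 2 / (s - 1) ^ 3) (at s)"
    using s1 by (auto intro!: derivative_eq_intros simp: power2_eq_square power3_eq_cube divide_simps)
  from DERIV_diff[OF has_field_derivative_deriv_zeta_hol this] show ?thesis
    using assms unfolding zeta'_def[abs_def] zeta''_def by simp
qed

abbreviation mangoldt_defect :: "complex \<Rightarrow> complex" where
  "mangoldt_defect \<equiv> dseries (\<lambda>n. mangoldt n - 1)"

lemma mangoldt_defect_eq:
  assumes "1 < Re s" "Re s \<le> 5"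
  shows "mangoldt_defect s = - zeta' s / zeta_series s - zeta_series s"
proof -
  have nz: "zeta_series s \<noteq> 0" by (rule zeta_series_nonzero[OF assms])
  have "- (dseries mangoldt s * zeta_series s) = zeta' s"
    using DERIV_unique[OF has_field_derivative_zeta_series zeta_series_has_derivative] assms by blast
  then have "dseries mangoldt s * zeta_series s = - zeta' s" by (metis minus_minus)
  then have "dseries mangoldt s = - zeta' s / zeta_series s"
    using nz by (simp add: field_simps)
  moreover have "(\<lambda>k. of_real (mangoldt (Suc k)) * rpow s (real (Suc k)) - of_real 1 * rpow s (real (Suc k))) sums
        (dseries mangoldt s - zeta_series s)"
    using assms by (intro sums_diff dseries_sums log_bounded_mangoldt log_bounded_one)
  then have "mangoldt_defect s = dseries mangoldt s - zeta_series s"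
    unfolding dseries_def[of "\<lambda>n. mangoldt n - 1"] by (simp add: sums_iff algebra_simps)
  ultimately show ?thesis by simp
qed

definition mangoldt_defect' :: "complex \<Rightarrow> complex" where
  "mangoldt_defect' s = - (zeta'' s / zeta_series s) + (zeta' s / zeta_series s)\<^sup>2 - zeta' s"

lemma open_strip: "open {s. a < Re s \<and> Re s < b}"
  by (intro open_Collect_conj open_halfspace_Re_gt open_halfspace_Re_lt)

lemma mangoldt_defect_has_derivative:
  assumes "1 < Re s" "Re s < 5"
  shows "(mangoldt_defect has_field_derivative mangoldt_defect' s) (at s)"
proof (rule has_field_derivative_transform_within_open[where S = "{s. 1 < Re s \<and> Re s < 5}"])
  show "((\<lambda>s. - zeta' s / zeta_series s - zeta_series s) has_field_derivative mangoldt_defect' s) (at s)"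
    using assms zeta_series_nonzero[of s]
    by (auto intro!: derivative_eq_intros zeta'_has_derivative zeta_series_has_derivative
          simp: mangoldt_defect'_def power2_eq_square field_simps)
qed (use assms in \<open>auto simp: open_strip mangoldt_defect_eq\<close>)

definition zeta_reg' :: "complex \<Rightarrow> complex" where
  "zeta_reg' s = zeta_hol s + (s - 1) * deriv zeta_hol s"

definition zeta_reg'' :: "complex \<Rightarrow> complex" where
  "zeta_reg'' s = 2 * deriv zeta_hol s + (s - 1) * deriv (deriv zeta_hol) s"

lemma zeta_reg_nonzero:
  assumes "1 < Re s" "Re s \<le> 5"
  shows "zeta_reg s \<noteq> 0"
proof -
  have s1: "s \<noteq> 1" using assms by auto
  have "zeta_reg s = (s - 1) * zeta_series s"
    using assms s1 by (simp add: zeta_reg_eq zeta_series_eq field_simps)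
  then show ?thesis using s1 zeta_series_nonzero[OF assms] by simp
qed

text \<open>The formula \<open>- \<zeta>'/\<zeta> - \<zeta>\<close> hides that the poles at \<open>s = 1\<close> cancel. Rewritten
  with \<open>(s - 1) \<zeta>(s)\<close>, which is close to 1 there, the function is visibly bounded near \<open>s = 1\<close>.\<close>

lemma mangoldt_defect_eq_near:
  assumes "1 < Re s" "Re s \<le> 5"
  shows "mangoldt_defect s = - zeta_hol s - zeta_reg' s / zeta_reg s"
proof -
  have s1: "s - 1 \<noteq> 0" using assms by auto
  define w where "w = s - 1"
  have w: "w \<noteq> 0" using s1 by (simp add: w_def)
  have Z: "zeta_reg s = (s - 1) * zeta_series s"
    using assms s1 by (simp add: zeta_reg_eq zeta_series_eq field_simps)
  have nz: "zeta_series s \<noteq> 0" by (rule zeta_series_nonzero[OF assms])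
  have z: "zeta_series s = zeta_hol s + 1 / w" using assms by (simp add: zeta_series_eq w_def)
  have "- zeta' s / zeta_series s - zeta_series s = - zeta_hol s - zeta_reg' s / zeta_reg s"
  proof -
    have "zeta' s = (zeta_reg' s - zeta_series s) / w"
      using w by (simp add: zeta'_def zeta_reg'_def z w_def[symmetric] field_simps power2_eq_square)
    then have "- zeta' s / zeta_series s = - zeta_reg' s / (w * zeta_series s) + 1 / w"
      using nz w by (simp add: field_simps)
    then show ?thesis unfolding Z w_def[symmetric] using z by simp
  qed
  then show ?thesis using mangoldt_defect_eq[OF assms] by simp
qed

lemma mangoldt_defect'_eq_near:
  assumes "1 < Re s" "Re s < 5"
  shows "mangoldt_defect' s = - deriv zeta_hol s - zeta_reg'' s / zeta_reg s + (zeta_reg' s / zeta_reg s)\<^sup>2"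
proof -
  have Z: "(zeta_reg has_field_derivative zeta_reg' s) (at s)"
    unfolding zeta_reg_eq[abs_def] zeta_reg'_def using assms
    by (auto intro!: derivative_eq_intros has_field_derivative_zeta_hol)
  have Z': "(zeta_reg' has_field_derivative zeta_reg'' s) (at s)"
    unfolding zeta_reg'_def[abs_def] zeta_reg''_def using assms
    by (auto intro!: derivative_eq_intros has_field_derivative_zeta_hol has_field_derivative_deriv_zeta_hol)
  have nz: "zeta_reg s \<noteq> 0" using assms by (intro zeta_reg_nonzero) auto
  have "(mangoldt_defect has_field_derivative - deriv zeta_hol s - zeta_reg'' s / zeta_reg s + (zeta_reg' s / zeta_reg s)\<^sup>2) (at s)"
  proof (rule has_field_derivative_transform_within_open[where S = "{s. 1 < Re s \<and> Re s < 5}"])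
    show "((\<lambda>s. - zeta_hol s - zeta_reg' s / zeta_reg s) has_field_derivative 
        - deriv zeta_hol s - zeta_reg'' s / zeta_reg s + (zeta_reg' s / zeta_reg s)\<^sup>2) (at s)"
      using assms nz
      by (auto intro!: derivative_eq_intros Z Z' has_field_derivative_zeta_hol simp: power2_eq_square field_simps)
  qed (use assms in \<open>auto simp: open_strip mangoldt_defect_eq_near\<close>)
  from DERIV_unique[OF mangoldt_defect_has_derivative[OF assms] this] show ?thesis .
qed

section \<open>Explicit bounds near the line Re s = 1\<close>

text \<open>The number \<open>M\<close> is an upper bound for \<open>\<zeta>\<close> without its pole up to height \<open>2 T\<close>. All estimates are expressed
  as powers of \<open>M\<close>; since \<open>M \<ge> 1100\<close>, the contribution of the pole at a distance of at least \<open>1/16\<close> is absorbed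
  into the constants.\<close>

context
  fixes T M :: real
  assumes T: "T \<ge> 10000" and M: "M = 11 * sqrt T"
begin

lemma M_ge: "M \<ge> 1100"
  using real_sqrt_le_mono[OF T] real_sqrt_abs[of 100] by (simp add: M)

text \<open>The argument may go up to height \<open>2 T\<close> because the 3-4-1 inequality involves \<open>2 t\<close>; the margin
  \<open>1/4\<close> in each direction is the radius of the circles in Cauchy's inequality.\<close>

lemma norm_zeta_hol_le_M:
  assumes "3 / 4 \<le> Re s" "Re s \<le> 9 / 4" "\<bar>Im s\<bar> \<le> 2 * T + 1 / 4"
  shows "norm (zeta_hol s) \<le> M"
proof -
  have "norm s \<le> 2 * T + 5 / 2" using cmod_le[of s] assms by simp
  then have "25 * (2 * norm s) \<le> 121 * T" using T by simp
  then have "sqrt (25 * (2 * norm s)) \<le> sqrt (121 * T)" by (rule real_sqrt_le_mono)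
  moreover have "sqrt (25::real) = 5" "sqrt (121::real) = 11"
    using real_sqrt_abs[of 5] real_sqrt_abs[of 11] by simp_all
  ultimately have "5 * sqrt (2 * norm s) \<le> M"
    unfolding M real_sqrt_mult by simp
  with norm_zeta_hol_le[OF assms(1)] show ?thesis by linarith
qed

text \<open>Cauchy's inequality on the circle of radius \<open>1/4\<close> about \<open>s\<close>.\<close>

lemma
  assumes s: "1 \<le> Re s" "Re s \<le> 2" "\<bar>Im s\<bar> \<le> 2 * T"
  shows norm_deriv_zeta_hol_le: "norm (deriv zeta_hol s) \<le> 4 * M"
    and norm_deriv2_zeta_hol_le: "norm (deriv (deriv zeta_hol) s) \<le> 32 * M"
proof -
  have sub: "cball s (1 / 4) \<subseteq> {s. Re s > 1 / 2}"
  proof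
    fix w assume "w \<in> cball s (1 / 4)"
    then have "norm (s - w) \<le> 1 / 4" by (simp add: dist_norm)
    then have "\<bar>Re s - Re w\<bar> \<le> 1 / 4" using abs_Re_le_cmod[of "s - w"] by simp
    then have "Re w > 1 / 2" using s by linarith
    then show "w \<in> {s. Re s > 1 / 2}" by simp
  qed
  have hol: "zeta_hol holomorphic_on cball s (1 / 4)" by (rule holomorphic_on_subset[OF holomorphic_zeta_hol sub])
  have "norm ((deriv ^^ n) zeta_hol s) \<le> fact n * M / (1 / 4) ^ n" for n
  proof (rule Cauchy_inequality)
    show "zeta_hol holomorphic_on ball s (1 / 4)" using hol ball_subset_cball holomorphic_on_subset by blast
    show "continuous_on (cball s (1 / 4)) zeta_hol" using hol by (rule holomorphic_on_imp_continuous_on)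
    fix w assume "norm (s - w) = 1 / 4"
    then have "\<bar>Re s - Re w\<bar> \<le> 1 / 4" "\<bar>Im s - Im w\<bar> \<le> 1 / 4" 
      using abs_Re_le_cmod[of "s - w"] abs_Im_le_cmod[of "s - w"] by simp_all
    then show "norm (zeta_hol w) \<le> M" using s by (intro norm_zeta_hol_le_M) linarith+
  qed auto
  from this[of 1] this[of 2] show "norm (deriv zeta_hol s) \<le> 4 * M" "norm (deriv (deriv zeta_hol) s) \<le> 32 * M"
    by (simp_all add: numeral_2_eq_2)
qed

lemma
  assumes s: "1 < Re s" "Re s \<le> 2" "\<bar>Im s\<bar> \<le> 2 * T" and far: "norm (s - 1) \<ge> 1 / 16"
  shows norm_zeta_series_le: "norm (zeta_series s) \<le> 2 * M"
    and norm_zeta'_le: "norm (zeta' s) \<le> 5 * M"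
    and norm_zeta''_le: "norm (zeta'' s) \<le> 40 * M"
proof -
  have inv: "norm (1 / (s - 1)) \<le> 16" using far by (simp add: norm_divide divide_le_eq)
  have h: "norm (zeta_hol s) \<le> M" using s by (intro norm_zeta_hol_le_M) auto
  have "norm (zeta_series s) \<le> norm (zeta_hol s) + norm (1 / (s - 1))"
    using s by (simp only: zeta_series_eq norm_triangle_ineq)
  then show "norm (zeta_series s) \<le> 2 * M" using inv h M_ge by linarith
  have "norm (zeta' s) \<le> norm (deriv zeta_hol s) + norm (1 / (s - 1)) ^ 2"
    unfolding zeta'_def norm_power[symmetric] power_one_over[symmetric]
    using norm_triangle_ineq4 by (metis power_one_over)
  moreover have "norm (1 / (s - 1)) ^ 2 \<le> 16 ^ 2" by (intro power_mono inv) auto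
  moreover have "norm (deriv zeta_hol s) \<le> 4 * M" using s by (intro norm_deriv_zeta_hol_le) auto
  ultimately show "norm (zeta' s) \<le> 5 * M" using M_ge by simp
  have "zeta'' s = deriv (deriv zeta_hol) s + 2 * (1 / (s - 1)) ^ 3"
    by (simp add: zeta''_def power_one_over)
  then have "norm (zeta'' s) \<le> norm (deriv (deriv zeta_hol) s) + norm (2 * (1 / (s - 1)) ^ 3)"
    by (simp only: norm_triangle_ineq)
  also have "norm (2 * (1 / (s - 1)) ^ 3) = 2 * norm (1 / (s - 1)) ^ 3"
    by (simp add: norm_mult norm_power norm_divide)
  finally have "norm (zeta'' s) \<le> norm (deriv (deriv zeta_hol) s) + 2 * norm (1 / (s - 1)) ^ 3" .
  moreover have "norm (1 / (s - 1)) ^ 3 \<le> 16 ^ 3" by (intro power_mono inv) auto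
  moreover have "norm (deriv (deriv zeta_hol) s) \<le> 32 * M" using s by (intro norm_deriv2_zeta_hol_le) auto
  ultimately show "norm (zeta'' s) \<le> 40 * M" using M_ge by simp
qed

lemma norm_minus_one_mono:
  assumes "1 \<le> x" "x \<le> y" "\<bar>t\<bar> \<le> \<bar>u\<bar>"
  shows "norm (Complex x t - 1) \<le> norm (Complex y u - 1)"
proof -
  have "(x - 1)\<^sup>2 \<le> (y - 1)\<^sup>2" using assms by (intro power_mono) auto
  moreover have "t\<^sup>2 \<le> u\<^sup>2" using assms by (simp add: abs_le_square_iff)
  ultimately have "(x - 1)\<^sup>2 + t\<^sup>2 \<le> (y - 1)\<^sup>2 + u\<^sup>2" by (rule add_mono)
  then show ?thesis by (simp add: cmod_def)
qed

text \<open>At distance \<open>\<eta>\<close> from the line, the 3-4-1 inequality gives a lower bound of the size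
  \<open>\<eta> powr (3/4) * M powr (-1/4)\<close>. Taking \<open>\<eta>\<close> proportional to \<open>M ^ (-5)\<close> makes this a whole power of \<open>M\<close>.\<close>

lemma norm_zeta_series_ge_right:
  assumes s: "1 + 1 / (2000000 * M ^ 5) \<le> \<sigma>" "\<sigma> \<le> 2" "\<bar>t\<bar> \<le> T" and far: "norm (Complex \<sigma> t - 1) \<ge> 1 / 16"
  shows "norm (zeta_series (Complex \<sigma> t)) \<ge> 1 / (200000 * M ^ 4)"
proof (rule ccontr)
  define \<eta> where "\<eta> = 1 / (2000000 * M ^ 5)"
  define n where "n = norm (zeta_series (Complex \<sigma> t))"
  assume "\<not> ?thesis"
  then have n: "n \<le> 1 / (200000 * M ^ 4)" "n \<ge> 0" by (auto simp: n_def)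
  have M0: "M > 0" using M_ge by simp
  have \<eta>: "\<eta> > 0" using M0 by (simp add: \<eta>_def)
  have \<sigma>: "\<sigma> > 1" "\<sigma> - 1 \<ge> \<eta>" using s(1) \<eta> unfolding \<eta>_def[symmetric] by linarith+
  have "norm (zeta_series (Complex \<sigma> 0)) \<le> 2 / (\<sigma> - 1)"
    using \<sigma> s by (intro norm_zeta_series_real_le) auto
  also have "\<dots> \<le> 2 / \<eta>" using \<sigma> \<eta> by (intro divide_left_mono) auto
  finally have z0: "norm (zeta_series (Complex \<sigma> 0)) \<le> 2 / \<eta>" .
  have "norm (Complex \<sigma> t - 1) \<le> norm (Complex \<sigma> (2 * t) - 1)" using \<sigma> by (intro norm_minus_one_mono) auto
  then have z2: "norm (zeta_series (Complex \<sigma> (2 * t))) \<le> 2 * M"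
    using s \<sigma> far by (intro norm_zeta_series_le) auto
  \<comment> \<open>The power of M cancels in the resulting upper bound, which leaves a false numerical inequality.\<close>
  have "1 / 100 \<le> zeta_341 t \<sigma>" using \<sigma> s by (intro zeta_341_ge) auto
  also have "\<dots> \<le> ((2 / \<eta>)\<^sup>2) ^ 3 * ((1 / (200000 * M ^ 4))\<^sup>2) ^ 4 * (2 * M)\<^sup>2"
    unfolding zeta_341_def n_def[symmetric] using n z0 z2 \<eta> M0
    by (intro mult_mono power_mono mult_nonneg_nonneg zero_le_power) auto
  also have "\<dots> = 256 * 2000000 ^ 6 / 200000 ^ 8"
    using M0 by (simp add: \<eta>_def field_simps power_mult_distrib flip: power_mult)
  also have "\<dots> < 1 / 100" by simp
  finally show False by simp
qed

text \<open>Closer to the line, move to the right by at most \<open>\<eta>\<close>. As \<open>\<zeta>'\<close> is at most \<open>5 M\<close>, this changes \<open>\<zeta>\<close> by at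
  most half of the lower bound available at \<open>1 + \<eta> + i t\<close>; this is what the constant in \<open>\<eta>\<close> is chosen for.\<close>

lemma norm_zeta_series_ge:
  assumes s: "1 < \<sigma>" "\<sigma> \<le> 2" "\<bar>t\<bar> \<le> T" and far: "norm (Complex \<sigma> t - 1) \<ge> 1 / 16"
  shows "norm (zeta_series (Complex \<sigma> t)) \<ge> 1 / (400000 * M ^ 4)"
proof -
  define \<eta> where "\<eta> = 1 / (2000000 * M ^ 5)"
  have M0: "M \<ge> 1" using M_ge by simp
  have "1 \<le> M ^ 5" using M0 by (rule one_le_power)
  then have "2000000 * M ^ 5 \<ge> 1" by linarith
  then have \<eta>: "\<eta> > 0" "\<eta> \<le> 1" using M0 by (auto simp: \<eta>_def)
  show ?thesis
  proof (cases "1 + \<eta> \<le> \<sigma>")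
    case True
    have "1 / (400000 * M ^ 4) \<le> 1 / (200000 * M ^ 4)" using M0 by (intro divide_left_mono) auto
    then show ?thesis using norm_zeta_series_ge_right[of \<sigma> t] True s far unfolding \<eta>_def by linarith
  next
    case False
    \<comment> \<open>Moving to the right does not get closer to the pole.\<close>
    have far': "norm (Complex x t - 1) \<ge> 1 / 16" if "x \<ge> \<sigma>" for x
      using norm_minus_one_mono[of \<sigma> x t t] that s far by simp
    have "norm (zeta_series (Complex (1 + \<eta>) t) - zeta_series (Complex \<sigma> t)) \<le> (5 * M) * ((1 + \<eta>) - \<sigma>)"
    proof (rule norm_diff_le_vector_derivative[where f' = "\<lambda>x. zeta' (Complex x t)"])
      fix x assume x: "x \<in> {\<sigma>..1 + \<eta>}"
      show "((\<lambda>x. zeta_series (Complex x t)) has_vector_derivative zeta' (Complex x t)) (at x within {\<sigma>..1 + \<eta>})"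
        using x s by (intro has_vector_derivative_horizontal zeta_series_has_derivative) auto
      show "norm (zeta' (Complex x t)) \<le> 5 * M"
        using x s \<eta> T by (intro norm_zeta'_le far') auto
    qed (use False in auto)
    also have "\<dots> \<le> (5 * M) * \<eta>" using s M0 by (intro mult_left_mono) auto
    also have "\<dots> = 1 / (400000 * M ^ 4)" using M0 by (simp add: \<eta>_def field_simps power_numeral_reduce)
    finally have "norm (zeta_series (Complex (1 + \<eta>) t) - zeta_series (Complex \<sigma> t)) \<le> 1 / (400000 * M ^ 4)" .
    moreover have "norm (zeta_series (Complex (1 + \<eta>) t)) \<ge> 1 / (200000 * M ^ 4)"
      using \<eta> s False by (intro norm_zeta_series_ge_right far') (auto simp: \<eta>_def)
    moreover have "1 / (200000 * M ^ 4) = 2 * (1 / (400000 * M ^ 4))" by simp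
    ultimately show ?thesis
      using norm_triangle_ineq2[of "zeta_series (Complex (1 + \<eta>) t)" "zeta_series (Complex \<sigma> t)"] by linarith
  qed
qed

lemma mangoldt_defect_bounds_far:
  assumes s: "1 < Re s" "Re s \<le> 2" "\<bar>Im s\<bar> \<le> T" and far: "norm (s - 1) \<ge> 1 / 16"
  shows "norm (mangoldt_defect s) \<le> 5000000000000 * M ^ 10" "norm (mangoldt_defect' s) \<le> 5000000000000 * M ^ 10"
proof -
  have M1: "M \<ge> 1" using M_ge by simp
  have T2: "\<bar>Im s\<bar> \<le> 2 * T" using s T by simp
  have ge: "norm (zeta_series s) \<ge> 1 / (400000 * M ^ 4)"
    using norm_zeta_series_ge[of "Re s" "Im s"] s far by simp
  have pos: "0 < 1 / (400000 * M ^ 4)" using M1 by simp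
  have q1: "norm (zeta' s / zeta_series s) \<le> 2000000 * M ^ 5"
  proof -
    have "norm (zeta' s / zeta_series s) \<le> (5 * M) / (1 / (400000 * M ^ 4))"
      unfolding norm_divide using norm_zeta'_le[OF s(1,2) T2 far] ge pos M1 by (intro frac_le) auto
    also have "\<dots> = 2000000 * M ^ 5" by (simp add: power_numeral_reduce)
    finally show ?thesis .
  qed
  have q2: "norm (zeta'' s / zeta_series s) \<le> 16000000 * M ^ 5"
  proof -
    have "norm (zeta'' s / zeta_series s) \<le> (40 * M) / (1 / (400000 * M ^ 4))"
      unfolding norm_divide using norm_zeta''_le[OF s(1,2) T2 far] ge pos M1 by (intro frac_le) auto
    also have "\<dots> = 16000000 * M ^ 5" by (simp add: power_numeral_reduce)
    finally show ?thesis .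
  qed
  have pw: "M \<le> M ^ 10" "M ^ 5 \<le> M ^ 10"
    using M1 power_increasing[of 1 10 M] power_increasing[of 5 10 M] by auto
  have "norm (mangoldt_defect s) \<le> norm (zeta' s / zeta_series s) + norm (zeta_series s)"
    using norm_triangle_ineq4[of "- zeta' s / zeta_series s" "zeta_series s"] s
    by (simp add: mangoldt_defect_eq)
  also have "\<dots> \<le> 2000000 * M ^ 5 + 2 * M" using q1 norm_zeta_series_le[OF s(1,2) T2 far] by (rule add_mono)
  also have "\<dots> \<le> 5000000000000 * M ^ 10" using pw M1 by linarith
  finally show "norm (mangoldt_defect s) \<le> 5000000000000 * M ^ 10" .
  have "norm (mangoldt_defect' s) \<le> norm (zeta'' s / zeta_series s) + norm (zeta' s / zeta_series s) ^ 2 + norm (zeta' s)"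
  proof -
    have "norm (mangoldt_defect' s) \<le> norm (- (zeta'' s / zeta_series s) + (zeta' s / zeta_series s)\<^sup>2) + norm (zeta' s)"
      unfolding mangoldt_defect'_def by (rule norm_triangle_ineq4)
    also have "norm (- (zeta'' s / zeta_series s) + (zeta' s / zeta_series s)\<^sup>2)
       \<le> norm (- (zeta'' s / zeta_series s)) + norm ((zeta' s / zeta_series s)\<^sup>2)" by (rule norm_triangle_ineq)
    finally show ?thesis by (simp only: norm_minus_cancel norm_power)
  qed
  also have "\<dots> \<le> 16000000 * M ^ 5 + (2000000 * M ^ 5) ^ 2 + 5 * M"
    using q1 q2 norm_zeta'_le[OF s(1,2) T2 far] by (intro add_mono power_mono) auto
  also have "(2000000 * M ^ 5) ^ 2 = 4000000000000 * M ^ 10" by (simp add: power_mult_distrib flip: power_mult)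
  also have "16000000 * M ^ 5 + 4000000000000 * M ^ 10 + 5 * M \<le> 5000000000000 * M ^ 10" using pw M1 by linarith
  finally show "norm (mangoldt_defect' s) \<le> 5000000000000 * M ^ 10" .
qed

lemma mangoldt_defect_bounds_near:
  assumes s: "1 < Re s" "Re s \<le> 2" and near: "norm (s - 1) \<le> 1 / 16"
  shows "norm (mangoldt_defect s) \<le> 5000000000000 * M ^ 10" "norm (mangoldt_defect' s) \<le> 5000000000000 * M ^ 10"
proof -
  have M1: "M \<ge> 1100" by (rule M_ge)
  have Im: "\<bar>Im s\<bar> \<le> 1 / 16" using abs_Im_le_cmod[of "s - 1"] near by simp
  have ns: "norm s \<le> 17 / 16" using norm_triangle_ineq[of "s - 1" 1] near by simp
  have h: "norm (zeta_hol s) \<le> M" using s T Im by (intro norm_zeta_hol_le_M) auto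
  have h1: "norm (deriv zeta_hol s) \<le> 4 * M" using s T Im by (intro norm_deriv_zeta_hol_le) auto
  have h2: "norm (deriv (deriv zeta_hol) s) \<le> 32 * M" using s T Im by (intro norm_deriv2_zeta_hol_le) auto
  have "norm (zeta_hol s) \<le> 5 * sqrt (2 * norm s)" using s by (intro norm_zeta_hol_le) auto
  also have "sqrt (2 * norm s) \<le> sqrt ((3 / 2)\<^sup>2)" using ns by (intro real_sqrt_le_mono) (simp add: power2_eq_square)
  finally have h8: "norm (zeta_hol s) \<le> 8" by simp
  have "norm ((s - 1) * zeta_hol s) \<le> 1 / 16 * 8"
    unfolding norm_mult using near h8 by (intro mult_mono) auto
  then have Zge: "norm (zeta_reg s) \<ge> 1 / 2"
    using norm_triangle_ineq2[of 1 "- ((s - 1) * zeta_hol s)"] by (simp add: zeta_reg_eq)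
  have Z: "norm (x / zeta_reg s) \<le> 2 * norm x" for x
  proof -
    have "norm x / norm (zeta_reg s) \<le> norm x / (1 / 2)"
      using Zge by (intro divide_left_mono mult_pos_pos) auto
    then show ?thesis by (simp add: norm_divide)
  qed
  have "norm (zeta_reg' s) \<le> norm (zeta_hol s) + norm ((s - 1) * deriv zeta_hol s)"
    unfolding zeta_reg'_def by (rule norm_triangle_ineq)
  also have "norm ((s - 1) * deriv zeta_hol s) \<le> 1 / 16 * (4 * M)"
    unfolding norm_mult using near h1 by (intro mult_mono) auto
  finally have Z1: "norm (zeta_reg' s) \<le> 2 * M" using h M1 by simp
  have "norm (zeta_reg'' s) \<le> norm (2 * deriv zeta_hol s) + norm ((s - 1) * deriv (deriv zeta_hol) s)"
    unfolding zeta_reg''_def by (rule norm_triangle_ineq)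
  also have "norm ((s - 1) * deriv (deriv zeta_hol) s) \<le> 1 / 16 * (32 * M)"
    unfolding norm_mult using near h2 by (intro mult_mono) auto
  finally have Z2: "norm (zeta_reg'' s) \<le> 10 * M" using h1 by (simp add: norm_mult)
  have q1: "norm (zeta_reg' s / zeta_reg s) \<le> 4 * M" using Z[of "zeta_reg' s"] Z1 by simp
  have q2: "norm (zeta_reg'' s / zeta_reg s) \<le> 20 * M" using Z[of "zeta_reg'' s"] Z2 by simp
  have pw: "M \<le> M ^ 10" "M ^ 2 \<le> M ^ 10"
    using M1 power_increasing[of 1 10 M] power_increasing[of 2 10 M] by auto
  have "norm (mangoldt_defect s) \<le> norm (zeta_hol s) + norm (zeta_reg' s / zeta_reg s)"
    using norm_triangle_ineq4[of "- zeta_hol s" "zeta_reg' s / zeta_reg s"] s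
    by (simp add: mangoldt_defect_eq_near)
  also have "\<dots> \<le> 5000000000000 * M ^ 10" using q1 h pw M1 by linarith
  finally show "norm (mangoldt_defect s) \<le> 5000000000000 * M ^ 10" .
  have "norm (mangoldt_defect' s) \<le> norm (deriv zeta_hol s) + norm (zeta_reg'' s / zeta_reg s) + norm (zeta_reg' s / zeta_reg s) ^ 2"
  proof -
    have "norm (mangoldt_defect' s) \<le> norm (- deriv zeta_hol s - zeta_reg'' s / zeta_reg s) + norm ((zeta_reg' s / zeta_reg s)\<^sup>2)"
      using s by (simp only: mangoldt_defect'_eq_near norm_triangle_ineq)
    also have "norm (- deriv zeta_hol s - zeta_reg'' s / zeta_reg s) \<le> norm (- deriv zeta_hol s) + norm (zeta_reg'' s / zeta_reg s)"
      by (rule norm_triangle_ineq4)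
    finally show ?thesis by (simp only: norm_minus_cancel norm_power)
  qed
  also have "\<dots> \<le> 4 * M + 20 * M + (4 * M) ^ 2"
    using q1 q2 h1 by (intro add_mono power_mono) auto
  also have "\<dots> = 24 * M + 16 * M ^ 2" by (simp add: power2_eq_square)
  also have "\<dots> \<le> 5000000000000 * M ^ 10" using pw M1 by linarith
  finally show "norm (mangoldt_defect' s) \<le> 5000000000000 * M ^ 10" .
qed

lemma M_power_10: "5000000000000 * M ^ 10 \<le> 13 * 10 ^ 22 * T ^ 5"
proof -
  have "M ^ 10 = 11 ^ 10 * ((sqrt T)\<^sup>2) ^ 5" by (simp add: M power_mult_distrib flip: power_mult)
  also have "(sqrt T)\<^sup>2 = T" using T by simp
  finally have "5000000000000 * M ^ 10 = (5000000000000 * 11 ^ 10) * T ^ 5" by simp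
  also have "\<dots> \<le> (13 * 10 ^ 22) * T ^ 5" using T by (intro mult_right_mono) auto
  finally show ?thesis .
qed

end

lemma
  assumes "T \<ge> 10000" "1 < Re s" "Re s \<le> 2" "\<bar>Im s\<bar> \<le> T"
  shows norm_mangoldt_defect_le: "norm (mangoldt_defect s) \<le> 13 * 10 ^ 22 * T ^ 5"
    and norm_mangoldt_defect'_le: "norm (mangoldt_defect' s) \<le> 13 * 10 ^ 22 * T ^ 5"
proof -
  have "norm (mangoldt_defect s) \<le> 5000000000000 * (11 * sqrt T) ^ 10 \<and>
        norm (mangoldt_defect' s) \<le> 5000000000000 * (11 * sqrt T) ^ 10"
    using mangoldt_defect_bounds_far[OF assms(1) refl assms(2-4)]
      mangoldt_defect_bounds_near[OF assms(1) refl assms(2,3)] by linarith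
  then show "norm (mangoldt_defect s) \<le> 13 * 10 ^ 22 * T ^ 5" "norm (mangoldt_defect' s) \<le> 13 * 10 ^ 22 * T ^ 5"
    using M_power_10[OF assms(1) refl] by linarith+
qed

section \<open>Sums with a Fejer weight\<close>

text \<open>The Fejer kernel, the square of \<open>sin (w/2) / (w/2)\<close>.\<close>

definition fejer :: "real \<Rightarrow> real" where
  "fejer w = (if w = 0 then 1 else 2 * (1 - cos w) / w\<^sup>2)"

text \<open>The transform of the kernel is a hat function with support in \<open>[-1, 1]\<close>. This compact support is the reason
  for the choice of the kernel.\<close>

lemma has_integral_fejer: "((\<lambda>t. 2 * (1 - t) * cos (t * w)) has_integral fejer w) {0..1}"
proof (cases "w = 0")
  case True
  have "((\<lambda>t. 2 * (1 - t)) has_integral (2 * 1 - 1\<^sup>2) - (2 * 0 - 0\<^sup>2)) {0..1::real}"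
    by (rule fundamental_theorem_of_calculus)
       (auto intro!: derivative_eq_intros simp flip: has_real_derivative_iff_has_vector_derivative)
  then show ?thesis using True by (simp add: fejer_def)
next
  case False
  define F where "F t = 2 * ((1 - t) * sin (t * w) / w - cos (t * w) / w\<^sup>2)" for t
  have "((\<lambda>t. 2 * (1 - t) * cos (t * w)) has_integral F 1 - F 0) {0..1}"
    unfolding F_def using False
    by (intro fundamental_theorem_of_calculus)
       (auto intro!: derivative_eq_intros simp: power2_eq_square field_simps simp flip: has_real_derivative_iff_has_vector_derivative)
  also have "F 1 - F 0 = fejer w" using False by (simp add: F_def fejer_def field_simps)
  finally show ?thesis .
qed

lemma fejer_nonneg: "fejer w \<ge> 0"
  by (simp add: fejer_def)

lemma fejer_le: "w \<noteq> 0 \<Longrightarrow> fejer w \<le> 4 / w\<^sup>2"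
proof -
  assume w: "w \<noteq> 0"
  have "2 * (1 - cos w) \<le> 4" using abs_cos_le_one[of w] unfolding abs_le_iff by (smt (verit))
  then have "2 * (1 - cos w) / w\<^sup>2 \<le> 4 / w\<^sup>2" by (rule divide_right_mono) simp
  then show ?thesis using w by (simp add: fejer_def)
qed

lemma cos_ge_one_minus: "cos x \<ge> 1 - x\<^sup>2 / (2::real)"
proof -
  have "cos x = 1 - 2 * (sin (x / 2))\<^sup>2" using cos_double_sin[of "x / 2"] by simp
  moreover have "(sin (x / 2))\<^sup>2 \<le> (x / 2)\<^sup>2"
    using abs_sin_x_le_abs_x[of "x / 2"] by (simp only: abs_le_square_iff)
  ultimately show ?thesis by (simp add: power_divide)
qed

text \<open>Insert \<open>cos x \<ge> 1 - x\<^sup>2 / 2\<close> into the integral.\<close>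

lemma fejer_ge:
  assumes "\<bar>w\<bar> \<le> 1"
  shows "fejer w \<ge> 11 / 12"
proof -
  define F where "F t = 2 * t - t\<^sup>2 - w\<^sup>2 * (t ^ 3 / 3 - t ^ 4 / 4)" for t :: real
  have "((\<lambda>t. 2 * (1 - t) * (1 - (t * w)\<^sup>2 / 2)) has_integral F 1 - F 0) {0..1}"
    unfolding F_def
    by (intro fundamental_theorem_of_calculus)
       (auto intro!: derivative_eq_intros simp: field_simps numeral_eq_Suc simp flip: has_real_derivative_iff_has_vector_derivative)
  then have "F 1 - F 0 \<le> fejer w"
  proof (rule has_integral_le[OF _ has_integral_fejer])
    fix t :: real assume "t \<in> {0..1}"
    then show "2 * (1 - t) * (1 - (t * w)\<^sup>2 / 2) \<le> 2 * (1 - t) * cos (t * w)"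
      using cos_ge_one_minus[of "t * w"] by (intro mult_left_mono) auto
  qed
  moreover have "w\<^sup>2 \<le> 1" using assms by (simp add: abs_square_le_1)
  ultimately show ?thesis by (simp add: F_def)
qed

text \<open>A parametrization of the vertical segment of height \<open>T\<close> above \<open>1 + \<delta>\<close>. Staying at a positive distance \<open>\<delta>\<close> from
  the line keeps all series absolutely convergent.\<close>

definition vpoint :: "real \<Rightarrow> real \<Rightarrow> real \<Rightarrow> complex" where
  "vpoint \<delta> T t = of_real (1 + \<delta>) + \<i> * of_real (T * t)"

lemma Re_vpoint [simp]: "Re (vpoint \<delta> T t) = 1 + \<delta>"
  and Im_vpoint [simp]: "Im (vpoint \<delta> T t) = T * t"
  by (simp_all add: vpoint_def)

lemma norm_vpoint_ge: "\<delta> \<ge> 0 \<Longrightarrow> norm (vpoint \<delta> T t) \<ge> 1"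
  using abs_Re_le_cmod[of "vpoint \<delta> T t"] by simp

lemma vpoint_nonzero: "\<delta> \<ge> 0 \<Longrightarrow> vpoint \<delta> T t \<noteq> 0"
  using norm_vpoint_ge[of \<delta> T t] by auto

text \<open>Up to a constant factor this is a smoothed indicator function of \<open>y \<le> exp v\<close>. As a superposition
  of the functions \<open>y ^ (-s)\<close> with \<open>s\<close> on the segment, it turns sums over \<open>n\<close> into integrals of Dirichlet series. The
  division by \<open>s\<close> serves to make the derivative in \<open>y\<close> a Fejer kernel times a power of \<open>y\<close>.\<close>

definition fejer_weight :: "real \<Rightarrow> real \<Rightarrow> real \<Rightarrow> real \<Rightarrow> real" where
  "fejer_weight \<delta> T v y = integral {0..1}
     (\<lambda>t. 2 * (1 - t) * Re (exp (\<i> * of_real (T * v * t)) * rpow (vpoint \<delta> T t) y / vpoint \<delta> T t))"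

lemma continuous_on_fejer_weight_integrand:
  assumes "\<delta> \<ge> 0"
  shows "continuous_on S (\<lambda>t. 2 * (1 - t) * Re (exp (\<i> * of_real (T * v * t)) * rpow (vpoint \<delta> T t) y / vpoint \<delta> T t))"
proof -
  have "continuous_on S (\<lambda>t. vpoint \<delta> T t)" unfolding vpoint_def by (intro continuous_intros)
  then show ?thesis unfolding rpow_def
    using vpoint_nonzero[OF assms] by (intro continuous_intros) auto
qed

lemma fejer_weight_integrand_le:
  assumes "\<delta> \<ge> 0" "y > 0" "t \<in> {0..1}"
  shows "\<bar>2 * (1 - t) * Re (exp (\<i> * of_real (T * v * t)) * rpow (vpoint \<delta> T t) y / vpoint \<delta> T t)\<bar> \<le> 2 * y powr (-1 - \<delta>)"
proof -
  have "\<bar>Re (exp (\<i> * of_real (T * v * t)) * rpow (vpoint \<delta> T t) y / vpoint \<delta> T t)\<bar>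
      \<le> norm (exp (\<i> * of_real (T * v * t)) * rpow (vpoint \<delta> T t) y / vpoint \<delta> T t)" by (rule abs_Re_le_cmod)
  also have "\<dots> = y powr (-1 - \<delta>) / norm (vpoint \<delta> T t)"
    using assms by (simp add: norm_mult norm_divide norm_rpow norm_exp_i_times)
  also have "\<dots> \<le> y powr (-1 - \<delta>) / 1"
    using norm_vpoint_ge[OF assms(1), of T t] by (intro divide_left_mono) auto
  finally have "\<bar>2 * (1 - t)\<bar> * \<bar>Re (exp (\<i> * of_real (T * v * t)) * rpow (vpoint \<delta> T t) y / vpoint \<delta> T t)\<bar> \<le> 2 * y powr (-1 - \<delta>)"
    using assms by (intro mult_mono) auto
  then show ?thesis by (simp only: abs_mult)
qed

lemma abs_fejer_weight_le:
  assumes "\<delta> \<ge> 0" "y > 0"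
  shows "\<bar>fejer_weight \<delta> T v y\<bar> \<le> 2 * y powr (-1 - \<delta>)"
proof -
  have "norm (fejer_weight \<delta> T v y) \<le> (2 * y powr (-1 - \<delta>)) * measure lborel (cbox 0 (1::real))"
    unfolding fejer_weight_def
  proof (rule has_integral_bound[OF _ _ ])
    show "((\<lambda>t. 2 * (1 - t) * Re (exp (\<i> * of_real (T * v * t)) * rpow (vpoint \<delta> T t) y / vpoint \<delta> T t)) has_integral
      integral {0..1} (\<lambda>t. 2 * (1 - t) * Re (exp (\<i> * of_real (T * v * t)) * rpow (vpoint \<delta> T t) y / vpoint \<delta> T t))) (cbox 0 1)"
      using continuous_on_fejer_weight_integrand[OF assms(1)]
      by (auto intro!: integrable_integral integrable_continuous_interval)
  qed (use fejer_weight_integrand_le[OF assms] in auto)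
  then show ?thesis by simp
qed

text \<open>Differentiation under the integral sign cancels the denominator \<open>s\<close>, and the
  real part of what remains is the cosine in \<open>has_integral_fejer\<close>.\<close>

lemma has_real_derivative_fejer_weight:
  assumes \<delta>: "\<delta> \<ge> 0" and y: "y > 0"
  shows "(fejer_weight \<delta> T v has_real_derivative - (y powr (-2 - \<delta>) * fejer (T * (v - ln y)))) (at y within S)"
proof -
  define f where "f y t = 2 * (1 - t) * Re (exp (\<i> * of_real (T * v * t)) * rpow (vpoint \<delta> T t) y / vpoint \<delta> T t)" for y t
  define fx where "fx y t = - (y powr (-2 - \<delta>)) * (2 * (1 - t) * cos (t * (T * (v - ln y))))" for y t
  have "((\<lambda>y. integral (cbox 0 1) (f y)) has_real_derivative integral (cbox 0 1) (fx y)) (at y within {0<..})"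
  proof (rule leibniz_rule_field_derivative)
    fix y t :: real assume "y \<in> {0<..}" 
    then have y: "y > 0" by simp
    define s where "s = vpoint \<delta> T t"
    define c where "c = exp (\<i> * of_real (T * v * t))"
    have s0: "s \<noteq> 0" unfolding s_def by (rule vpoint_nonzero[OF \<delta>])
    have "((\<lambda>y. (c / s) * rpow s y) has_vector_derivative (c / s) * (- s * rpow (s + 1) y)) (at y within {0<..})"
      by (intro has_vector_derivative_mult_right has_vector_derivative_rpow y)
    from bounded_linear.has_vector_derivative[OF bounded_linear_Re this]
    have "((\<lambda>y. Re (c * rpow s y / s)) has_real_derivative Re ((c / s) * (- s * rpow (s + 1) y))) (at y within {0<..})"
      by (simp add: has_real_derivative_iff_has_vector_derivative)
    then have "((\<lambda>y. 2 * (1 - t) * Re (c * rpow s y / s)) has_real_derivative 2 * (1 - t) * Re ((c / s) * (- s * rpow (s + 1) y))) (at y within {0<..})"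
      by (rule DERIV_cmult)
    moreover have "Re ((c / s) * (- s * rpow (s + 1) y)) = - (y powr (-2 - \<delta>)) * cos (t * (T * (v - ln y)))"
    proof -
      have "(c / s) * (- s * rpow (s + 1) y) = - (c * rpow (s + 1) y)" using s0 by simp
      also have "c * rpow (s + 1) y = exp (\<i> * of_real (T * v * t) + - (s + 1) * of_real (ln y))"
        by (simp add: c_def rpow_def exp_add[symmetric])
      also have "Re (- \<dots>) = - (exp (- (2 + \<delta>) * ln y) * cos (T * v * t - T * t * ln y))"
        by (simp add: Re_exp s_def)
      also have "exp (- (2 + \<delta>) * ln y) = y powr (-2 - \<delta>)" using y by (simp add: powr_def)
      also have "T * v * t - T * t * ln y = t * (T * (v - ln y))" by (simp add: algebra_simps)
      finally show ?thesis by simp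
    qed
    then have "2 * (1 - t) * Re ((c / s) * (- s * rpow (s + 1) y)) = fx y t"
      unfolding fx_def by simp
    ultimately show "((\<lambda>y. f y t) has_real_derivative fx y t) (at y within {0<..})"
      unfolding f_def c_def s_def by metis
  next
    fix y :: real assume "y \<in> {0<..}"
    show "f y integrable_on cbox 0 1" unfolding f_def
      using continuous_on_fejer_weight_integrand[OF \<delta>] by (auto intro!: integrable_continuous_interval)
  next
    show "continuous_on ({0<..} \<times> cbox 0 1) (\<lambda>(y, t). fx y t)"
      unfolding fx_def case_prod_unfold by (intro continuous_intros) auto
  qed (use y in auto)
  moreover have "integral (cbox 0 1) (fx y) = - (y powr (-2 - \<delta>)) * fejer (T * (v - ln y))"
    unfolding fx_def box_real
    by (rule integral_unique[OF has_integral_mult_right[OF has_integral_fejer]])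
  moreover have "(\<lambda>y. integral (cbox 0 1) (f y)) = fejer_weight \<delta> T v"
    by (simp add: fejer_weight_def[abs_def] f_def[abs_def])
  ultimately have "(fejer_weight \<delta> T v has_real_derivative - (y powr (-2 - \<delta>) * fejer (T * (v - ln y)))) (at y)"
    using y by (simp add: at_within_open[of _ "{0<..}"])
  then show ?thesis by (rule has_field_derivative_at_within)
qed

text \<open>One integration by parts.\<close>

lemma oscillatory_integral_le:
  fixes \<phi> :: "real \<Rightarrow> complex"
  assumes d: "\<And>t. t \<in> {0..1} \<Longrightarrow> (\<phi> has_vector_derivative \<phi>' t) (at t within {0..1})"
    and C: "\<And>t. t \<in> {0..1} \<Longrightarrow> norm (\<phi>' t) \<le> C"
    and A: "norm (\<phi> 0) \<le> A" and fin: "\<phi> 1 = 0" and u: "u > 0"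
  shows "norm (integral {0..1} (\<lambda>t. \<phi> t * exp (\<i> * of_real (u * t)))) \<le> (A + C) / u"
proof -
  define e where "e t = exp (\<i> * of_real (u * t))" for t
  define c where "c = 1 / (\<i> * of_real u)"
  have u0: "\<i> * of_real u \<noteq> 0" using u by simp
  have C0: "C \<ge> 0" using order_trans[OF norm_ge_zero C[of 0]] by simp
  have e: "(e has_vector_derivative (\<i> * of_real u) * e t) (at t within {0..1})" for t
  proof -
    have "((\<lambda>t. \<i> * of_real (u * t)) has_vector_derivative \<i> * of_real (u * 1)) (at t within {0..1})"
      by (intro has_vector_derivative_mult_right has_vector_derivative_of_real) (auto intro!: derivative_eq_intros)
    from field_vector_diff_chain_within[OF this has_field_derivative_at_within[OF DERIV_exp]]
    show ?thesis by (simp add: o_def e_def[abs_def])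
  qed
  have "((\<lambda>t. c * (\<phi> t * e t)) has_vector_derivative c * (\<phi> t * ((\<i> * of_real u) * e t) + \<phi>' t * e t)) (at t within {0..1})"
    if "t \<in> {0..1}" for t
    by (intro has_vector_derivative_mult_right has_vector_derivative_mult d e that)
  then have "((\<lambda>t. c * (\<phi> t * ((\<i> * of_real u) * e t) + \<phi>' t * e t)) has_integral c * (\<phi> 1 * e 1) - c * (\<phi> 0 * e 0)) {0..1}"
    by (intro fundamental_theorem_of_calculus) auto
  then have 1: "((\<lambda>t. \<phi> t * e t + c * (\<phi>' t * e t)) has_integral - (c * \<phi> 0)) {0..1}"
    using u0 fin by (simp add: c_def e_def distrib_left mult.left_commute)
  have "continuous_on {0..1} \<phi>"
    unfolding continuous_on_eq_continuous_within by (intro ballI has_vector_derivative_continuous[OF d])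
  then have "continuous_on {0..1} (\<lambda>t. \<phi> t * e t)"
    unfolding e_def by (intro continuous_intros)
  then have 2: "((\<lambda>t. \<phi> t * e t) has_integral integral {0..1} (\<lambda>t. \<phi> t * e t)) {0..1}"
    by (intro integrable_integral integrable_continuous_interval)
  have I: "((\<lambda>t. c * (\<phi>' t * e t)) has_integral - (c * \<phi> 0) - integral {0..1} (\<lambda>t. \<phi> t * e t)) (cbox 0 1)"
    using has_integral_diff[OF 1 2] by simp
  have "norm (- (c * \<phi> 0) - integral {0..1} (\<lambda>t. \<phi> t * e t)) \<le> (C / u) * measure lborel (cbox 0 (1::real))"
  proof (rule has_integral_bound[OF _ I])
    fix t :: real assume "t \<in> cbox 0 1"
    then show "norm (c * (\<phi>' t * e t)) \<le> C / u"
      using C[of t] u by (simp add: c_def e_def norm_mult norm_divide norm_exp_i_times divide_right_mono)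
  qed (use C0 u in auto)
  moreover have "norm (c * \<phi> 0) \<le> A / u"
    using A u by (simp add: c_def norm_mult norm_divide divide_right_mono)
  ultimately have "norm (integral {0..1} (\<lambda>t. \<phi> t * e t)) \<le> A / u + C / u"
    using norm_triangle_ineq4[of "- (c * \<phi> 0)" "- (c * \<phi> 0) - integral {0..1} (\<lambda>t. \<phi> t * e t)"] by simp
  then show ?thesis by (simp add: e_def add_divide_distrib)
qed

lemma Re_of_real_mult: "Re (of_real r * z) = r * Re z"
  by simp

text \<open>Summation and integration may be exchanged by uniform convergence, which gives an integral of
  \<open>G(s) / s\<close> against \<open>exp (i T v t)\<close> over the segment. Its decay in \<open>v\<close> comes from \<open>oscillatory_integral_le\<close>, and the
  bounds for \<open>G\<close> and \<open>G'\<close> do not depend on \<open>\<delta>\<close>.\<close>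

lemma smoothed_sum_limit:
  assumes \<delta>: "0 < \<delta>" "\<delta> \<le> 1" and T: "T \<ge> 10000" and v: "v > 0"
  obtains S where "(\<lambda>N. \<Sum>k<N. (mangoldt (Suc k) - 1) * fejer_weight \<delta> T v (real (Suc k))) \<longlonglongrightarrow> S"
    and "\<bar>S\<bar> \<le> 65 * 10 ^ 22 * T ^ 5 / v"
proof -
  define B where "B = 13 * 10 ^ 22 * T ^ 5"
  have B0: "B \<ge> 0" using T by (simp add: B_def)
  have \<delta>0: "\<delta> \<ge> 0" using \<delta> by simp
  define e where "e t = exp (\<i> * of_real (T * v * t))" for t
  define f where "f k t = (mangoldt (Suc k) - 1) * (2 * (1 - t) * Re (e t * rpow (vpoint \<delta> T t) (real (Suc k)) / vpoint \<delta> T t))" for k t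
  define g where "g t = 2 * (1 - t) * Re (e t * mangoldt_defect (vpoint \<delta> T t) / vpoint \<delta> T t)" for t
  \<comment> \<open>The majorant for the uniform convergence on the segment.\<close>
  define M where "M k = 2 * norm (of_real (mangoldt (Suc k) - 1) * rpow (of_real (1 + \<delta>)) (real (Suc k)))" for k
  have M: "M k = 2 * \<bar>mangoldt (Suc k) - 1\<bar> * real (Suc k) powr (-1 - \<delta>)" for k
    unfolding M_def norm_mult norm_of_real by (subst norm_rpow) auto
  have sM: "summable M" unfolding M_def
    using \<delta> by (intro summable_mult summable_norm_dseries log_bounded_mangoldt_minus_one) auto
  have f_le: "norm (f k t) \<le> M k" if "t \<in> {0..1}" for k t
  proof -
    have "norm (f k t) \<le> \<bar>mangoldt (Suc k) - 1\<bar> * (2 * real (Suc k) powr (-1 - \<delta>))"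
      unfolding f_def e_def real_norm_def abs_mult[of "mangoldt (Suc k) - 1"] using \<delta> that
      by (intro mult_left_mono fejer_weight_integrand_le) auto
    then show ?thesis by (simp add: M mult_ac)
  qed
  have f_sum: "(\<Sum>k. f k t) = g t" for t
  proof -
    have "(\<lambda>k. of_real (mangoldt (Suc k) - 1) * rpow (vpoint \<delta> T t) (real (Suc k))) sums mangoldt_defect (vpoint \<delta> T t)"
      using \<delta> by (intro dseries_sums log_bounded_mangoldt_minus_one) auto
    then have "(\<lambda>k. (e t / vpoint \<delta> T t) * (of_real (mangoldt (Suc k) - 1) * rpow (vpoint \<delta> T t) (real (Suc k))))
       sums ((e t / vpoint \<delta> T t) * mangoldt_defect (vpoint \<delta> T t))" by (rule sums_mult)
    from sums_mult[OF sums_Re[OF this], of "2 * (1 - t)"]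
    have "(\<lambda>k. 2 * (1 - t) * Re (of_real (mangoldt (Suc k) - 1) * (e t * rpow (vpoint \<delta> T t) (real (Suc k)) / vpoint \<delta> T t))) sums g t"
      by (simp add: g_def mult_ac del: of_nat_Suc of_real_diff)
    then have "(\<lambda>k. f k t) sums g t" unfolding f_def Re_of_real_mult by (simp add: mult_ac del: of_nat_Suc of_real_diff)
    then show ?thesis by (simp add: sums_iff)
  qed
  \<comment> \<open>Hence the weighted sums converge to the integral J of g.\<close>
  have "uniform_limit {0..1} (\<lambda>N t. \<Sum>k<N. f k t) (\<lambda>t. \<Sum>k. f k t) sequentially"
    by (rule Weierstrass_m_test[OF f_le sM])
  then have ul: "uniform_limit {0..1} (\<lambda>N t. \<Sum>k<N. f k t) g sequentially" unfolding f_sum .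
  have cont: "continuous_on {0..1} (f k)" for k
    unfolding f_def[abs_def] e_def by (intro continuous_on_mult_left continuous_on_fejer_weight_integrand \<delta>0)
  obtain I J where IJ: "\<And>N. ((\<lambda>t. \<Sum>k<N. f k t) has_integral I N) {0..1}" "(g has_integral J) {0..1}" "I \<longlonglongrightarrow> J"
    by (rule uniform_limit_integral[OF ul]) (auto intro!: continuous_on_sum cont)
  have "((\<lambda>t. \<Sum>k<N. f k t) has_integral (\<Sum>k<N. (mangoldt (Suc k) - 1) * fejer_weight \<delta> T v (real (Suc k)))) {0..1}" for N
  proof (intro has_integral_sum)
    fix k
    have "((\<lambda>t. 2 * (1 - t) * Re (e t * rpow (vpoint \<delta> T t) (real (Suc k)) / vpoint \<delta> T t)) has_integral
       fejer_weight \<delta> T v (real (Suc k))) {0..1}"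
      unfolding fejer_weight_def e_def using continuous_on_fejer_weight_integrand[OF \<delta>0]
      by (intro integrable_integral integrable_continuous_interval)
    then show "(f k has_integral (mangoldt (Suc k) - 1) * fejer_weight \<delta> T v (real (Suc k))) {0..1}"
      unfolding f_def by (rule has_integral_mult_right)
  qed auto
  then have "I = (\<lambda>N. \<Sum>k<N. (mangoldt (Suc k) - 1) * fejer_weight \<delta> T v (real (Suc k)))"
    using IJ(1) has_integral_unique by blast
  then have lim: "(\<lambda>N. \<Sum>k<N. (mangoldt (Suc k) - 1) * fejer_weight \<delta> T v (real (Suc k))) \<longlonglongrightarrow> J"
    using IJ(3) by (simp only:)
  define q where "q s = mangoldt_defect s / s" for s
  define q' where "q' s = mangoldt_defect' s / s - mangoldt_defect s / s\<^sup>2" for s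
  define \<phi> where "\<phi> t = of_real (2 * (1 - t)) * q (vpoint \<delta> T t)" for t
  define \<phi>' where "\<phi>' t = of_real (2 * (1 - t)) * ((\<i> * of_real T) * q' (vpoint \<delta> T t)) + of_real (- 2) * q (vpoint \<delta> T t)" for t
  have bounds: "norm (q (vpoint \<delta> T t)) \<le> B" "norm (q' (vpoint \<delta> T t)) \<le> 2 * B" if "t \<in> {0..1}" for t
  proof -
    define s where "s = vpoint \<delta> T t"
    have Im: "\<bar>Im s\<bar> \<le> T" using that T by (simp add: s_def abs_mult mult_left_le)
    have G: "norm (mangoldt_defect s) \<le> B" "norm (mangoldt_defect' s) \<le> B"
      unfolding B_def using \<delta> by (intro norm_mangoldt_defect_le norm_mangoldt_defect'_le T Im; simp add: s_def)+
    have s1: "norm s \<ge> 1" unfolding s_def by (rule norm_vpoint_ge[OF \<delta>0])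
    have "norm x / norm s \<le> norm x / 1" for x :: complex using s1 by (intro divide_left_mono) auto
    then have div: "norm (x / s) \<le> norm x" for x by (simp add: norm_divide)
    show "norm (q (vpoint \<delta> T t)) \<le> B"
      using div[of "mangoldt_defect s"] G(1) unfolding q_def s_def[symmetric] by linarith
    have eq: "mangoldt_defect s / s\<^sup>2 = mangoldt_defect s / s / s" by (simp add: power2_eq_square)
    have "norm (mangoldt_defect s / s\<^sup>2) \<le> B"
      unfolding eq using div[of "mangoldt_defect s"] div[of "mangoldt_defect s / s"] G(1) by linarith
    then show "norm (q' (vpoint \<delta> T t)) \<le> 2 * B"
      using norm_triangle_ineq4[of "mangoldt_defect' s / s" "mangoldt_defect s / s\<^sup>2"] div[of "mangoldt_defect' s"] G(2)
      unfolding q'_def s_def[symmetric] by linarith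
  qed
  have "norm (integral {0..1} (\<lambda>t. \<phi> t * exp (\<i> * of_real (T * v * t)))) \<le> (2 * B + (4 * B * T + 2 * B)) / (T * v)"
  proof (rule oscillatory_integral_le)
    fix t :: real assume t: "t \<in> {0..1}"
    define s where "s = vpoint \<delta> T t"
    have s0: "s \<noteq> 0" unfolding s_def by (rule vpoint_nonzero[OF \<delta>0])
    have "((\<lambda>t. of_real (1 + \<delta>) + \<i> * of_real (T * t)) has_vector_derivative 0 + \<i> * of_real (T * 1)) (at t within {0..1})"
      by (intro has_vector_derivative_add has_vector_derivative_const has_vector_derivative_mult_right has_vector_derivative_of_real)
         (auto intro!: derivative_eq_intros)
    then have 1: "(vpoint \<delta> T has_vector_derivative \<i> * of_real T) (at t within {0..1})"
      by (simp add: vpoint_def[abs_def])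
    have "(q has_field_derivative q' s) (at s)"
      unfolding q_def[abs_def] q'_def using s0 \<delta> mangoldt_defect_has_derivative[of s]
      by (auto intro!: derivative_eq_intros simp: s_def power2_eq_square field_simps)
    from field_vector_diff_chain_within[OF 1 has_field_derivative_at_within[OF this[unfolded s_def]]]
    have 2: "((\<lambda>t. q (vpoint \<delta> T t)) has_vector_derivative (\<i> * of_real T) * q' (vpoint \<delta> T t)) (at t within {0..1})"
      by (simp add: o_def)
    have 3: "((\<lambda>t. of_real (2 * (1 - t)) :: complex) has_vector_derivative of_real (- 2)) (at t within {0..1})"
      by (intro has_vector_derivative_of_real) (auto intro!: derivative_eq_intros)
    show "(\<phi> has_vector_derivative \<phi>' t) (at t within {0..1})"
      unfolding \<phi>_def[abs_def] \<phi>'_def by (rule has_vector_derivative_mult[OF 3 2])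
    have "norm (\<phi>' t) \<le> norm (of_real (2 * (1 - t)) * ((\<i> * of_real T) * q' (vpoint \<delta> T t))) + norm (of_real (- 2) * q (vpoint \<delta> T t))"
      unfolding \<phi>'_def by (rule norm_triangle_ineq)
    also have "norm (of_real (2 * (1 - t)) * ((\<i> * of_real T) * q' (vpoint \<delta> T t))) \<le> 2 * ((1 * T) * (2 * B))"
      unfolding norm_mult norm_of_real using t T bounds[OF t] by (intro mult_mono) auto
    also have "norm (of_real (- 2) * q (vpoint \<delta> T t)) \<le> 2 * B"
      unfolding norm_mult norm_of_real using bounds[OF t] by (intro mult_mono) auto
    finally show "norm (\<phi>' t) \<le> 4 * B * T + 2 * B" by (simp add: mult_ac)
  next
    show "norm (\<phi> 0) \<le> 2 * B" using bounds(1)[of 0] by (simp add: \<phi>_def norm_mult)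
  qed (use T v in \<open>auto simp: \<phi>_def\<close>)
  also have "\<dots> \<le> (5 * B * T) / (T * v)"
  proof (rule divide_right_mono)
    have "4 * B \<le> B * T" using mult_left_mono[of 4 T B] T B0 by simp
    then show "2 * B + (4 * B * T + 2 * B) \<le> 5 * B * T" by simp
  qed (use T v in auto)
  also have "\<dots> = 65 * 10 ^ 22 * T ^ 5 / v" using T by (simp add: B_def)
  finally have "norm (integral {0..1} (\<lambda>t. \<phi> t * e t)) \<le> 65 * 10 ^ 22 * T ^ 5 / v"
    by (simp add: e_def)
  moreover have "J = Re (integral {0..1} (\<lambda>t. \<phi> t * e t))"
  proof -
    have c1: "continuous_on {0..1} (vpoint \<delta> T)" unfolding vpoint_def[abs_def] by (intro continuous_intros)
    have "continuous_on {s. 1 < Re s \<and> Re s < 5} mangoldt_defect"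
      by (intro continuous_at_imp_continuous_on ballI DERIV_isCont[OF mangoldt_defect_has_derivative]) auto
    then have c2: "continuous_on {0..1} (\<lambda>t. mangoldt_defect (vpoint \<delta> T t))"
      by (rule continuous_on_compose2[OF _ c1]) (use \<delta> in auto)
    have "continuous_on {0..1} \<phi>" unfolding \<phi>_def[abs_def] q_def
      using vpoint_nonzero[OF \<delta>0] by (intro continuous_intros c1 c2) auto
    then have "(\<lambda>t. \<phi> t * e t) integrable_on {0..1}"
      unfolding e_def by (intro integrable_continuous_interval continuous_intros)
    from has_integral_linear[OF integrable_integral[OF this] bounded_linear_Re]
    have "((\<lambda>t. Re (\<phi> t * e t)) has_integral Re (integral {0..1} (\<lambda>t. \<phi> t * e t))) {0..1}" by (simp add: o_def)
    moreover have "Re (\<phi> t * e t) = g t" for t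
    proof -
      have "\<phi> t * e t = of_real (2 * (1 - t)) * (e t * mangoldt_defect (vpoint \<delta> T t) / vpoint \<delta> T t)"
        by (simp add: \<phi>_def q_def)
      then show ?thesis unfolding g_def by (simp only: Re_of_real_mult)
    qed
    ultimately show ?thesis using IJ(2) has_integral_unique by auto
  qed
  ultimately have "\<bar>J\<bar> \<le> 65 * 10 ^ 22 * T ^ 5 / v"
    using abs_Re_le_cmod[of "integral {0..1} (\<lambda>t. \<phi> t * e t)"] by linarith
  with lim show thesis by (rule that)
qed

section \<open>From the weighted sum to a lower bound for Chebyshev's function\<close>

lemma fejer_weight_antimono:
  assumes "\<delta> \<ge> 0" "0 < x" "x \<le> y"
  shows "fejer_weight \<delta> T v y \<le> fejer_weight \<delta> T v x"
proof (rule DERIV_nonpos_imp_nonincreasing[OF assms(3)])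
  fix z assume "x \<le> z" "z \<le> y"
  then have z: "z > 0" using assms by simp
  have "- (z powr (-2 - \<delta>) * fejer (T * (v - ln z))) \<le> 0" using fejer_nonneg by simp
  then show "\<exists>d. (fejer_weight \<delta> T v has_real_derivative d) (at z) \<and> d \<le> 0"
    using has_real_derivative_fejer_weight[OF assms(1) z] by blast
qed

text \<open>An antiderivative of \<open>4 / (T\<^sup>2 y (v - ln y)\<^sup>2)\<close>, which dominates \<open>y\<close> times minus the
  derivative of the weight.\<close>

definition fejer_tail :: "real \<Rightarrow> real \<Rightarrow> real \<Rightarrow> real" where
  "fejer_tail T v y = 4 / (T\<^sup>2 * (v - ln y))"

text \<open>Compare derivatives on \<open>[k, k + 1]\<close>. In this form the contributions far from
  \<open>exp v\<close> telescope.\<close>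

lemma fejer_weight_step_le_tail:
  assumes \<delta>: "\<delta> \<ge> 0" and T: "T > 0" and k: "k \<ge> 1"
    and ne: "\<And>y. k \<le> y \<Longrightarrow> y \<le> k + 1 \<Longrightarrow> ln y \<noteq> v"
  shows "k * (fejer_weight \<delta> T v k - fejer_weight \<delta> T v (k + 1)) \<le> fejer_tail T v (k + 1) - fejer_tail T v k"
proof -
  \<comment> \<open>The claim says that this function is larger at k + 1 than at k.\<close>
  define g where "g y = fejer_tail T v y + k * fejer_weight \<delta> T v y" for y
  have "g k \<le> g (k + 1)"
  proof (rule DERIV_nonneg_imp_nondecreasing[where f = g])
    fix y assume y: "k \<le> y" "y \<le> k + 1"
    have y0: "y \<ge> 1" using y k by simp
    have d: "v - ln y \<noteq> 0" using ne[OF y] by simp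
    have "(fejer_tail T v has_real_derivative 4 / (T\<^sup>2 * (v - ln y)\<^sup>2) / y) (at y)"
      unfolding fejer_tail_def[abs_def] using y0 d T
      by (auto intro!: derivative_eq_intros simp: divide_simps power2_eq_square)
    from DERIV_add[OF this DERIV_cmult[OF has_real_derivative_fejer_weight[OF \<delta>, of y T v UNIV], of k]]
    have D: "(g has_real_derivative 4 / (T\<^sup>2 * (v - ln y)\<^sup>2) / y + k * (- (y powr (-2 - \<delta>) * fejer (T * (v - ln y))))) (at y)"
      using y0 by (simp add: g_def[abs_def])
    have "fejer (T * (v - ln y)) \<le> 4 / (T * (v - ln y))\<^sup>2" using d T by (intro fejer_le) auto
    then have fj: "fejer (T * (v - ln y)) \<le> 4 / (T\<^sup>2 * (v - ln y)\<^sup>2)" by (simp add: power_mult_distrib)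
    have "k * y powr (-2 - \<delta>) \<le> y * y powr (-2 - \<delta>)" using y by (intro mult_right_mono) auto
    also have "\<dots> = y powr (1 + (-2 - \<delta>))" using y0 by (subst powr_add) auto
    also have "\<dots> \<le> y powr (- 1)" using y0 \<delta> by (intro powr_mono) auto
    also have "\<dots> = 1 / y" using y0 by (simp add: powr_minus_divide)
    finally have "(k * y powr (-2 - \<delta>)) * fejer (T * (v - ln y)) \<le> (1 / y) * (4 / (T\<^sup>2 * (v - ln y)\<^sup>2))"
      using fj y0 by (intro mult_mono fejer_nonneg) auto
    then show "\<exists>D. (g has_real_derivative D) (at y) \<and> 0 \<le> D" using D by (auto simp: mult_ac)
  qed simp
  then show ?thesis by (simp add: g_def algebra_simps)
qed

text \<open>Within logarithmic distance \<open>1 / T\<close> of \<open>exp v\<close> the kernel is at least \<open>11/12\<close>, so the mean value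
  theorem shows that the weight drops substantially there. With \<open>\<delta> = 1 / (100 v)\<close> the factor \<open>exp (- \<delta> v)\<close> is harmless.\<close>

lemma fejer_weight_window_ge:
  assumes v: "v \<ge> 1" and T: "T \<ge> 10000"
  shows "fejer_weight (1 / (100 * v)) T v (exp (v - 1 / T)) - fejer_weight (1 / (100 * v)) T v (exp (v + 1 / T)) \<ge> 17 / 10 / (T * exp v)"
proof -
  define \<delta> where "\<delta> = 1 / (100 * v)"
  have \<delta>: "\<delta> \<ge> 0" "\<delta> \<le> 1 / 100" "\<delta> * v = 1 / 100" using v by (auto simp: \<delta>_def field_simps)
  define a b where "a = exp (v - 1 / T)" and "b = exp (v + 1 / T)"
  have ab: "0 < a" "a < b" using T by (auto simp: a_def b_def)
  obtain z where z: "a < z" "z < b" 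
    "fejer_weight \<delta> T v b - fejer_weight \<delta> T v a = (b - a) * (- (z powr (-2 - \<delta>) * fejer (T * (v - ln z))))"
  proof -
    have "\<exists>z>a. z < b \<and> fejer_weight \<delta> T v b - fejer_weight \<delta> T v a = (b - a) * (- (z powr (-2 - \<delta>) * fejer (T * (v - ln z))))"
      using ab \<delta> by (intro MVT2 has_real_derivative_fejer_weight) auto
    then show ?thesis using that by blast
  qed
  have "ln a < ln z" "ln z < ln b" using z ab by simp_all
  then have "\<bar>v - ln z\<bar> \<le> 1 / T" unfolding a_def b_def by simp
  then have "T * \<bar>v - ln z\<bar> \<le> T * (1 / T)" using T by (intro mult_left_mono) auto
  then have "\<bar>T * (v - ln z)\<bar> \<le> 1" using T by (simp add: abs_mult)
  then have fj: "fejer (T * (v - ln z)) \<ge> 11 / 12" by (rule fejer_ge)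
  have "b powr (-2 - \<delta>) \<le> z powr (-2 - \<delta>)" using z ab \<delta> by (intro powr_mono2') auto
  moreover have "b powr (-2 - \<delta>) = exp (- 2 * v) * exp (- (2 + \<delta>) / T - 1 / 100)"
    using \<delta>(3) by (simp add: b_def powr_def exp_add[symmetric] algebra_simps add_divide_distrib diff_divide_distrib)
  ultimately have zb: "z powr (-2 - \<delta>) \<ge> exp (- 2 * v) * exp (- (2 + \<delta>) / T - 1 / 100)" by simp
  have b_minus_a: "b - a = a * (exp (2 / T) - 1)"
    by (simp add: a_def b_def algebra_simps exp_add[symmetric] add_divide_distrib)
  have "2 / T \<le> exp (2 / T) - 1" using exp_ge_add_one_self[of "2 / T"] by linarith
  then have ba: "b - a \<ge> a * (2 / T)" unfolding b_minus_a using ab by (intro mult_left_mono) auto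
  define c where "c = exp (- (3 + \<delta>) / T - 1 / 100)"
  have "c \<ge> 1 + (- (3 + \<delta>) / T - 1 / 100)" unfolding c_def by (rule exp_ge_add_one_self)
  moreover have "(3 + \<delta>) / T \<le> 4 / 10000" using T \<delta> by (intro frac_le) auto
  moreover have "- (3 + \<delta>) / T = - ((3 + \<delta>) / T)" by (rule minus_divide_left[symmetric])
  ultimately have c: "c \<ge> 98 / 100" by linarith
  have "17 / 10 / (T * exp v) \<le> (2 * 11 / 12 * c) / (T * exp v)"
    using c T by (intro divide_right_mono) auto
  also have "\<dots> = (a * (2 / T)) * ((exp (- 2 * v) * exp (- (2 + \<delta>) / T - 1 / 100)) * (11 / 12))"
  proof -
    have "a * (exp (- 2 * v) * exp (- (2 + \<delta>) / T - 1 / 100)) = exp (- v) * c"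
      by (simp add: a_def c_def exp_add[symmetric] add_divide_distrib diff_divide_distrib algebra_simps)
    then have "(a * (2 / T)) * ((exp (- 2 * v) * exp (- (2 + \<delta>) / T - 1 / 100)) * (11 / 12)) = exp (- v) * c * (2 / T) * (11 / 12)"
      by (simp add: mult_ac)
    then show ?thesis by (simp add: exp_minus field_simps)
  qed
  also have "\<dots> \<le> (b - a) * (z powr (-2 - \<delta>) * fejer (T * (v - ln z)))"
    using ba zb fj ab T by (intro mult_mono) auto
  also have "\<dots> = fejer_weight \<delta> T v a - fejer_weight \<delta> T v b" using z(3) by simp
  finally show ?thesis by (simp add: a_def b_def \<delta>_def)
qed

text \<open>Partial summation; \<open>\<psi>(k) - k\<close> are the partial sums of \<open>\<Lambda> - 1\<close>.\<close>

lemma abel_summation_psi: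
  fixes F :: "nat \<Rightarrow> real"
  shows "(\<Sum>k<Suc m. (mangoldt (Suc k) - 1) * F (Suc k)) =
      (\<Sum>k=1..<Suc m. (chebyshev_psi k - real k) * (F k - F (Suc k))) + (chebyshev_psi (Suc m) - real (Suc m)) * F (Suc m)"
proof (induction m)
  case 0
  then show ?case by (simp add: chebyshev_psi_def)
next
  case (Suc m)
  have "chebyshev_psi (Suc (Suc m)) = chebyshev_psi (Suc m) + mangoldt (Suc (Suc m))"
    by (simp add: chebyshev_psi_def)
  then show ?case
    unfolding sum.lessThan_Suc[of _ "Suc m"] Suc by (simp add: algebra_simps)
qed

text \<open>After partial summation the weighted sum is \<open>\<Sum> (\<psi>(k) - k) w k\<close> with nonnegative
  \<open>w\<close>. In the limit it is at least \<open>-E\<close>, where \<open>E\<close> is the bound of \<open>smoothed_sum_limit\<close>. On the window \<open>exp (v - H) \<le> k \<le> exp (v + H) = n\<close> one has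
  \<open>\<psi>(k) - k \<le> \<psi>(n) - A\<close> by monotonicity, where \<open>A\<close> is the left end, while outside it \<open>\<psi>(k) \<le> 3 k\<close> is enough
  because the kernel is small there. If \<open>\<psi>(n)\<close> were much less than \<open>A\<close>, the window would make the sum too negative.\<close>

lemma chebyshev_psi_lower_smoothed:
  assumes T: "T \<ge> 10000" and H: "H \<ge> 1 / T" and v: "v \<ge> 1" "v \<ge> H" and n: "ln (real n) = v + H" "n \<ge> 1"
  shows "chebyshev_psi n \<ge> exp (v - H) - 1 - (65 * 10 ^ 22 * T ^ 5 / v + 24 / (T\<^sup>2 * H)) * (T * exp v / (17 / 10))"
proof -
  define \<delta> where "\<delta> = 1 / (100 * v)"
  have \<delta>: "\<delta> > 0" "\<delta> \<le> 1" using v by (auto simp: \<delta>_def field_simps)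
  have H0: "H > 0" using H T by (smt (verit) divide_pos_pos)
  define E where "E = 65 * 10 ^ 22 * T ^ 5 / v"
  define R where "R = 8 / (T\<^sup>2 * H)"
  have R2: "R / 2 = 4 / (T\<^sup>2 * H)" by (simp add: R_def)
  \<comment> \<open>The left end of the window; rounding down keeps the intervals [k, k + 1] with k < A at logarithmic distance at least H from v.\<close>
  define A where "A = nat \<lfloor>exp (v - H)\<rfloor>"
  define F where "F k = fejer_weight \<delta> T v (real k)" for k
  define w where "w k = F k - F (Suc k)" for k
  define P where "P k = fejer_tail T v (real k)" for k
  have A1: "A \<ge> 1" "real A \<le> exp (v - H)" "real A \<ge> exp (v - H) - 1"
  proof -
    have "exp (v - H) \<ge> 1" using v by simp
    then show "A \<ge> 1" unfolding A_def by linarith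
    show "real A \<le> exp (v - H)" "real A \<ge> exp (v - H) - 1" unfolding A_def using exp_gt_zero[of "v - H"] by linarith+
  qed
  have n_eq: "real n = exp (v + H)" using n by (metis exp_ln of_nat_0_less_iff less_le_trans zero_less_one)
  have "exp (v - H) \<le> exp (v + H)" using H0 by simp
  then have An: "A \<le> n" using A1 n_eq by (metis of_nat_le_iff order_trans)
  have w0: "w k \<ge> 0" if "k \<ge> 1" for k
    unfolding w_def F_def using \<delta> that fejer_weight_antimono[of \<delta> "real k" "real (Suc k)" T v] by simp
  have lnA: "ln (real A) \<le> v - H" using A1 by (subst ln_exp[symmetric], subst ln_le_cancel_iff) auto
  have step: "real k * w k \<le> P (Suc k) - P k" if "k \<ge> 1" "Suc k \<le> A \<or> k \<ge> Suc n" for k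
  proof -
    have "ln y \<noteq> v" if y: "real k \<le> y" "y \<le> real k + 1" for y
      using \<open>Suc k \<le> A \<or> k \<ge> Suc n\<close>
    proof
      assume "Suc k \<le> A"
      then have "y \<le> real A" using y by linarith
      then have "ln y \<le> ln (real A)" using y \<open>k \<ge> 1\<close> by simp
      then show ?thesis using lnA H0 by linarith
    next
      assume "k \<ge> Suc n"
      then have "real n \<le> y" using y by linarith
      then have "ln (real n) \<le> ln y" using n(2) by simp
      then show ?thesis using n H0 by linarith
    qed
    then have "real k * (fejer_weight \<delta> T v (real k) - fejer_weight \<delta> T v (real k + 1)) \<le> fejer_tail T v (real k + 1) - fejer_tail T v (real k)"
      using \<delta> T that by (intro fejer_weight_step_le_tail) auto
    then show ?thesis by (simp add: w_def F_def P_def add.commute)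
  qed
  have left: "(\<Sum>k=1..<A. real k * w k) \<le> R / 2"
  proof -
    have "(\<Sum>k=1..<A. real k * w k) \<le> (\<Sum>k=1..<A. P (Suc k) - P k)" by (intro sum_mono step) auto
    also have "\<dots> = P A - P 1" using A1 by (intro sum_Suc_diff') auto
    also have "P 1 \<ge> 0" using v by (simp add: P_def fejer_tail_def)
    then have "P A - P 1 \<le> P A" by simp
    also have "P A \<le> 4 / (T\<^sup>2 * H)" unfolding P_def fejer_tail_def
      using lnA H0 T by (intro divide_left_mono mult_left_mono mult_pos_pos) auto
    finally show ?thesis unfolding R2 .
  qed
  have right: "(\<Sum>k=Suc n..<m. real k * w k) \<le> R / 2" if m: "m > n" for m
  proof -
    have "(\<Sum>k=Suc n..<m. real k * w k) \<le> (\<Sum>k=Suc n..<m. P (Suc k) - P k)" by (intro sum_mono step) auto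
    also have "\<dots> = P m - P (Suc n)" using m by (intro sum_Suc_diff') auto
    also have "P m \<le> 0"
    proof -
      have "ln (real n) \<le> ln (real m)" using m n(2) by simp
      then have "v - ln (real m) \<le> 0" using n H0 by linarith
      then show ?thesis unfolding P_def fejer_tail_def by (intro divide_nonneg_nonpos mult_nonneg_nonpos) auto
    qed
    then have "P m - P (Suc n) \<le> - P (Suc n)" by simp
    also have "\<dots> = 4 / (T\<^sup>2 * (ln (real (Suc n)) - v))"
      unfolding P_def fejer_tail_def by (metis minus_diff_eq minus_divide_right mult_minus_right)
    also have "\<dots> \<le> 4 / (T\<^sup>2 * H)"
    proof -
      have "ln (real n) \<le> ln (real (Suc n))" using n(2) by simp
      then have "H \<le> ln (real (Suc n)) - v" using n by linarith
      then show ?thesis using H0 T by (intro divide_left_mono mult_left_mono mult_pos_pos) auto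
    qed
    finally show ?thesis unfolding R2 .
  qed
  define W where "W = F A - F (Suc n)"
  have W: "W \<ge> 17 / 10 / (T * exp v)"
  proof -
    have "exp (v - H) \<le> exp (v - 1 / T)" using H by simp
    then have 1: "F A \<ge> fejer_weight \<delta> T v (exp (v - 1 / T))"
      unfolding F_def using A1 \<delta> by (intro fejer_weight_antimono) linarith+
    have "exp (v + 1 / T) \<le> exp (v + H)" using H by simp
    moreover have "real (Suc n) = real n + 1" by simp
    ultimately have "exp (v + 1 / T) \<le> real (Suc n)" using n_eq by linarith
    then have 2: "F (Suc n) \<le> fejer_weight \<delta> T v (exp (v + 1 / T))"
      unfolding F_def using \<delta> by (intro fejer_weight_antimono) auto
    show ?thesis using 1 2 fejer_weight_window_ge[OF v(1) T] unfolding W_def \<delta>_def by linarith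
  qed
  have mid: "(\<Sum>k=A..<Suc n. (chebyshev_psi k - real k) * w k) \<le> (chebyshev_psi n - real A) * W"
  proof -
    have "(\<Sum>k=A..<Suc n. (chebyshev_psi k - real k) * w k) \<le> (\<Sum>k=A..<Suc n. (chebyshev_psi n - real A) * w k)"
      using A1 by (intro sum_mono mult_right_mono diff_mono chebyshev_psi_mono w0) auto
    also have "\<dots> = (chebyshev_psi n - real A) * (\<Sum>k=A..<Suc n. w k)" by (simp only: sum_distrib_left)
    also have "(\<Sum>k=A..<Suc n. w k) = W"
    proof -
      have "(\<Sum>k=A..<Suc n. w k) = - (\<Sum>k=A..<Suc n. F (Suc k) - F k)"
        unfolding w_def sum_negf[symmetric] by (intro sum.cong) auto
      also have "\<dots> = W" using An by (subst sum_Suc_diff') (auto simp: W_def)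
      finally show ?thesis .
    qed
    finally show ?thesis .
  qed
  have psi_step: "(chebyshev_psi k - real k) * w k \<le> 3 * (real k * w k)" if "k \<ge> 1" for k
  proof -
    have "(chebyshev_psi k - real k) * w k \<le> (3 * real k) * w k"
      using chebyshev_psi_upper[of k] w0[OF that] by (intro mult_right_mono) auto
    then show ?thesis by (simp add: mult.assoc)
  qed
  have main: "(\<Sum>k=1..<Suc m. (chebyshev_psi k - real k) * w k) \<le> 3 * R + (chebyshev_psi n - real A) * W" if m: "m \<ge> n" for m
  proof -
    have "(\<Sum>k=1..<Suc m. (chebyshev_psi k - real k) * w k) =
      (\<Sum>k=1..<A. (chebyshev_psi k - real k) * w k) + (\<Sum>k=A..<Suc n. (chebyshev_psi k - real k) * w k)
      + (\<Sum>k=Suc n..<Suc m. (chebyshev_psi k - real k) * w k)"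
      using A1 An m by (subst sum.atLeastLessThan_concat, simp, simp)+ simp
    also have "(\<Sum>k=1..<A. (chebyshev_psi k - real k) * w k) \<le> (\<Sum>k=1..<A. 3 * (real k * w k))"
      by (intro sum_mono psi_step) auto
    also have "(\<Sum>k=Suc n..<Suc m. (chebyshev_psi k - real k) * w k) \<le> (\<Sum>k=Suc n..<Suc m. 3 * (real k * w k))"
      by (intro sum_mono psi_step) auto
    finally show ?thesis
      using left right[of "Suc m"] m mid unfolding sum_distrib_left[symmetric] by simp
  qed
  have v0: "v > 0" using v by linarith
  obtain S where S: "(\<lambda>N. \<Sum>k<N. (mangoldt (Suc k) - 1) * F (Suc k)) \<longlonglongrightarrow> S" "\<bar>S\<bar> \<le> E"
    unfolding F_def E_def using smoothed_sum_limit[OF \<delta> T v0] by blast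
  \<comment> \<open>The boundary term of the partial summation vanishes in the limit because \<delta> > 0.\<close>
  have bd: "(\<lambda>m. (chebyshev_psi (Suc m) - real (Suc m)) * F (Suc m)) \<longlonglongrightarrow> 0"
  proof (rule Lim_null_comparison)
    show "\<forall>\<^sub>F m in sequentially. norm ((chebyshev_psi (Suc m) - real (Suc m)) * F (Suc m)) \<le> 6 * real (Suc m) powr (- \<delta>)"
    proof (intro always_eventually allI)
      fix m
      define x where "x = real (Suc m)"
      have "0 \<le> x" "chebyshev_psi (Suc m) \<le> 3 * x" "0 \<le> chebyshev_psi (Suc m)"
        using chebyshev_psi_upper[of "Suc m"] by (simp_all add: x_def chebyshev_psi_nonneg)
      then have "\<bar>chebyshev_psi (Suc m) - x\<bar> \<le> 3 * x" by linarith
      then have "\<bar>chebyshev_psi (Suc m) - real (Suc m)\<bar> \<le> 3 * real (Suc m)" by (simp only: x_def)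
      moreover have "\<bar>F (Suc m)\<bar> \<le> 2 * real (Suc m) powr (-1 - \<delta>)"
        unfolding F_def using \<delta> by (intro abs_fejer_weight_le) auto
      ultimately have "\<bar>chebyshev_psi (Suc m) - real (Suc m)\<bar> * \<bar>F (Suc m)\<bar> \<le> (3 * real (Suc m)) * (2 * real (Suc m) powr (-1 - \<delta>))"
        by (intro mult_mono) auto
      also have "\<dots> = 6 * (real (Suc m) powr 1 * real (Suc m) powr (-1 - \<delta>))" by simp
      also have "\<dots> = 6 * real (Suc m) powr (- \<delta>)" by (subst powr_add[symmetric]) simp
      finally show "norm ((chebyshev_psi (Suc m) - real (Suc m)) * F (Suc m)) \<le> 6 * real (Suc m) powr (- \<delta>)"
        by (simp only: real_norm_def abs_mult)
    qed
    have "(\<lambda>m. real (Suc m) powr (- \<delta>)) \<longlonglongrightarrow> 0"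
      using \<delta> by (intro tendsto_neg_powr filterlim_compose[OF filterlim_real_sequentially filterlim_Suc]) auto
    from tendsto_mult_right_zero[OF this] show "(\<lambda>m. 6 * real (Suc m) powr (- \<delta>)) \<longlonglongrightarrow> 0" .
  qed
  have "S - 0 \<le> 3 * R + (chebyshev_psi n - real A) * W"
  proof (rule tendsto_upperbound)
    show "(\<lambda>m. (\<Sum>k<Suc m. (mangoldt (Suc k) - 1) * F (Suc k)) - (chebyshev_psi (Suc m) - real (Suc m)) * F (Suc m)) \<longlonglongrightarrow> S - 0"
      by (intro tendsto_diff bd LIMSEQ_Suc[OF S(1)])
    show "\<forall>\<^sub>F m in sequentially. (\<Sum>k<Suc m. (mangoldt (Suc k) - 1) * F (Suc k)) - (chebyshev_psi (Suc m) - real (Suc m)) * F (Suc m)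
       \<le> 3 * R + (chebyshev_psi n - real A) * W"
      using eventually_ge_at_top[of n]
    proof eventually_elim
      case (elim m)
      show ?case unfolding abel_summation_psi using main[OF elim] unfolding w_def by simp
    qed
  qed simp
  then have AW: "(real A - chebyshev_psi n) * W \<le> E + 3 * R" using S(2) by (simp add: algebra_simps)
  have ER: "E + 3 * R \<ge> 0" using H0 T v by (simp add: E_def R_def)
  have "real A - chebyshev_psi n \<le> (E + 3 * R) * (T * exp v / (17 / 10))"
  proof (cases "real A - chebyshev_psi n \<le> 0")
    case True
    then show ?thesis using ER T by (smt (verit) mult_nonneg_nonneg divide_nonneg_nonneg exp_ge_zero)
  next
    case False
    then have "(real A - chebyshev_psi n) * (17 / 10 / (T * exp v)) \<le> (real A - chebyshev_psi n) * W"
      using W by (intro mult_left_mono) auto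
    also note AW
    finally show ?thesis using T by (simp add: field_simps)
  qed
  moreover have R3: "3 * R = 24 / (T\<^sup>2 * H)" by (simp add: R_def)
  ultimately have "real A - chebyshev_psi n \<le> (E + 24 / (T\<^sup>2 * H)) * (T * exp v / (17 / 10))"
    unfolding R3 by simp
  then show ?thesis using A1(3) unfolding E_def[symmetric] by linarith
qed

section \<open>The mean of the exponents\<close>

text \<open>From \<open>exp (1/5) \<ge> 61/50\<close> one gets \<open>exp 5.2 \<ge> 170\<close>; the bound is the tangent line of \<open>170 exp (u - 5.2)\<close>
  at \<open>u = 5.2\<close>, a value just below \<open>125 / 24\<close>.\<close>

lemma exp_ge_linear:
  fixes u :: real
  assumes "u \<ge> 52 / 10"
  shows "exp u \<ge> 170 * u - 714"
proof -
  have "1 + 1 / 5 + (1 / 5)\<^sup>2 / 2 \<le> exp (1 / 5 :: real)" by (rule exp_lower_Taylor_quadratic) simp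
  then have "(61 / 50) ^ 26 \<le> exp (1 / 5 :: real) ^ 26" by (intro power_mono) (auto simp: power2_eq_square)
  also have "exp (1 / 5 :: real) ^ 26 = exp (52 / 10)" by (simp flip: exp_of_nat_mult)
  finally have "exp (52 / 10 :: real) \<ge> 170" by (simp add: power_divide)
  then have "170 * (1 + (u - 52 / 10)) \<le> exp (52 / 10) * exp (u - 52 / 10)"
    using exp_ge_add_one_self[of "u - 52 / 10"] assms by (intro mult_mono) auto
  also have "exp (52 / 10) * exp (u - 52 / 10) = exp u" by (simp flip: exp_add)
  finally show ?thesis by (simp add: algebra_simps)
qed

text \<open>With \<open>T = \<tau>\<^sup>2\<close> and \<open>H = 3 / \<tau>\<close> the window costs \<open>2 H = 6 / \<tau>\<close> and the tails of
  the kernel about \<open>5 / \<tau>\<close>. The error from the analytic part is of order \<open>10^24 \<tau>^12 / ln n = 10^24 \<tau>^(-12)\<close>, which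
  for \<open>\<tau> \<ge> 170\<close> is below \<open>1 / \<tau>\<close> in spite of the constant.\<close>

lemma chebyshev_psi_asymptotic_lower:
  assumes L: "ln (ln (real n)) \<ge> 125" 
  shows "chebyshev_psi n \<ge> (1 - 12 / exp (ln (ln (real n)) / 24)) * real n"
proof -
  define u where "u = ln (ln (real n)) / 24"
  define \<tau> where "\<tau> = exp u"
  define T H v where "T = \<tau>\<^sup>2" and "H = 3 / \<tau>" and "v = ln (real n) - H"
  have u: "u \<ge> 52 / 10" using L by (simp add: u_def)
  have \<tau>: "\<tau> \<ge> 170" using exp_ge_linear[OF u] u unfolding \<tau>_def by linarith
  have ln0: "ln (real n) > 0"
  proof (rule ccontr)
    assume "\<not> ?thesis"
    moreover have "ln (real n) \<ge> 0" by (cases "n = 0") auto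
    ultimately show False using L by simp
  qed
  have n2: "real n > 1" using ln0 by (cases "n = 0") (auto simp: ln_gt_zero_iff)
  have l: "ln (real n) = \<tau> ^ 24"
  proof -
    have "\<tau> ^ 24 = exp (24 * u)" by (simp add: \<tau>_def flip: exp_of_nat_mult)
    also have "24 * u = ln (ln (real n))" by (simp add: u_def)
    finally show ?thesis using ln0 by simp
  qed
  have T: "T \<ge> 10000"
    using power_mono[of 170 \<tau> 2] \<tau> by (simp add: T_def)
  have H: "H > 0" "H \<le> 1" using \<tau> by (auto simp: H_def)
  have HT: "H \<ge> 1 / T" unfolding H_def T_def using \<tau> by (simp add: field_simps power2_eq_square)
  have \<tau>24: "\<tau> ^ 24 \<ge> 5 * \<tau>" "\<tau> ^ 24 \<ge> 4"
  proof -
    have "\<tau> ^ 2 \<le> \<tau> ^ 24" using \<tau> by (intro power_increasing) auto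
    moreover have "170 * \<tau> \<le> \<tau> ^ 2" using \<tau> by (simp add: power2_eq_square)
    ultimately show "\<tau> ^ 24 \<ge> 5 * \<tau>" "\<tau> ^ 24 \<ge> 4" using \<tau> by linarith+
  qed
  have v: "v \<ge> 1" "v \<ge> H" "v \<ge> \<tau> ^ 24 / 2" using \<tau>24(2) H unfolding v_def l by linarith+
  have nv: "ln (real n) = v + H" by (simp add: v_def)
  have *: "chebyshev_psi n \<ge> exp (v - H) - 1 - (65 * 10 ^ 22 * T ^ 5 / v + 24 / (T\<^sup>2 * H)) * (T * exp v / (17 / 10))"
    using n2 by (intro chebyshev_psi_lower_smoothed T HT v nv) auto
  have ev: "exp v \<le> real n" and evH: "exp (v - H) \<ge> real n * (1 - 6 / \<tau>)"
  proof -
    have "exp v \<le> exp (ln (real n))" using H by (simp add: v_def)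
    then show "exp v \<le> real n" using n2 by simp
    have "exp (v - H) = exp (ln (real n)) * exp (- (2 * H))" by (simp add: v_def flip: exp_add)
    also have "exp (ln (real n)) = real n" using n2 by simp
    finally have eq: "exp (v - H) = real n * exp (- (2 * H))" .
    have "1 - 6 / \<tau> \<le> exp (- (2 * H))" using exp_ge_add_one_self[of "- (2 * H)"] by (simp add: H_def)
    then show "exp (v - H) \<ge> real n * (1 - 6 / \<tau>)" unfolding eq by (intro mult_left_mono) auto
  qed
  have one: "1 \<le> real n * (1 / 5 / \<tau>)"
  proof -
    have "\<tau> ^ 24 \<le> real n" using ln_less_self[of "real n"] n2 l by simp
    then have "5 * \<tau> \<le> real n" using \<tau>24 by linarith
    then show ?thesis using \<tau> by (simp add: field_simps)
  qed
  have E: "65 * 10 ^ 22 * T ^ 5 / v * T \<le> 17 / 10 / \<tau>"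
  proof -
    have "65 * 10 ^ 22 * T ^ 5 / v * T = 65 * 10 ^ 22 * \<tau> ^ 12 / v"
      by (simp add: T_def power_mult[symmetric] power_add[symmetric] flip: power_Suc2)
    also have "\<dots> \<le> 65 * 10 ^ 22 * \<tau> ^ 12 / (\<tau> ^ 24 / 2)"
      using v \<tau> by (intro divide_left_mono mult_pos_pos) auto
    also have "\<dots> = 13 * 10 ^ 23 / (\<tau> ^ 11 * \<tau>)"
      using \<tau> by (simp add: field_simps power_add[symmetric] flip: power_Suc power_Suc2)
    also have "\<dots> \<le> 17 / 10 / \<tau>"
    proof -
      have "170 ^ 11 \<le> \<tau> ^ 11" using \<tau> by (intro power_mono) auto
      then have "13 * 10 ^ 23 \<le> 17 / 10 * \<tau> ^ 11" by simp
      then show ?thesis using \<tau> by (simp add: field_simps)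
    qed
    finally show ?thesis .
  qed
  have R: "24 / (T\<^sup>2 * H) * T = 8 / \<tau>"
    using \<tau> by (simp add: T_def H_def field_simps power2_eq_square)
  have "(65 * 10 ^ 22 * T ^ 5 / v + 24 / (T\<^sup>2 * H)) * (T * exp v / (17 / 10))
      = (65 * 10 ^ 22 * T ^ 5 / v * T + 24 / (T\<^sup>2 * H) * T) / (17 / 10) * exp v"
    by (simp add: algebra_simps)
  also have "\<dots> \<le> (17 / 10 / \<tau> + 8 / \<tau>) / (17 / 10) * real n"
    unfolding R using E ev \<tau> by (intro mult_mono divide_right_mono add_mono) auto
  also have "(17 / 10 / \<tau> + 8 / \<tau>) / (17 / 10) = (97 / 17) / \<tau>" by simp
  finally have "chebyshev_psi n \<ge> real n * (1 - 6 / \<tau>) - real n * (1 / 5 / \<tau>) - (97 / 17) / \<tau> * real n"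
    using * evH one by linarith
  moreover have "real n * (1 - 6 / \<tau>) - real n * (1 / 5 / \<tau>) - (97 / 17) / \<tau> * real n = (1 - (6 + 1 / 5 + 97 / 17) / \<tau>) * real n"
    by (simp add: algebra_simps add_divide_distrib)
  moreover have "(1 - (6 + 1 / 5 + 97 / 17) / \<tau>) * real n \<ge> (1 - 12 / \<tau>) * real n"
    using \<tau> by (intro mult_right_mono diff_left_mono divide_right_mono) auto
  ultimately show ?thesis by (simp add: \<tau>_def u_def)
qed

theorem corollary1p3:
  fixes n :: nat
  assumes "n \<ge> 12602987"
  shows "Upsilon_mean n < ln (real n) * ln (ln (real n)) + 380537 / 17966 * ln (real n) + 1"
proof -
  define l L where "l = ln (real n)" and "L = ln (ln (real n))"
  define K :: real where "K = 380537 / 17966"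
  have K: "K \<ge> 2118 / 100" "K \<le> 2119 / 100" by (auto simp: K_def)
  have l: "l \<ge> 1"
  proof -
    have "exp 1 \<le> real n" using exp_le assms by linarith
    then show ?thesis unfolding l_def using assms by (subst ln_ge_iff) auto
  qed
  then have L: "L \<ge> 0" by (simp add: L_def l_def)
  \<comment> \<open>The threshold 125 lies in the range where both lower bounds for \<psi> suffice.\<close>
  define c where "c = (if L \<le> 125 then 905 / 1000 else 1 - 12 / exp (L / 24))"
  have psi: "chebyshev_psi n \<ge> c * real n"
    using chebyshev_psi_lower[OF assms] chebyshev_psi_asymptotic_lower[of n] by (auto simp: c_def L_def)
  have c: "c * (L + K) \<ge> L + 7"
  proof (cases "L \<le> 125")
    case True
    then show ?thesis using K by (simp add: c_def)
  next
    case False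
    define u where "u = L / 24"
    have u: "u \<ge> 52 / 10" "L = 24 * u" using False by (auto simp: u_def)
    have e: "exp u \<ge> 170 * u - 714" by (rule exp_ge_linear[OF u(1)])
    then have "12 * (L + K) \<le> (K - 7) * (170 * u - 714)"
    proof -
      have "12 * (L + K) \<le> 14 * (170 * u - 714)" using u K by simp
      also have "\<dots> \<le> (K - 7) * (170 * u - 714)" using u K by (intro mult_right_mono) auto
      finally show ?thesis .
    qed
    also have "\<dots> \<le> (K - 7) * exp u" using e K by (intro mult_left_mono) auto
    finally have "12 / exp u * (L + K) \<le> K - 7" by (simp add: field_simps)
    then show ?thesis using False by (simp add: c_def u_def algebra_simps)
  qed
  define p where "p = real (prime_pi n)"
  have pl: "c * real n \<le> p * l" using psi chebyshev_psi_le_prime_pi[of n] unfolding p_def l_def by linarith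
  have "0 < (L + 7) * real n" using L assms by simp
  also have up: "(L + 7) * real n \<le> c * (L + K) * real n" using c by (intro mult_right_mono) auto
  also have "\<dots> = (L + K) * (c * real n)" by simp
  also have low: "\<dots> \<le> (L + K) * (p * l)" using pl L K by (intro mult_left_mono) auto
  finally have "p \<noteq> 0" by auto
  then have p: "p > 0" by (simp add: p_def)
  have "real (Upsilon n) \<le> (L + 7) * real n"
    using Upsilon_le[of n] assms by (simp add: L_def mult.commute)
  also note up
  also have "c * (L + K) * real n = (L + K) * (c * real n)" by simp
  also note low
  also have "(L + K) * (p * l) < (l * L + K * l + 1) * p" using p by (simp add: algebra_simps)
  finally have "real (Upsilon n) / p < l * L + K * l + 1" using p by (simp add: divide_less_eq)
  then show ?thesis by (simp add: Upsilon_mean_def p_def l_def L_def K_def)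
qed

end
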